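(* Let $B$ be a commutative $k$-algebra and let $(A,B,C,\psi,\zeta)$ be an entwining structure over $B$. Then: (a) The secondary Hochschild complex $\mathscr C_\psi^\bullet(A,B,C,\zeta)$, with the operations $\Diamond_i$ and the element $\alpha$ described in the context, is a (right) weak comp algebra. (b) The products $\cup$ and $\sqcup$ on $\mathscr C_\psi^\bullet(A,B,C,\zeta)$ induce cup products on the secondary Hochschild cohomology of the entwining structure $$\cup : HH^m_\psi(A,B,C,\zeta)\otimes HH_\psi^n(A,B,C,\zeta) \longrightarrow HH_\psi^{m+n}(A,B,C,\zeta),$$ $$\sqcup: HH^m_\psi(A,B,C,\zeta)\otimes HH_\psi^n(A,B,C,\zeta) \longrightarrow HH_\psi^{m+n}(A,B,C,\zeta),$$ which are related as follows: for cohomology classes $\bar f\in HH^m_\psi(A,B,C,\zeta)$ and $\bar g\in HH^n_\psi(A,B,C,\zeta)$, $$\bar f\cup\bar g=(-1)^{mn}\,\bar g\sqcup\bar f.$$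
   Context: Conventions: $k$ is a field; $\otimes$ and $\mathrm{Hom}$ are over $k$; $A$ is a unital associative $k$-algebra; $C\neq 0$ is a $k$-coalgebra with coproduct $\Delta(c)=c_1\otimes c_2$ (summation suppressed) and counit $\varepsilon$. For a linear map $\psi:C\otimes A\to A\otimes C$ write $\psi(c\otimes a)=a_\psi\otimes c^\psi$ (summation suppressed). Entwining structure over $k$: a triple $(A,C,\psi)$ with $\psi:C\otimes A\to A\otimes C$ linear such that for all $a,b\in A$, $c\in C$: $(ab)_\psi\otimes c^\psi=a_\psi b_\psi\otimes {c^\psi}^\psi$ [i.e. $\psi\circ(1\otimes\mu)=(\mu\otimes 1)(1\otimes\psi)(\psi\otimes 1)$]; $a_\psi\otimes\Delta(c^\psi)={a_\psi}_\psi\otimes c_1^\psi\otimes c_2^\psi$ [i.e. $(1\otimes\Delta)\psi=(\psi\otimes1)(1\otimes\psi)(\Delta\otimes 1)$]; $a_\psi\varepsilon(c^\psi)=\varepsilon(c)a$; $1_\psi\otimes c^\psi=1\otimes c$. Entwining structure over a commutative $k$-algebra $B$: a tuple $(A,B,C,\psi,\zeta)$ with $(A,C,\psi)$ an entwining structure over $k$ and $\zeta:B\to A$ a $k$-algebra morphism with $\zeta(B)\subseteq Z(A)$ and $\psi(c\otimes\zeta(b))=\zeta(b)\otimes c$ for all $b\in B,c\in C$. Tensor matrices: an element of $C\otimes A^{\otimes n}\otimes B^{\otimes n(n-1)/2}$ is written $c\otimes T$, where $T$ is an $n\times n$ upper triangular array with diagonal entries $a_i\in A$, entries $b_{ij}\in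 B$ in position $(i,j)$ for $i<j$, and $1$ below the diagonal. Passing $c$ successively past $a_1,\dots,a_i$ by $\psi$ is denoted $c\otimes a_1\otimes\cdots\otimes a_i\mapsto a_{1\psi}\otimes\cdots\otimes a_{i\psi}\otimes c^{\psi^i}$. Empty products equal $1$. Complex: $\mathscr C^n_\psi=\mathscr C^n_\psi(A,B,C,\zeta)=\mathrm{Hom}(C\otimes A^{\otimes n}\otimes B^{\otimes n(n-1)/2},A)$ for $n\ge0$ (and $0$ for $n<0$), with differential, for $T$ of size $n+1$, $$\delta^n(f)(c\otimes T)=\zeta\Big(\prod_{j=2}^{n+1}b_{1j}\Big)a_{1\psi}f(c^\psi\otimes T^{(0)})+\sum_{i=1}^n(-1)^if(c\otimes T^{(i)})+(-1)^{n+1}\zeta\Big(\prod_{r=1}^{n}b_{r,n+1}\Big)f(c\otimes T^{(n+1)})a_{n+1},$$ where $T^{(0)}$ (resp. $T^{(n+1)}$) is $T$ with first (resp. last) row and column deleted, and $T^{(i)}$, $1\le i\le n$, is obtained by merging indices $i,i+1$: the merged diagonal entry is $\zeta(b_{i,i+1})a_ia_{i+1}$, for $r<i$ the entry joining $r$ to the merged index is $b_{ri}b_{r,i+1}$, for $s>i+1$ the entry joining the merged index to $s$ is $b_{is}b_{i+1,s}$, other entries unchanged. Its cohomology is $HH^\bullet_\psi(A,B,C,\zeta)$. Operations $\Diamond_i$: for $f\in\mathscr C^m_\psi$, $g\in\mathscr C^n_\psi$, $0\le i\le m-1$ and $T$ of size $m+n-1$, let $I=\{1,\dots,i\}$, $J=\{i+1,\dots,i+n\}$,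 $K=\{i+n+1,\dots,m+n-1\}$, and let $T_J$ be the submatrix of $T$ with rows and columns in $J$. Then $(f\Diamond_ig)(c\otimes T)=f(c_1\otimes T')$, where $T'$ is the tensor matrix of size $m$ with diagonal entries $a_{1\psi},\dots,a_{i\psi},\ g(c_2^{\psi^i}\otimes T_J),\ a_{i+n+1},\dots,a_{m+n-1}$ and off-diagonal entries: $b_{rs}$ for $r<s$ in $I\cup K$; $\prod_{s\in J}b_{rs}$ between $r\in I$ and the $(i+1)$-st place; $\prod_{r\in J}b_{rs}$ between the $(i+1)$-st place and $s\in K$. For $i\ge m$, $f\Diamond_ig=0$. The element $\alpha\in\mathscr C^2_\psi$ is $\alpha\left(c\otimes\begin{pmatrix}a_1&b_{12}\\1&a_2\end{pmatrix}\right)=\varepsilon(c)\zeta(b_{12})a_1a_2$. Cup products on cochains: for $f\in\mathscr C^m_\psi$, $g\in\mathscr C^n_\psi$ and $T$ of size $m+n$, let $T'$ be the upper left $m\times m$ block, $T''$ the lower right $n\times n$ block, $\beta=\prod_{r\le m<s}b_{rs}$. Then $(f\cup g)(c\otimes T)=\zeta(\beta)f(c_1\otimes T'_\psi)\,g(c_2^{\psi^m}\otimes T'')$, where $T'_\psi$ is $T'$ with diagonal $a_{1\psi},\dots,a_{m\psi}$, and $(f\sqcup g)(c\otimes T)=\zeta(\beta)f(c_2\otimes T')_\psi\,g(c_1^\psi\otimes T'')$. Weak comp algebra: a (right) weak comp algebra $(V^\bullet,\Diamond,\alpha)$ over $k$ is a graded vector space $V=\bigoplus_{i\ge0}V^i$,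 an element $\alpha\in V^2$ and operations $\Diamond_i:V^m\otimes V^n\to V^{m+n-1}$, $i\ge0$, such that for $f\in V^m,g\in V^n,h\in V^p$: (1) $f\Diamond_ig=0$ if $i>m-1$; (2) $(f\Diamond_ig)\Diamond_jh=f\Diamond_i(g\Diamond_{j-i}h)$ if $i\le j<n+i$; (3) if $g=\alpha$ or $h=\alpha$, then $(f\Diamond_ig)\Diamond_jh=(f\Diamond_jh)\Diamond_{i+p-1}g$ if $j<i$; (4) $\alpha\Diamond_0\alpha=\alpha\Diamond_1\alpha$. *)

theory Defs
  imports
    Complex_Main
    "HOL-Library.Poly_Mapping"
    "HOL-Library.Set_Algebras"
    "HOL-Library.Function_Algebras"
begin

section \<open>Quotient spaces and linear maps\<close>

text \<open>
  Vector spaces over the field \<open>'k\<close> are given by a type with a scalar multiplication. A quotient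
  by a subspace \<open>N\<close> consists of the cosets \<open>x +o N\<close>. The sum of two cosets is
  their elementwise sum (the library's \<open>+\<close> on sets), so that \<open>+\<close> may be used uniformly below.
\<close>

definition quotient_space :: "'v::ab_group_add set \<Rightarrow> 'v set \<Rightarrow> 'v set set" where
  "quotient_space V N = (\<lambda>x. x +o N) ` V"

text \<open>Adding \<open>N\<close> matters for the scalar 0 only: \<open>0 \<cdot> X\<close> has to be \<open>N\<close>, not \<open>{0}\<close>.\<close>

definition quotient_scale ::
    "('k \<Rightarrow> 'v::ab_group_add \<Rightarrow> 'v) \<Rightarrow> 'v set \<Rightarrow> 'k \<Rightarrow> 'v set \<Rightarrow> 'v set" where
  "quotient_scale s N r X = s r ` X + N"

definition linear_map_on ::
    "'v::plus set \<Rightarrow> ('k \<Rightarrow> 'v \<Rightarrow> 'v) \<Rightarrow> ('k \<Rightarrow> 'w::plus \<Rightarrow> 'w) \<Rightarrow> ('v \<Rightarrow> 'w) \<Rightarrow> bool" where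
  "linear_map_on V s s' f \<longleftrightarrow>
     (\<forall>x\<in>V. \<forall>y\<in>V. f (x + y) = f x + f y) \<and> (\<forall>r. \<forall>x\<in>V. f (s r x) = s' r (f x))"

definition bilinear_map_on ::
    "'u::plus set \<Rightarrow> ('k \<Rightarrow> 'u \<Rightarrow> 'u) \<Rightarrow> 'v::plus set \<Rightarrow> ('k \<Rightarrow> 'v \<Rightarrow> 'v) \<Rightarrow>
     ('k \<Rightarrow> 'w::plus \<Rightarrow> 'w) \<Rightarrow> ('u \<Rightarrow> 'v \<Rightarrow> 'w) \<Rightarrow> bool" where
  "bilinear_map_on U sU V sV sW f \<longleftrightarrow>
     (\<forall>y\<in>V. linear_map_on U sU sW (\<lambda>x. f x y)) \<and> (\<forall>x\<in>U. linear_map_on V sV sW (f x))"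


section \<open>Tensor products\<close>

text \<open>
  The free vector space on \<open>'x\<close> is \<open>'x \<Rightarrow>\<^sub>0 'k\<close>. A tensor product is the quotient of the free vector
  space on the symbols for pure tensors by the subspace spanned by the multilinearity relations.
\<close>

definition free_scale :: "'k::field \<Rightarrow> ('x \<Rightarrow>\<^sub>0 'k) \<Rightarrow> ('x \<Rightarrow>\<^sub>0 'k)" where
  "free_scale r = Poly_Mapping.map ((*) r)"

lemma lookup_free_scale [simp]:
  "Poly_Mapping.lookup (free_scale r u) x = r * Poly_Mapping.lookup u x"
  by (simp add: free_scale_def Poly_Mapping.map.rep_eq when_def)

lemma vector_space_free_scale: "vector_space (free_scale :: 'k::field \<Rightarrow> ('x \<Rightarrow>\<^sub>0 'k) \<Rightarrow> _)"
  by standard (auto intro!: poly_mapping_eqI simp: lookup_add algebra_simps)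

definition gen :: "'x \<Rightarrow> ('x \<Rightarrow>\<^sub>0 'k::field)" where
  "gen x = Poly_Mapping.single x 1"

definition free_extend :: "('k::field \<Rightarrow> 'v::ab_group_add \<Rightarrow> 'v) \<Rightarrow> ('x \<Rightarrow> 'v) \<Rightarrow> ('x \<Rightarrow>\<^sub>0 'k) \<Rightarrow> 'v" where
  "free_extend s F u = (\<Sum>x\<in>Poly_Mapping.keys u. s (Poly_Mapping.lookup u x) (F x))"

text \<open>
  \<open>sweedler s F X\<close> is \<open>\<Sum>\<^sub>j F x\<^sub>j\<close> (in a space with scalar multiplication \<open>s\<close>) for any expression of
  the tensor \<open>X\<close> as a sum of pure tensors \<open>x\<^sub>j\<close>: the value at \<open>X\<close> of the linear map induced by \<open>F\<close>.
  It does not depend on the chosen expression if \<open>F\<close> respects the multilinearity relations.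
  With values in a free vector space, it yields a representative of the resulting tensor.
\<close>

definition sweedler ::
    "('k::field \<Rightarrow> 'v::ab_group_add \<Rightarrow> 'v) \<Rightarrow> ('x \<Rightarrow> 'v) \<Rightarrow> ('x \<Rightarrow>\<^sub>0 'k) set \<Rightarrow> 'v" where
  "sweedler s F X = free_extend s F (SOME u. u \<in> X)"

text \<open>Linearity in one tensor factor; \<open>p\<close> inserts a vector in this factor of a pure tensor.\<close>

definition slot_relations ::
    "('k::field \<Rightarrow> 'v::ab_group_add \<Rightarrow> 'v) \<Rightarrow> ('v \<Rightarrow> 'x) \<Rightarrow> ('x \<Rightarrow>\<^sub>0 'k) set" where
  "slot_relations s p =
     {gen (p (v + w)) - gen (p v) - gen (p w) | v w. True} \<union>
     {gen (p (s r v)) - free_scale r (gen (p v)) | r v. True}"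

definition tensor2_null ::
    "('k::field \<Rightarrow> 'u::ab_group_add \<Rightarrow> 'u) \<Rightarrow> ('k \<Rightarrow> 'v::ab_group_add \<Rightarrow> 'v) \<Rightarrow> ('u \<times> 'v \<Rightarrow>\<^sub>0 'k) set" where
  "tensor2_null sU sV = module.span free_scale
     ((\<Union>v. slot_relations sU (\<lambda>u. (u, v))) \<union> (\<Union>u. slot_relations sV (\<lambda>v. (u, v))))"

definition tensor3_null ::
    "('k::field \<Rightarrow> 'u::ab_group_add \<Rightarrow> 'u) \<Rightarrow> ('k \<Rightarrow> 'v::ab_group_add \<Rightarrow> 'v) \<Rightarrow>
     ('k \<Rightarrow> 'w::ab_group_add \<Rightarrow> 'w) \<Rightarrow> ('u \<times> 'v \<times> 'w \<Rightarrow>\<^sub>0 'k) set" where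
  "tensor3_null sU sV sW = module.span free_scale
     ((\<Union>v w. slot_relations sU (\<lambda>u. (u, v, w))) \<union>
      (\<Union>u w. slot_relations sV (\<lambda>v. (u, v, w))) \<union>
      (\<Union>u v. slot_relations sW (\<lambda>w. (u, v, w))))"

definition tensor2_space ::
    "('k::field \<Rightarrow> 'u::ab_group_add \<Rightarrow> 'u) \<Rightarrow> ('k \<Rightarrow> 'v::ab_group_add \<Rightarrow> 'v) \<Rightarrow> ('u \<times> 'v \<Rightarrow>\<^sub>0 'k) set set" where
  "tensor2_space sU sV = quotient_space UNIV (tensor2_null sU sV)"

abbreviation tensor2_scale ::
    "('k::field \<Rightarrow> 'u::ab_group_add \<Rightarrow> 'u) \<Rightarrow> ('k \<Rightarrow> 'v::ab_group_add \<Rightarrow> 'v) \<Rightarrow>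
     'k \<Rightarrow> ('u \<times> 'v \<Rightarrow>\<^sub>0 'k) set \<Rightarrow> ('u \<times> 'v \<Rightarrow>\<^sub>0 'k) set" where
  "tensor2_scale sU sV \<equiv> quotient_scale free_scale (tensor2_null sU sV)"

definition tensor2 ::
    "('k::field \<Rightarrow> 'u::ab_group_add \<Rightarrow> 'u) \<Rightarrow> ('k \<Rightarrow> 'v::ab_group_add \<Rightarrow> 'v) \<Rightarrow>
     'u \<Rightarrow> 'v \<Rightarrow> ('u \<times> 'v \<Rightarrow>\<^sub>0 'k) set" where
  "tensor2 sU sV u v = gen (u, v) +o tensor2_null sU sV"


section \<open>Algebras, coalgebras and entwining structures\<close>

text \<open>
  The type of the algebra is of sort \<open>{ring, monoid_mult}\<close> and not \<open>ring_1\<close>, since the latter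
  excludes the zero algebra.
\<close>

locale k_algebra = vector_space scale
  for scale :: "'k::field \<Rightarrow> 'a::{ring, monoid_mult} \<Rightarrow> 'a" +
  assumes scale_mult_left: "scale r x * y = scale r (x * y)"
    and scale_mult_right: "x * scale r y = scale r (x * y)"

locale k_coalgebra = vector_space scale
  for scale :: "'k::field \<Rightarrow> 'c::ab_group_add \<Rightarrow> 'c" +
  fixes \<Delta> :: "'c \<Rightarrow> ('c \<times> 'c \<Rightarrow>\<^sub>0 'k) set"
    and \<epsilon> :: "'c \<Rightarrow> 'k"
  assumes comul_closed: "\<Delta> c \<in> tensor2_space scale scale"
    and comul_linear: "linear_map_on UNIV scale (tensor2_scale scale scale) \<Delta>"
    and counit_linear: "linear_map_on UNIV scale (*) \<epsilon>"
    and coassoc: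
      "sweedler free_scale (\<lambda>(x, y). sweedler free_scale (\<lambda>(x\<^sub>1, x\<^sub>2). gen (x\<^sub>1, x\<^sub>2, y)) (\<Delta> x)) (\<Delta> c)
         +o tensor3_null scale scale scale
       = sweedler free_scale (\<lambda>(x, y). sweedler free_scale (\<lambda>(y\<^sub>1, y\<^sub>2). gen (x, y\<^sub>1, y\<^sub>2)) (\<Delta> y)) (\<Delta> c)
         +o tensor3_null scale scale scale"
    and counit_left: "sweedler scale (\<lambda>(x, y). scale (\<epsilon> x) y) (\<Delta> c) = c"
    and counit_right: "sweedler scale (\<lambda>(x, y). scale (\<epsilon> y) x) (\<Delta> c) = c"

record (overloaded) ('k, 'a, 'b, 'c) entwining_data =
  scaleA :: "'k \<Rightarrow> 'a \<Rightarrow> 'a"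
  scaleB :: "'k \<Rightarrow> 'b \<Rightarrow> 'b"
  scaleC :: "'k \<Rightarrow> 'c \<Rightarrow> 'c"
  comul :: "'c \<Rightarrow> ('c \<times> 'c \<Rightarrow>\<^sub>0 'k::zero) set"
  counit :: "'c \<Rightarrow> 'k"
  entw :: "('c \<times> 'a \<Rightarrow>\<^sub>0 'k) set \<Rightarrow> ('a \<times> 'c \<Rightarrow>\<^sub>0 'k) set"
  zeta :: "'b \<Rightarrow> 'a"

definition psi ::
    "('k::field, 'a::{ring, monoid_mult}, 'b, 'c::ab_group_add) entwining_data \<Rightarrow>
     'c \<Rightarrow> 'a \<Rightarrow> ('a \<times> 'c \<Rightarrow>\<^sub>0 'k) set" where
  "psi E c a = entw E (tensor2 (scaleC E) (scaleA E) c a)"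

locale entwining_structure =
  A: k_algebra "scaleA E" + C: k_coalgebra "scaleC E" "comul E" "counit E"
  for E :: "('k::field, 'a::{ring, monoid_mult}, 'b, 'c::ab_group_add) entwining_data" +
  assumes C_nonzero: "\<exists>c::'c. c \<noteq> 0"
    and entw_closed:
      "X \<in> tensor2_space (scaleC E) (scaleA E) \<Longrightarrow> entw E X \<in> tensor2_space (scaleA E) (scaleC E)"
    and entw_linear:
      "linear_map_on (tensor2_space (scaleC E) (scaleA E))
         (tensor2_scale (scaleC E) (scaleA E)) (tensor2_scale (scaleA E) (scaleC E)) (entw E)"
    and entw_mult:
      "psi E c (a * b)
       = sweedler free_scale (\<lambda>(x, c'). sweedler free_scale (\<lambda>(y, c''). gen (x * y, c'')) (psi E c' b)) (psi E c a)
         +o tensor2_null (scaleA E) (scaleC E)"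
    and entw_comul:
      "sweedler free_scale (\<lambda>(x, c'). sweedler free_scale (\<lambda>(c\<^sub>1, c\<^sub>2). gen (x, c\<^sub>1, c\<^sub>2)) (comul E c')) (psi E c a)
         +o tensor3_null (scaleA E) (scaleC E) (scaleC E)
       = sweedler free_scale (\<lambda>(c\<^sub>1, c\<^sub>2). sweedler free_scale (\<lambda>(x, c\<^sub>2').
           sweedler free_scale (\<lambda>(y, c\<^sub>1'). gen (y, c\<^sub>1', c\<^sub>2')) (psi E c\<^sub>1 x)) (psi E c\<^sub>2 a)) (comul E c)
         +o tensor3_null (scaleA E) (scaleC E) (scaleC E)"
    and entw_counit:
      "sweedler (scaleA E) (\<lambda>(x, c'). scaleA E (counit E c') x) (psi E c a) = scaleA E (counit E c) a"
    and entw_unit: "psi E c 1 = tensor2 (scaleA E) (scaleC E) 1 c"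

locale entwining_structure_over = entwining_structure E + B: k_algebra "scaleB E"
  for E :: "('k::field, 'a::{ring, monoid_mult}, 'b::{comm_ring, comm_monoid_mult},
             'c::ab_group_add) entwining_data" +
  assumes zeta_linear: "linear_map_on UNIV (scaleB E) (scaleA E) (zeta E)"
    and zeta_mult: "zeta E (b * b') = zeta E b * zeta E b'"
    and zeta_one: "zeta E 1 = 1"
    and zeta_central: "zeta E b * a = a * zeta E b"
    and entw_zeta: "psi E c (zeta E b) = tensor2 (scaleA E) (scaleC E) (zeta E b) c"


section \<open>The secondary Hochschild complex\<close>

text \<open>
  A tensor matrix is a pair \<open>(a, b)\<close>: the diagonal \<open>a i\<close> and the entries \<open>b i j\<close> above it, with
  indices starting at 1. All other values of \<open>a\<close> and \<open>b\<close> are irrelevant for size \<open>n\<close>, and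
  pure tensors that differ only there are identified.
\<close>

type_synonym ('a, 'b) tmat = "(nat \<Rightarrow> 'a) \<times> (nat \<Rightarrow> nat \<Rightarrow> 'b)"

definition same_tmat :: "nat \<Rightarrow> ('a, 'b) tmat \<Rightarrow> ('a, 'b) tmat \<Rightarrow> bool" where
  "same_tmat n T T' \<longleftrightarrow>
     (\<forall>i\<in>{1..n}. fst T i = fst T' i) \<and> (\<forall>i\<in>{1..n}. \<forall>j\<in>{i<..n}. snd T i j = snd T' i j)"

text \<open>The tensor product \<open>C \<otimes> A\<^bsup>\<otimes>n\<^esup> \<otimes> B\<^bsup>\<otimes>n(n-1)/2\<^esup>\<close> is the quotient of the free space on all \<open>(c, T)\<close> by \<open>tmat_null E n\<close>.\<close>

definition tmat_null ::
    "('k::field, 'a::{ring, monoid_mult}, 'b::{comm_ring, comm_monoid_mult}, 'c::ab_group_add) entwining_data \<Rightarrow>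
     nat \<Rightarrow> ('c \<times> ('a, 'b) tmat \<Rightarrow>\<^sub>0 'k) set" where
  "tmat_null E n = module.span free_scale
     ((\<Union>T. slot_relations (scaleC E) (\<lambda>c. (c, T))) \<union>
      (\<Union>c a b. \<Union>i\<in>{1..n}. slot_relations (scaleA E) (\<lambda>x. (c, a(i := x), b))) \<union>
      (\<Union>c a b. \<Union>i\<in>{1..n}. \<Union>j\<in>{i<..n}. slot_relations (scaleB E) (\<lambda>y. (c, a, b(i := (b i)(j := y))))) \<union>
      {gen (c, T) - gen (c, T') | c T T'. same_tmat n T T'})"

definition tmat_space ::
    "('k::field, 'a::{ring, monoid_mult}, 'b::{comm_ring, comm_monoid_mult}, 'c::ab_group_add) entwining_data \<Rightarrow>
     nat \<Rightarrow> ('c \<times> ('a, 'b) tmat \<Rightarrow>\<^sub>0 'k) set set" where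
  "tmat_space E n = quotient_space UNIV (tmat_null E n)"

type_synonym ('k, 'a, 'b, 'c) cochain = "('c \<times> ('a, 'b) tmat \<Rightarrow>\<^sub>0 'k) set \<Rightarrow> 'a"

text \<open>Linear maps \<open>C \<otimes> A\<^bsup>\<otimes>n\<^esup> \<otimes> B\<^bsup>\<otimes>n(n-1)/2\<^esup> \<rightarrow> A\<close>, extended by 0 outside of their domain.\<close>

definition cochains ::
    "('k::field, 'a::{ring, monoid_mult}, 'b::{comm_ring, comm_monoid_mult}, 'c::ab_group_add) entwining_data \<Rightarrow>
     nat \<Rightarrow> ('k, 'a, 'b, 'c) cochain set" where
  "cochains E n =
     {f. linear_map_on (tmat_space E n) (quotient_scale free_scale (tmat_null E n)) (scaleA E) f \<and>
         (\<forall>X. X \<notin> tmat_space E n \<longrightarrow> f X = 0)}"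

definition cochain_scale ::
    "('k::field, 'a::{ring, monoid_mult}, 'b, 'c) entwining_data \<Rightarrow>
     'k \<Rightarrow> ('k, 'a, 'b, 'c) cochain \<Rightarrow> ('k, 'a, 'b, 'c) cochain" where
  "cochain_scale E r f = (\<lambda>X. scaleA E r (f X))"

definition apply_cochain ::
    "('k::field, 'a::{ring, monoid_mult}, 'b::{comm_ring, comm_monoid_mult}, 'c::ab_group_add) entwining_data \<Rightarrow>
     nat \<Rightarrow> ('k, 'a, 'b, 'c) cochain \<Rightarrow> 'c \<Rightarrow> ('a, 'b) tmat \<Rightarrow> 'a" where
  "apply_cochain E n f c T = f (gen (c, T) +o tmat_null E n)"

text \<open>The cochain with value \<open>F c T\<close> at \<open>c \<otimes> T\<close>, for \<open>F\<close> that respects the relations.\<close>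

definition cochain_of ::
    "('k::field, 'a::{ring, monoid_mult}, 'b::{comm_ring, comm_monoid_mult}, 'c::ab_group_add) entwining_data \<Rightarrow>
     nat \<Rightarrow> ('c \<Rightarrow> ('a, 'b) tmat \<Rightarrow> 'a) \<Rightarrow> ('k, 'a, 'b, 'c) cochain" where
  "cochain_of E n F =
     (\<lambda>X. if X \<in> tmat_space E n then sweedler (scaleA E) (\<lambda>(c, T). F c T) X else 0)"

definition tmat_shift :: "nat \<Rightarrow> ('a, 'b) tmat \<Rightarrow> ('a, 'b) tmat" where
  "tmat_shift m = (\<lambda>(a, b). (\<lambda>i. a (i + m), \<lambda>r s. b (r + m) (s + m)))"

definition tmat_merge ::
    "('b \<Rightarrow> 'a) \<Rightarrow> nat \<Rightarrow> ('a::{ring, monoid_mult}, 'b::{comm_ring, comm_monoid_mult}) tmat \<Rightarrow> ('a, 'b) tmat" where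
  "tmat_merge z i = (\<lambda>(a, b).
     let up = (\<lambda>k. if k \<le> i then k else Suc k) in
     (\<lambda>k. if k = i then z (b i (i + 1)) * a i * a (i + 1) else a (up k),
      \<lambda>r s. if s = i then b r i * b r (i + 1)
            else if r = i then b i (up s) * b (i + 1) (up s)
            else b (up r) (up s)))"

text \<open>Deleting the last row and column of \<open>T\<close> of size \<open>n + 1\<close> means to regard it as of size \<open>n\<close>.\<close>

definition differential ::
    "('k::field, 'a::{ring, monoid_mult}, 'b::{comm_ring, comm_monoid_mult}, 'c::ab_group_add) entwining_data \<Rightarrow>
     nat \<Rightarrow> ('k, 'a, 'b, 'c) cochain \<Rightarrow> ('k, 'a, 'b, 'c) cochain" where
  "differential E n f = cochain_of E (n + 1) (\<lambda>c (a, b).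
     zeta E (\<Prod>j=2..n+1. b 1 j) *
       sweedler (scaleA E) (\<lambda>(x, c'). x * apply_cochain E n f c' (tmat_shift 1 (a, b))) (psi E c (a 1))
     + (\<Sum>i=1..n. scaleA E ((-1) ^ i) (apply_cochain E n f c (tmat_merge (zeta E) i (a, b))))
     + scaleA E ((-1) ^ (n + 1)) (zeta E (\<Prod>r=1..n. b r (n + 1)) * apply_cochain E n f c (a, b) * a (n + 1)))"

definition cocycles ::
    "('k::field, 'a::{ring, monoid_mult}, 'b::{comm_ring, comm_monoid_mult}, 'c::ab_group_add) entwining_data \<Rightarrow>
     nat \<Rightarrow> ('k, 'a, 'b, 'c) cochain set" where
  "cocycles E n = {f \<in> cochains E n. differential E n f = 0}"

definition coboundaries ::
    "('k::field, 'a::{ring, monoid_mult}, 'b::{comm_ring, comm_monoid_mult}, 'c::ab_group_add) entwining_data \<Rightarrow>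
     nat \<Rightarrow> ('k, 'a, 'b, 'c) cochain set" where
  "coboundaries E n = (if n = 0 then {0} else differential E (n - 1) ` cochains E (n - 1))"

definition HH ::
    "('k::field, 'a::{ring, monoid_mult}, 'b::{comm_ring, comm_monoid_mult}, 'c::ab_group_add) entwining_data \<Rightarrow>
     nat \<Rightarrow> ('k, 'a, 'b, 'c) cochain set set" where
  "HH E n = quotient_space (cocycles E n) (coboundaries E n)"

definition HH_scale ::
    "('k::field, 'a::{ring, monoid_mult}, 'b::{comm_ring, comm_monoid_mult}, 'c::ab_group_add) entwining_data \<Rightarrow>
     nat \<Rightarrow> 'k \<Rightarrow> ('k, 'a, 'b, 'c) cochain set \<Rightarrow> ('k, 'a, 'b, 'c) cochain set" where
  "HH_scale E n = quotient_scale (cochain_scale E) (coboundaries E n)"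

definition cohomology_class ::
    "('k::field, 'a::{ring, monoid_mult}, 'b::{comm_ring, comm_monoid_mult}, 'c::ab_group_add) entwining_data \<Rightarrow>
     nat \<Rightarrow> ('k, 'a, 'b, 'c) cochain \<Rightarrow> ('k, 'a, 'b, 'c) cochain set" where
  "cohomology_class E n f = f +o coboundaries E n"


section \<open>Operations on cochains\<close>

text \<open>
  Representative of \<open>a\<^bsub>1\<psi>\<^esub> \<otimes> \<dots> \<otimes> a\<^bsub>i\<psi>\<^esub> \<otimes> c\<^bsup>\<psi>^i\<^esup>\<close>: a linear combination of pairs \<open>(a', c')\<close>, in which \<open>a'\<close>
  agrees with \<open>a\<close> except for the entries \<open>1, \<dots>, i\<close>.
\<close>

primrec psi_iter ::
    "('k::field, 'a::{ring, monoid_mult}, 'b, 'c::ab_group_add) entwining_data \<Rightarrow>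
     nat \<Rightarrow> 'c \<Rightarrow> (nat \<Rightarrow> 'a) \<Rightarrow> ((nat \<Rightarrow> 'a) \<times> 'c \<Rightarrow>\<^sub>0 'k)" where
  "psi_iter E 0 c a = gen (a, c)"
| "psi_iter E (Suc i) c a =
     free_extend free_scale (\<lambda>(a', c').
       sweedler free_scale (\<lambda>(x, c''). gen (a'(Suc i := x), c'')) (psi E c' (a (Suc i))))
     (psi_iter E i c a)"

text \<open>
  The indices of \<open>T\<close> that are collected in place \<open>k\<close> of \<open>T'\<close>: with \<open>J = {i + 1..i + n}\<close> moved to place
  \<open>i + 1\<close>, the index \<open>i + n + 1\<close> gets the place \<open>i + 2\<close>.
\<close>

definition block :: "nat \<Rightarrow> nat \<Rightarrow> nat \<Rightarrow> nat set" where
  "block i n k = (if k \<le> i then {k} else if k = i + 1 then {i + 1..i + n} else {k + n - 1})"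

definition tmat_insert ::
    "nat \<Rightarrow> nat \<Rightarrow> 'a \<Rightarrow> ('a::{ring, monoid_mult}, 'b::{comm_ring, comm_monoid_mult}) tmat \<Rightarrow> ('a, 'b) tmat" where
  "tmat_insert i n x = (\<lambda>(a, b).
     (\<lambda>k. if k \<le> i then a k else if k = i + 1 then x else a (k + n - 1),
      \<lambda>r s. \<Prod>p\<in>block i n r. \<Prod>q\<in>block i n s. b p q))"

text \<open>The degrees \<open>m\<close> of \<open>f\<close> and \<open>n\<close> of \<open>g\<close> are explicit arguments of all operations.\<close>

definition diamond ::
    "('k::field, 'a::{ring, monoid_mult}, 'b::{comm_ring, comm_monoid_mult}, 'c::ab_group_add) entwining_data \<Rightarrow>
     nat \<Rightarrow> nat \<Rightarrow> nat \<Rightarrow> ('k, 'a, 'b, 'c) cochain \<Rightarrow> ('k, 'a, 'b, 'c) cochain \<Rightarrow> ('k, 'a, 'b, 'c) cochain" where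
  "diamond E m n i f g =
     (if i < m then
        cochain_of E (m + n - 1) (\<lambda>c (a, b).
          sweedler (scaleA E) (\<lambda>(c\<^sub>1, c\<^sub>2).
            free_extend (scaleA E) (\<lambda>(a', c').
              apply_cochain E m f c\<^sub>1
                (tmat_insert i n (apply_cochain E n g c' (tmat_shift i (a, b))) (a', b)))
            (psi_iter E i c\<^sub>2 a))
          (comul E c))
      else 0)"

definition alpha ::
    "('k::field, 'a::{ring, monoid_mult}, 'b::{comm_ring, comm_monoid_mult}, 'c::ab_group_add) entwining_data \<Rightarrow>
     ('k, 'a, 'b, 'c) cochain" where
  "alpha E = cochain_of E 2 (\<lambda>c (a, b). scaleA E (counit E c) (zeta E (b 1 2) * a 1 * a 2))"

definition cup ::
    "('k::field, 'a::{ring, monoid_mult}, 'b::{comm_ring, comm_monoid_mult}, 'c::ab_group_add) entwining_data \<Rightarrow>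
     nat \<Rightarrow> nat \<Rightarrow> ('k, 'a, 'b, 'c) cochain \<Rightarrow> ('k, 'a, 'b, 'c) cochain \<Rightarrow> ('k, 'a, 'b, 'c) cochain" where
  "cup E m n f g = cochain_of E (m + n) (\<lambda>c (a, b).
     zeta E (\<Prod>r=1..m. \<Prod>s=m+1..m+n. b r s) *
     sweedler (scaleA E) (\<lambda>(c\<^sub>1, c\<^sub>2).
       free_extend (scaleA E) (\<lambda>(a', c').
         apply_cochain E m f c\<^sub>1 (a', b) * apply_cochain E n g c' (tmat_shift m (a, b)))
       (psi_iter E m c\<^sub>2 a))
     (comul E c))"

definition sqcup ::
    "('k::field, 'a::{ring, monoid_mult}, 'b::{comm_ring, comm_monoid_mult}, 'c::ab_group_add) entwining_data \<Rightarrow>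
     nat \<Rightarrow> nat \<Rightarrow> ('k, 'a, 'b, 'c) cochain \<Rightarrow> ('k, 'a, 'b, 'c) cochain \<Rightarrow> ('k, 'a, 'b, 'c) cochain" where
  "sqcup E m n f g = cochain_of E (m + n) (\<lambda>c (a, b).
     zeta E (\<Prod>r=1..m. \<Prod>s=m+1..m+n. b r s) *
     sweedler (scaleA E) (\<lambda>(c\<^sub>1, c\<^sub>2).
       sweedler (scaleA E) (\<lambda>(x, c'). x * apply_cochain E n g c' (tmat_shift m (a, b)))
         (psi E c\<^sub>1 (apply_cochain E m f c\<^sub>2 (a, b))))
     (comul E c))"

text \<open>The product \<open>P\<close> on cochains induces the product \<open>Q\<close> on cohomology.\<close>

definition induces_product ::
    "('k::field, 'a::{ring, monoid_mult}, 'b::{comm_ring, comm_monoid_mult}, 'c::ab_group_add) entwining_data \<Rightarrow>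
     (nat \<Rightarrow> nat \<Rightarrow> ('k, 'a, 'b, 'c) cochain \<Rightarrow> ('k, 'a, 'b, 'c) cochain \<Rightarrow> ('k, 'a, 'b, 'c) cochain) \<Rightarrow>
     (nat \<Rightarrow> nat \<Rightarrow> ('k, 'a, 'b, 'c) cochain set \<Rightarrow> ('k, 'a, 'b, 'c) cochain set \<Rightarrow> ('k, 'a, 'b, 'c) cochain set) \<Rightarrow> bool"
  where
  "induces_product E P Q \<longleftrightarrow> (\<forall>m n.
     (\<forall>x\<in>HH E m. \<forall>y\<in>HH E n. Q m n x y \<in> HH E (m + n)) \<and>
     bilinear_map_on (HH E m) (HH_scale E m) (HH E n) (HH_scale E n) (HH_scale E (m + n)) (Q m n) \<and>
     (\<forall>f\<in>cocycles E m. \<forall>g\<in>cocycles E n. P m n f g \<in> cocycles E (m + n) \<and>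
        Q m n (cohomology_class E m f) (cohomology_class E n g) = cohomology_class E (m + n) (P m n f g)))"


section \<open>Weak comp algebras\<close>

text \<open>
  The graded space is the external direct sum of the subspaces \<open>V n\<close> of \<open>'v\<close>; \<open>op m n i\<close> is
  \<open>\<diamond>\<^sub>i\<close> on \<open>V m \<otimes> V n\<close>. The truncated \<open>m + n - 1\<close> differs from the true degree
  only for \<open>m = n = 0\<close>, where the operations are 0 by the first axiom.
\<close>

locale weak_comp_algebra = vector_space scale
  for scale :: "'k::field \<Rightarrow> 'v::ab_group_add \<Rightarrow> 'v" +
  fixes V :: "nat \<Rightarrow> 'v set"
    and op :: "nat \<Rightarrow> nat \<Rightarrow> nat \<Rightarrow> 'v \<Rightarrow> 'v \<Rightarrow> 'v"
    and \<alpha> :: 'v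
  assumes graded: "subspace (V n)"
    and alpha_closed: "\<alpha> \<in> V 2"
    and op_closed: "f \<in> V m \<Longrightarrow> g \<in> V n \<Longrightarrow> op m n i f g \<in> V (m + n - 1)"
    and op_bilinear: "bilinear_map_on (V m) scale (V n) scale scale (op m n i)"
    and op_vanish: "f \<in> V m \<Longrightarrow> g \<in> V n \<Longrightarrow> i \<ge> m \<Longrightarrow> op m n i f g = 0"
    and op_assoc: "f \<in> V m \<Longrightarrow> g \<in> V n \<Longrightarrow> h \<in> V p \<Longrightarrow> i \<le> j \<Longrightarrow> j < n + i \<Longrightarrow>
      op (m + n - 1) p j (op m n i f g) h = op m (n + p - 1) i f (op n p (j - i) g h)"
    and op_swap: "f \<in> V m \<Longrightarrow> g \<in> V n \<Longrightarrow> h \<in> V p \<Longrightarrow>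
      (n = 2 \<and> g = \<alpha>) \<or> (p = 2 \<and> h = \<alpha>) \<Longrightarrow> j < i \<Longrightarrow>
      op (m + n - 1) p j (op m n i f g) h = op (m + p - 1) n (i + p - 1) (op m p j f h) g"
    and alpha_alpha: "op 2 2 0 \<alpha> \<alpha> = op 2 2 1 \<alpha> \<alpha>"

end

theory Submission
  imports Defs
begin

text \<open>
  A cochain is determined by its values on \<open>c \<otimes> T\<close>, a form that is multilinear in \<open>c\<close>, the diagonal
  entries and the entries above the diagonal. On such forms the axioms of a weak comp algebra are
  consequences of coassociativity, of the compatibility of \<open>\<psi>\<close> with \<open>\<Delta>\<close> (iterated along a list of
  elements of \<open>A\<close>) and of the compatibility of \<open>\<psi>\<close> with products, \<open>\<epsilon>\<close> and \<open>\<zeta>\<close>. The exchange axiom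
  needs \<open>\<alpha>\<close> because its counit removes the component of \<open>c\<close> that would otherwise be entwined with
  the value of the other cochain.

  The differential and both products are expressed by the operations and \<open>\<alpha>\<close>:
  \<open>\<delta> f = \<alpha> \<diamond>\<^sub>1 f + \<Sum>\<^sub>k (-1)\<^bsup>k+1\<^esup> f \<diamond>\<^sub>k \<alpha> + (-1)\<^bsup>n+1\<^esup> \<alpha> \<diamond>\<^sub>0 f\<close>, \<open>f \<union> g = (\<alpha> \<diamond>\<^sub>0 f) \<diamond>\<^sub>m g\<close> and
  \<open>f \<squnion> g = (\<alpha> \<diamond>\<^sub>1 g) \<diamond>\<^sub>0 f\<close>. Hence the Leibniz rules hold in every weak comp algebra, and for
  cocycles \<open>f \<union> g - (-1)\<^bsup>mn\<^esup> g \<squnion> f\<close> is up to sign the coboundary of \<open>\<Sum>\<^sub>i (-1)\<^bsup>i(n-1)\<^esup> f \<diamond>\<^sub>i g\<close>.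
\<close>


section \<open>Linear maps on free spaces and their quotients\<close>

text \<open>Sweedler sums are evaluated on chosen representatives of cosets, and equal tensors may
  have different representatives. Every structure axiom is therefore first restated as an equality
  of sums \<open>ext F u\<close> with values in \<open>A\<close> for multilinear \<open>F\<close>;
  discharging these linearity conditions takes a large share of the proof. They are available only
  for lists of the right length, so the lengths of the lists produced by entwining have to be
  tracked as well.

  The second obstacle is the bookkeeping for the entries from \<open>B\<close>. Merging a block of
  indices is treated as a product over the fibres of a monotone map of indices. Two iterated
  mergings then agree as soon as the composite index maps agree, which is linear arithmetic.

  The explicit formulas for the differential and the two products are never checked against the
  multilinearity relations: they are matched on pure tensors with composites that are already known
  to be cochains.\<close>

interpretation free: vector_space "free_scale :: 'k::field \<Rightarrow> ('x \<Rightarrow>\<^sub>0 'k) \<Rightarrow> _"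
  by (rule vector_space_free_scale)

abbreviation linmap ::
    "('k \<Rightarrow> 'v::plus \<Rightarrow> 'v) \<Rightarrow> ('k \<Rightarrow> 'w::plus \<Rightarrow> 'w) \<Rightarrow> ('v \<Rightarrow> 'w) \<Rightarrow> bool" where
  "linmap \<equiv> linear_map_on UNIV"

lemma linmapI:
  "(\<And>x y. f (x + y) = f x + f y) \<Longrightarrow> (\<And>r x. f (s r x) = s' r (f x)) \<Longrightarrow> linmap s s' f"
  by (simp add: linear_map_on_def)

lemma linmap_add: "linmap s s' f \<Longrightarrow> f (x + y) = f x + f y"
  by (simp add: linear_map_on_def)

lemma linmap_scale: "linmap s s' f \<Longrightarrow> f (s r x) = s' r (f x)"
  by (simp add: linear_map_on_def)

lemma linmap_compose: "linmap s' s'' f \<Longrightarrow> linmap s s' g \<Longrightarrow> linmap s s'' (\<lambda>x. f (g x))"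
  by (simp add: linear_map_on_def)

lemma linmap_zero:
  fixes f :: "'v::ab_group_add \<Rightarrow> 'w::ab_group_add"
  assumes "linmap s s' f"
  shows "f 0 = 0"
  using linmap_add[OF assms, of 0 0] by simp

lemma linmap_diff:
  fixes f :: "'v::ab_group_add \<Rightarrow> 'w::ab_group_add"
  assumes "linmap s s' f"
  shows "f (x - y) = f x - f y"
  using linmap_add[OF assms, of "x - y" y] by (simp add: algebra_simps)

lemma linmap_sum:
  fixes f :: "'v::ab_group_add \<Rightarrow> 'w::ab_group_add"
  assumes "linmap s s' f"
  shows "f (sum g I) = (\<Sum>i\<in>I. f (g i))"
  by (induction I rule: infinite_finite_induct)
     (simp_all add: linmap_zero[OF assms] linmap_add[OF assms])

context vector_space
begin

text \<open>Cancellation makes the support of a sum or a multiple unpredictable; a common finite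
  superset of the supports makes linearity visible.\<close>

lemma free_extend_superset:
  assumes "finite S" "Poly_Mapping.keys u \<subseteq> S"
  shows "free_extend scale F u = (\<Sum>x\<in>S. scale (Poly_Mapping.lookup u x) (F x))"
  unfolding free_extend_def
  by (rule sum.mono_neutral_left) (use assms in \<open>auto simp: in_keys_iff\<close>)

lemma free_extend_gen: "free_extend scale F (gen x) = F x"
  by (simp add: free_extend_def gen_def)

lemma linmap_free_extend: "linmap free_scale scale (free_extend scale F :: ('x \<Rightarrow>\<^sub>0 'a) \<Rightarrow> 'b)"
proof (rule linmapI)
  fix u v :: "'x \<Rightarrow>\<^sub>0 'a"
  let ?S = "Poly_Mapping.keys u \<union> Poly_Mapping.keys v \<union> Poly_Mapping.keys (u + v)"
  show "free_extend scale F (u + v) = free_extend scale F u + free_extend scale F v"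
    by (simp add: free_extend_superset[where S = ?S] lookup_add scale_left_distrib sum.distrib le_supI1)
next
  fix r and u :: "'x \<Rightarrow>\<^sub>0 'a"
  let ?S = "Poly_Mapping.keys u \<union> Poly_Mapping.keys (free_scale r u)"
  show "free_extend scale F (free_scale r u) = scale r (free_extend scale F u)"
    by (simp add: free_extend_superset[where S = ?S] scale_sum_right)
qed

lemma linmap_of_free_extend:
  assumes "linmap s scale f"
  shows "f (free_extend s F u) = free_extend scale (\<lambda>x. f (F x)) u"
  by (simp add: free_extend_def linmap_sum[OF assms] linmap_scale[OF assms])

lemma free_extend_free_extend:
  "free_extend scale F (free_extend free_scale G u) = free_extend scale (\<lambda>x. free_extend scale F (G x)) u"
  by (rule linmap_of_free_extend) (rule linmap_free_extend)

text \<open>Linearity is demanded only on the support of \<open>u\<close>, because forms are linear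
  only on lists of the right length and the support of an entwined list contains no others.\<close>

lemma linmap_free_extend_fun:
  assumes "\<And>x. x \<in> Poly_Mapping.keys u \<Longrightarrow> linmap s scale (\<lambda>v. F v x)"
  shows "linmap s scale (\<lambda>v. free_extend scale (F v) u)"
  by (rule linmapI)
     (simp_all add: free_extend_def linmap_add[OF assms] linmap_scale[OF assms]
       sum.distrib scale_right_distrib scale_sum_right mult.commute cong: sum.cong)

lemma free_extend_swap:
  "free_extend scale (\<lambda>x. free_extend scale (\<lambda>y. F x y) v) u
     = free_extend scale (\<lambda>y. free_extend scale (\<lambda>x. F x y) u) v"
  by (simp add: free_extend_def scale_sum_right mult.commute
      sum.swap[of _ "Poly_Mapping.keys u" "Poly_Mapping.keys v"])

lemma linmap_vanishes_on_span:
  assumes "linmap free_scale scale f" "\<And>u. u \<in> S \<Longrightarrow> f u = 0" "u \<in> free.span S"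
  shows "f u = 0"
  using assms(3)
proof (induction rule: free.span_induct_alt)
  case base
  show ?case by (rule linmap_zero[OF assms(1)])
next
  case (step r u v)
  then show ?case
    by (simp add: linmap_add[OF assms(1)] linmap_scale[OF assms(1)] assms(2))
qed

lemma free_extend_slot_relations:
  assumes "u \<in> slot_relations s p" "linmap s scale (\<lambda>v. F (p v))"
  shows "free_extend scale F u = 0"
  using assms
  by (auto simp: slot_relations_def linmap_diff[OF linmap_free_extend] linmap_scale[OF linmap_free_extend]
      free_extend_gen linmap_add[OF assms(2)] linmap_scale[OF assms(2)])

lemma free_extend_tensor2_null:
  assumes "u \<in> tensor2_null s s'" "\<And>y. linmap s scale (\<lambda>x. F (x, y))" "\<And>x. linmap s' scale (\<lambda>y. F (x, y))"
  shows "free_extend scale F u = 0"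
  by (rule linmap_vanishes_on_span[OF linmap_free_extend _ assms(1)[unfolded tensor2_null_def]])
     (use assms(2,3) in \<open>auto intro: free_extend_slot_relations\<close>)

lemma free_extend_tensor3_null:
  assumes "u \<in> tensor3_null s s' s''" "\<And>y z. linmap s scale (\<lambda>x. F (x, y, z))"
    "\<And>x z. linmap s' scale (\<lambda>y. F (x, y, z))" "\<And>x y. linmap s'' scale (\<lambda>z. F (x, y, z))"
  shows "free_extend scale F u = 0"
  by (rule linmap_vanishes_on_span[OF linmap_free_extend _ assms(1)[unfolded tensor3_null_def]])
     (use assms(2-4) in \<open>auto intro: free_extend_slot_relations\<close>)

section \<open>Cosets of a subspace\<close>

lemma coset_eq_iff:
  assumes "subspace N"
  shows "x +o N = y +o N \<longleftrightarrow> x - y \<in> N"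
proof
  assume "x +o N = y +o N"
  then have "x \<in> y +o N"
    using subspace_0[OF assms] by (metis add.right_neutral set_plus_intro2)
  then show "x - y \<in> N"
    by (auto simp: elt_set_plus_def)
next
  assume *: "x - y \<in> N"
  have "u \<in> x +o N \<longleftrightarrow> u \<in> y +o N" for u
  proof -
    have "u - x \<in> N \<longleftrightarrow> u - y \<in> N"
      using subspace_add[OF assms _ *, of "u - x"] subspace_diff[OF assms _ *, of "u - y"] by auto
    moreover have "u \<in> z +o N \<longleftrightarrow> u - z \<in> N" for z
      by (auto simp: elt_set_plus_def intro: bexI[of _ "u - z"])
    ultimately show ?thesis by simp
  qed
  then show "x +o N = y +o N" by blast
qed

lemma coset_self: "subspace N \<Longrightarrow> x \<in> x +o N"
  by (metis add.right_neutral set_plus_intro2 subspace_0)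

lemma coset_add:
  assumes "subspace N"
  shows "(x +o N) + (y +o N) = (x + y) +o N"
proof -
  have "N + N = N"
    using subspace_0[OF assms] subspace_add[OF assms]
    by (auto simp: set_plus_def) (metis add.right_neutral)
  then show ?thesis by (simp add: set_plus_rearrange)
qed

lemma coset_scale:
  assumes "subspace N"
  shows "quotient_scale scale N r (x +o N) = scale r x +o N"
proof (intro equalityI subsetI)
  fix u assume "u \<in> quotient_scale scale N r (x +o N)"
  then obtain y z where "y \<in> N" "z \<in> N" "u = scale r x + (scale r y + z)"
    by (auto simp: quotient_scale_def elt_set_plus_def set_plus_def scale_right_distrib add.assoc)
  then show "u \<in> scale r x +o N"
    using subspace_add[OF assms subspace_scale[OF assms]] by (auto simp: elt_set_plus_def)
next
  fix u assume "u \<in> scale r x +o N"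
  then show "u \<in> quotient_scale scale N r (x +o N)"
    using coset_self[OF assms, of x] by (auto simp: quotient_scale_def elt_set_plus_def set_plus_def)
qed

end

lemma subspace_tensor2_null: "free.subspace (tensor2_null s s')"
  by (simp add: tensor2_null_def)

lemma subspace_tensor3_null: "free.subspace (tensor3_null s s' s'')"
  by (simp add: tensor3_null_def)

lemma gen_slot_add:
  "slot_relations s p \<subseteq> S \<Longrightarrow> gen (p (v + w)) - (gen (p v) + gen (p w)) \<in> free.span S"
  by (rule free.span_base) (auto simp: slot_relations_def diff_diff_eq)

lemma gen_slot_scale:
  "slot_relations s p \<subseteq> S \<Longrightarrow> gen (p (s r v)) - free_scale r (gen (p v)) \<in> free.span S"
  by (rule free.span_base) (auto simp: slot_relations_def)

lemma linmap_tensor2_left: "linmap s (tensor2_scale s s') (\<lambda>u. tensor2 s s' u v)"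
  by (rule linmapI; unfold tensor2_def free.coset_add[OF subspace_tensor2_null]
        free.coset_scale[OF subspace_tensor2_null] free.coset_eq_iff[OF subspace_tensor2_null])
     (unfold tensor2_null_def, (rule gen_slot_add gen_slot_scale, blast)+)

lemma linmap_tensor2_right: "linmap s' (tensor2_scale s s') (\<lambda>v. tensor2 s s' u v)"
  by (rule linmapI; unfold tensor2_def free.coset_add[OF subspace_tensor2_null]
        free.coset_scale[OF subspace_tensor2_null] free.coset_eq_iff[OF subspace_tensor2_null])
     (unfold tensor2_null_def, (rule gen_slot_add gen_slot_scale, blast)+)

lemma tensor2_in_space: "tensor2 s s' u v \<in> tensor2_space s s'"
  by (auto simp: tensor2_def tensor2_space_def quotient_space_def)


section \<open>Sums over Sweedler components\<close>

text \<open>A coset is nonempty, so the choice made in \<open>sweedler\<close> is a genuine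
  representative.\<close>

lemma some_rep_coset:
  assumes "X \<in> tensor2_space s s'"
  shows "X = (SOME v. v \<in> X) +o tensor2_null s s'"
proof -
  obtain u where X: "X = u +o tensor2_null s s'"
    using assms by (auto simp: tensor2_space_def quotient_space_def)
  then have "(SOME v. v \<in> X) \<in> u +o tensor2_null s s'"
    using free.coset_self[OF subspace_tensor2_null] by (metis someI_ex)
  then have "(SOME v. v \<in> X) - u \<in> tensor2_null s s'"
    by (auto simp: elt_set_plus_def)
  then show ?thesis
    using X free.coset_eq_iff[OF subspace_tensor2_null] by metis
qed

context entwining_structure
begin

abbreviation linA :: "('a \<Rightarrow> 'a) \<Rightarrow> bool" where "linA \<equiv> linmap (scaleA E) (scaleA E)"
abbreviation linC :: "('c \<Rightarrow> 'a) \<Rightarrow> bool" where "linC \<equiv> linmap (scaleC E) (scaleA E)"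

definition ext :: "('x \<Rightarrow> 'y \<Rightarrow> 'a) \<Rightarrow> ('x \<times> 'y \<Rightarrow>\<^sub>0 'k) \<Rightarrow> 'a" where
  "ext F = free_extend (scaleA E) (\<lambda>(x, y). F x y)"

definition comul_rep :: "'c \<Rightarrow> ('c \<times> 'c \<Rightarrow>\<^sub>0 'k)" where
  "comul_rep c = (SOME u. u \<in> comul E c)"

definition psi_rep :: "'c \<Rightarrow> 'a \<Rightarrow> ('a \<times> 'c \<Rightarrow>\<^sub>0 'k)" where
  "psi_rep c a = (SOME u. u \<in> psi E c a)"

lemma sweedler_comul: "sweedler s F (comul E c) = free_extend s F (comul_rep c)"
  by (simp add: sweedler_def comul_rep_def)

lemma sweedler_psi: "sweedler s F (psi E c a) = free_extend s F (psi_rep c a)"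
  by (simp add: sweedler_def psi_rep_def)

lemma ext_gen: "ext F (gen (x, y)) = F x y"
  by (simp add: ext_def A.free_extend_gen)

lemma ext_cong:
  "(\<And>x y. (x, y) \<in> Poly_Mapping.keys u \<Longrightarrow> F x y = G x y) \<Longrightarrow> ext F u = ext G u"
  by (auto simp: ext_def free_extend_def intro!: sum.cong)

lemma ext_linear: "linA f \<Longrightarrow> f (ext F u) = ext (\<lambda>x y. f (F x y)) u"
  by (simp add: ext_def A.linmap_of_free_extend split_def)

lemma linmap_ext:
  "(\<And>x y. (x, y) \<in> Poly_Mapping.keys u \<Longrightarrow> linmap s (scaleA E) (\<lambda>v. F v x y)) \<Longrightarrow>
   linmap s (scaleA E) (\<lambda>v. ext (F v) u)"
  unfolding ext_def by (rule A.linmap_free_extend_fun) auto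

lemma ext_swap: "ext (\<lambda>x y. ext (F x y) v) u = ext (\<lambda>z w. ext (\<lambda>x y. F x y z w) u) v"
  unfolding ext_def split_def by (rule A.free_extend_swap)

lemma ext_free_extend:
  "ext F (free_extend free_scale (\<lambda>(x, y). G x y) u) = ext (\<lambda>x y. ext F (G x y)) u"
  unfolding ext_def split_def by (rule A.free_extend_free_extend)

lemma ext_add: "ext (\<lambda>x y. F x y + G x y) u = ext F u + ext G u"
  by (simp add: ext_def free_extend_def split_def sum.distrib A.scale_right_distrib)

lemma ext_scale: "ext (\<lambda>x y. scaleA E r (F x y)) u = scaleA E r (ext F u)"
  by (rule ext_linear[symmetric]) (simp add: linmapI A.scale_right_distrib mult.commute)

lemma linA_mult_left: "linA (\<lambda>x. y * x)"
  by (simp add: linmapI A.scale_mult_right distrib_left)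

lemma linA_mult_right: "linA (\<lambda>x. x * y)"
  by (simp add: linmapI A.scale_mult_left distrib_right)

lemma linA_scale: "linA (scaleA E r)"
  by (simp add: linmapI A.scale_right_distrib mult.commute)

lemma linmap_scale_fun: "linmap s (*) f \<Longrightarrow> linmap s (scaleA E) (\<lambda>x. scaleA E (f x) a)"
  by (simp add: linear_map_on_def A.scale_left_distrib)

lemma comul_coset: "comul E c = comul_rep c +o tensor2_null (scaleC E) (scaleC E)"
  unfolding comul_rep_def by (rule some_rep_coset[OF C.comul_closed])

lemma psi_in_space: "psi E c a \<in> tensor2_space (scaleA E) (scaleC E)"
  unfolding psi_def by (intro entw_closed tensor2_in_space)

lemma psi_coset: "psi E c a = psi_rep c a +o tensor2_null (scaleA E) (scaleC E)"
  unfolding psi_rep_def by (rule some_rep_coset[OF psi_in_space])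

text \<open>Well-definedness of Sweedler notation: a bilinear \<open>F\<close> kills the relations
  that span the null space.\<close>

lemma ext_coset_eq:
  assumes "u +o tensor2_null s s' = v +o tensor2_null s s'"
    "\<And>y. linmap s (scaleA E) (\<lambda>x. F x y)" "\<And>x. linmap s' (scaleA E) (F x)"
  shows "ext F u = ext F v"
proof -
  have "ext F (u - v) = 0"
    unfolding ext_def
    by (rule A.free_extend_tensor2_null[where s = s and s' = s'])
       (use assms in \<open>auto simp: free.coset_eq_iff[OF subspace_tensor2_null]\<close>)
  then show ?thesis
    by (simp add: ext_def linmap_diff[OF A.linmap_free_extend])
qed

lemma free_extend_coset3_eq:
  assumes "u +o tensor3_null s s' s'' = v +o tensor3_null s s' s''"
    "\<And>y z. linmap s (scaleA E) (\<lambda>x. F x y z)" "\<And>x z. linmap s' (scaleA E) (\<lambda>y. F x y z)"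
    "\<And>x y. linmap s'' (scaleA E) (F x y)"
  shows "free_extend (scaleA E) (\<lambda>(x, y, z). F x y z) u = free_extend (scaleA E) (\<lambda>(x, y, z). F x y z) v"
proof -
  have "free_extend (scaleA E) (\<lambda>(x, y, z). F x y z) (u - v) = 0"
    by (rule A.free_extend_tensor3_null[where s = s and s' = s' and s'' = s''])
       (use assms in \<open>auto simp: free.coset_eq_iff[OF subspace_tensor3_null]\<close>)
  then show ?thesis
    by (simp add: linmap_diff[OF A.linmap_free_extend])
qed

text \<open>The chosen representatives \<open>R v\<close> need not depend linearly on
  \<open>v\<close>, only their cosets do; a bilinear \<open>F\<close> cannot see the
  difference.\<close>

lemma linmap_ext_coset:
  assumes lin: "linmap s (tensor2_scale s' s'') X"
    and rep: "\<And>v. X v = R v +o tensor2_null s' s''"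
    and F: "\<And>y. linmap s' (scaleA E) (\<lambda>x. F x y)" "\<And>x. linmap s'' (scaleA E) (F x)"
  shows "linmap s (scaleA E) (\<lambda>v. ext F (R v))"
proof (rule linmapI)
  fix v w
  have "R (v + w) +o tensor2_null s' s'' = (R v + R w) +o tensor2_null s' s''"
    using linmap_add[OF lin, of v w]
    by (simp add: rep free.coset_add[OF subspace_tensor2_null])
  then have "ext F (R (v + w)) = ext F (R v + R w)"
    using F by (rule ext_coset_eq)
  then show "ext F (R (v + w)) = ext F (R v) + ext F (R w)"
    by (simp add: ext_def linmap_add[OF A.linmap_free_extend])
next
  fix r v
  have "R (s r v) +o tensor2_null s' s'' = free_scale r (R v) +o tensor2_null s' s''"
    using linmap_scale[OF lin, of r v]
    by (simp add: rep free.coset_scale[OF subspace_tensor2_null])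
  then have "ext F (R (s r v)) = ext F (free_scale r (R v))"
    using F by (rule ext_coset_eq)
  then show "ext F (R (s r v)) = scaleA E r (ext F (R v))"
    by (simp add: ext_def linmap_scale[OF A.linmap_free_extend])
qed

lemma linC_comul:
  "(\<And>y. linC (\<lambda>x. F x y)) \<Longrightarrow> (\<And>x. linC (F x)) \<Longrightarrow> linC (\<lambda>c. ext F (comul_rep c))"
  by (rule linmap_ext_coset[OF C.comul_linear comul_coset])

lemma linear_entw_tensor2:
  assumes "linmap s (tensor2_scale (scaleC E) (scaleA E)) X"
    and "\<And>v. X v \<in> tensor2_space (scaleC E) (scaleA E)"
  shows "linmap s (tensor2_scale (scaleA E) (scaleC E)) (\<lambda>v. entw E (X v))"
  using entw_linear assms by (auto simp: linear_map_on_def)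

lemma linC_psi:
  "(\<And>y. linA (\<lambda>x. F x y)) \<Longrightarrow> (\<And>x. linC (F x)) \<Longrightarrow> linC (\<lambda>c. ext F (psi_rep c a))"
  by (rule linmap_ext_coset[OF _ psi_coset], unfold psi_def)
     (intro linear_entw_tensor2 linmap_tensor2_left tensor2_in_space)

lemma linA_psi:
  "(\<And>y. linA (\<lambda>x. F x y)) \<Longrightarrow> (\<And>x. linC (F x)) \<Longrightarrow> linA (\<lambda>a. ext F (psi_rep c a))"
  by (rule linmap_ext_coset[OF _ psi_coset], unfold psi_def)
     (intro linear_entw_tensor2 linmap_tensor2_right tensor2_in_space)

text \<open>The axiom is tested against an arbitrary trilinear map to \<open>A\<close>. The other
  structure axioms get the same treatment below; this suffices because all cochains take values in
  \<open>A\<close>.\<close>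

lemma ext_coassoc:
  assumes "\<And>y z. linC (\<lambda>x. F x y z)" "\<And>x z. linC (\<lambda>y. F x y z)" "\<And>x y. linC (F x y)"
  shows "ext (\<lambda>x z. ext (\<lambda>x y. F x y z) (comul_rep x)) (comul_rep c)
       = ext (\<lambda>x y. ext (\<lambda>y z. F x y z) (comul_rep y)) (comul_rep c)"
  using free_extend_coset3_eq[OF C.coassoc[unfolded sweedler_comul] assms, of c]
  unfolding ext_def split_def
  by (simp add: A.free_extend_free_extend A.free_extend_gen)

lemma ext_counit_left: "linC F \<Longrightarrow> ext (\<lambda>x y. scaleA E (counit E x) (F y)) (comul_rep c) = F c"
  using A.linmap_of_free_extend[of "scaleC E" F "\<lambda>(x, y). scaleC E (counit E x) y" "comul_rep c"]
  by (simp add: C.counit_left[unfolded sweedler_comul split_def] ext_def split_def linmap_scale)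

lemma ext_counit_right: "linC F \<Longrightarrow> ext (\<lambda>x y. scaleA E (counit E y) (F x)) (comul_rep c) = F c"
  using A.linmap_of_free_extend[of "scaleC E" F "\<lambda>(x, y). scaleC E (counit E y) x" "comul_rep c"]
  by (simp add: C.counit_right[unfolded sweedler_comul split_def] ext_def split_def linmap_scale)

lemma ext_psi_mult:
  assumes "\<And>y. linA (\<lambda>x. F x y)" "\<And>x. linC (F x)"
  shows "ext F (psi_rep c (a * b)) = ext (\<lambda>x c'. ext (\<lambda>y c''. F (x * y) c'') (psi_rep c' b)) (psi_rep c a)"
  using ext_coset_eq[OF entw_mult[of c a b, unfolded psi_coset[of c "a * b"] sweedler_psi] assms]
  by (simp add: ext_free_extend split_def ext_gen)
     (simp add: ext_def split_def A.free_extend_free_extend A.free_extend_gen)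

text \<open>The component \<open>c\<^sub>2\<close> stands next to \<open>a\<close> and passes it
  first; \<open>c\<^sub>1\<close> then passes the entwined element.\<close>

lemma ext_psi_comul:
  assumes "\<And>y z. linA (\<lambda>x. F x y z)" "\<And>x z. linC (\<lambda>y. F x y z)" "\<And>x y. linC (F x y)"
  shows "ext (\<lambda>x c'. ext (F x) (comul_rep c')) (psi_rep c a)
       = ext (\<lambda>c\<^sub>1 c\<^sub>2. ext (\<lambda>x c\<^sub>2'. ext (\<lambda>y c\<^sub>1'. F y c\<^sub>1' c\<^sub>2') (psi_rep c\<^sub>1 x)) (psi_rep c\<^sub>2 a)) (comul_rep c)"
  using free_extend_coset3_eq[OF entw_comul[unfolded sweedler_psi sweedler_comul] assms, of c a]
  unfolding ext_def split_def
  by (simp add: A.free_extend_free_extend A.free_extend_gen)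

lemma ext_psi_counit:
  "linA F \<Longrightarrow> ext (\<lambda>x c'. scaleA E (counit E c') (F x)) (psi_rep c a) = scaleA E (counit E c) (F a)"
  using A.linmap_of_free_extend[of "scaleA E" F "\<lambda>(x, c'). scaleA E (counit E c') x" "psi_rep c a"]
  by (simp add: entw_counit[unfolded sweedler_psi split_def] ext_def split_def linmap_scale)

end

context entwining_structure_over
begin

lemma ext_psi_zeta:
  assumes "\<And>y. linA (\<lambda>x. F x y)" "\<And>x. linC (F x)"
  shows "ext F (psi_rep c (zeta E b)) = F (zeta E b) c"
  using ext_coset_eq[OF entw_zeta[unfolded psi_coset tensor2_def] assms]
  by (simp add: ext_gen)

text \<open>Multiplicativity of \<open>\<psi>\<close> splits off the factor from \<open>B\<close>,
  which \<open>\<psi>\<close> leaves unchanged.\<close>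

lemma ext_psi_zeta_mult:
  assumes "\<And>y. linA (\<lambda>x. F x y)" "\<And>x. linC (F x)"
  shows "ext F (psi_rep c (zeta E b * a)) = ext (\<lambda>x. F (zeta E b * x)) (psi_rep c a)"
proof -
  have F': "linA (\<lambda>x. F (z * x) y)" "linA (\<lambda>x. F (x * z) y)" for z y
    by (rule linmap_compose[OF assms(1)], rule linA_mult_left linA_mult_right)+
  show ?thesis
    unfolding ext_psi_mult[OF assms]
    by (rule ext_psi_zeta) (intro linmap_ext F'(2) linC_psi F'(1) assms(2))+
qed

end


section \<open>Entwining with a list of algebra elements\<close>

lemma free_extend_in_span:
  assumes "\<And>x. x \<in> Poly_Mapping.keys u \<Longrightarrow> F x \<in> free.span S"
  shows "free_extend free_scale F u \<in> free.span S"
  unfolding free_extend_def by (intro free.span_sum free.span_scale assms)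

text \<open>Membership in a span survives cancellation, so it bounds the support of an iterated
  linear extension whose exact support is out of reach.\<close>

lemma keys_subset_if_in_span_gen:
  assumes "u \<in> free.span (gen ` X)"
  shows "Poly_Mapping.keys u \<subseteq> X"
  using assms
proof (induction rule: free.span_induct_alt)
  case base
  show ?case by simp
next
  case (step r v w)
  then obtain x where v: "v = gen x" "x \<in> X" by blast
  have "Poly_Mapping.keys (free_scale r v) \<subseteq> X"
    using v by (auto simp: in_keys_iff gen_def lookup_single when_def split: if_splits)
  then show ?case
    using step Poly_Mapping.keys_add[of "free_scale r v" w] by blast
qed

context entwining_structure
begin

text \<open>Lists replace functions on indices so that the entries before, inside and after a block
  can be separated by append.\<close>

primrec psi_list :: "'a list \<Rightarrow> 'c \<Rightarrow> ('a list \<times> 'c \<Rightarrow>\<^sub>0 'k)" where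
  "psi_list [] c = gen ([], c)"
| "psi_list (x # xs) c = free_extend free_scale (\<lambda>(y, c').
     free_extend free_scale (\<lambda>(ys, d). gen (y # ys, d)) (psi_list xs c')) (psi_rep c x)"

lemma ext_psi_list_Nil: "ext F (psi_list [] c) = F [] c"
  by (simp add: ext_gen)

lemma ext_psi_list_Cons:
  "ext F (psi_list (x # xs) c) = ext (\<lambda>y c'. ext (\<lambda>ys. F (y # ys)) (psi_list xs c')) (psi_rep c x)"
  by (simp add: ext_free_extend ext_gen)

lemma ext_psi_list_append:
  "ext F (psi_list (xs @ ys) c) = ext (\<lambda>us c'. ext (\<lambda>vs. F (us @ vs)) (psi_list ys c')) (psi_list xs c)"
proof (induction xs arbitrary: F c)
  case Nil
  show ?case by (simp add: ext_psi_list_Nil del: psi_list.simps)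
next
  case (Cons x xs)
  show ?case by (simp add: ext_psi_list_Cons Cons.IH del: psi_list.simps)
qed

lemma psi_list_in_span: "psi_list xs c \<in> free.span (gen ` {(ys, d). length ys = length xs})"
proof (induction xs arbitrary: c)
  case Nil
  show ?case by (auto intro: free.span_base)
next
  case (Cons x xs)
  have "length y = length xs" if "(y, d) \<in> Poly_Mapping.keys (psi_list xs c)" for y d c
    using keys_subset_if_in_span_gen[OF Cons.IH] that by blast
  then show ?case
    unfolding psi_list.simps split_def
    by (intro free_extend_in_span free.span_base) (auto simp: prod_eq_iff)
qed

lemma length_psi_list: "(ys, d) \<in> Poly_Mapping.keys (psi_list xs c) \<Longrightarrow> length ys = length xs"
  using keys_subset_if_in_span_gen[OF psi_list_in_span] by blast

text \<open>The length is fixed because nothing is known about a form on lists of any other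
  length.\<close>

definition multilin :: "nat \<Rightarrow> ('a list \<Rightarrow> 'c \<Rightarrow> 'a) \<Rightarrow> bool" where
  "multilin n F \<longleftrightarrow> (\<forall>xs. length xs = n \<longrightarrow> linC (F xs)) \<and>
     (\<forall>xs ys c. length xs + length ys + 1 = n \<longrightarrow> linA (\<lambda>x. F (xs @ x # ys) c))"

lemma multilinI:
  "(\<And>xs. length xs = n \<Longrightarrow> linC (F xs)) \<Longrightarrow>
   (\<And>xs ys c. length xs + length ys + 1 = n \<Longrightarrow> linA (\<lambda>x. F (xs @ x # ys) c)) \<Longrightarrow> multilin n F"
  by (simp add: multilin_def)

lemma multilin_linC: "multilin n F \<Longrightarrow> length xs = n \<Longrightarrow> linC (F xs)"
  by (simp add: multilin_def)

lemma multilin_linA: "multilin n F \<Longrightarrow> length xs + length ys + 1 = n \<Longrightarrow> linA (\<lambda>x. F (xs @ x # ys) c)"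
  by (simp add: multilin_def)

lemma multilin_linA_Cons: "multilin n F \<Longrightarrow> length ys + 1 = n \<Longrightarrow> linA (\<lambda>x. F (x # ys) c)"
  using multilin_linA[of n F "[]"] by simp

lemma multilin_append:
  assumes "multilin n F" "length us + m = n"
  shows "multilin m (\<lambda>xs. F (us @ xs))"
proof (rule multilinI)
  show "linC (F (us @ xs))" if "length xs = m" for xs
    by (rule multilin_linC[OF assms(1)]) (use assms(2) that in simp)
  show "linA (\<lambda>x. F (us @ xs @ x # ys) c)" if "length xs + length ys + 1 = m" for xs ys c
    using multilin_linA[OF assms(1), of "us @ xs" ys] assms(2) that by simp
qed

lemma multilin_Cons: "multilin n F \<Longrightarrow> m + 1 = n \<Longrightarrow> multilin m (\<lambda>xs. F (x # xs))"
  using multilin_append[of n F "[x]" m] by simp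

lemma linC_psi_list: "multilin (length xs) F \<Longrightarrow> linC (\<lambda>c. ext F (psi_list xs c))"
proof (induction xs arbitrary: F)
  case Nil
  then show ?case
    unfolding ext_psi_list_Nil by (simp add: multilin_linC)
next
  case (Cons x xs)
  show ?case
    unfolding ext_psi_list_Cons
  proof (rule linC_psi)
    show "linA (\<lambda>y. ext (\<lambda>ys. F (y # ys)) (psi_list xs c'))" for c'
      by (intro linmap_ext multilin_linA_Cons[OF Cons.prems]) (auto dest: length_psi_list)
    show "linC (\<lambda>c'. ext (\<lambda>ys. F (y # ys)) (psi_list xs c'))" for y
      by (rule Cons.IH, rule multilin_Cons[OF Cons.prems]) simp
  qed
qed

lemma linA_psi_list_Cons:
  assumes "multilin (Suc (length ys)) F"
  shows "linA (\<lambda>x. ext F (psi_list (x # ys) c))"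
  unfolding ext_psi_list_Cons
proof (rule linA_psi)
  show "linA (\<lambda>y. ext (\<lambda>vs. F (y # vs)) (psi_list ys c'))" for c'
    by (intro linmap_ext multilin_linA_Cons[OF assms]) (auto dest: length_psi_list)
  show "linC (\<lambda>c'. ext (\<lambda>vs. F (y # vs)) (psi_list ys c'))" for y
    by (rule linC_psi_list, rule multilin_Cons[OF assms]) simp
qed

lemma linA_psi_list:
  assumes "multilin n F" "length xs + length ys + 1 = n"
  shows "linA (\<lambda>x. ext F (psi_list (xs @ x # ys) c))"
  unfolding ext_psi_list_append
  using assms by (intro linmap_ext linA_psi_list_Cons multilin_append[OF assms(1)]) (auto dest: length_psi_list)

text \<open>Compatibility of \<open>\<psi>\<close> with the coproduct, iterated: taking the
  coproduct after passing a list equals letting \<open>c\<^sub>2\<close> and then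
  \<open>c\<^sub>1\<close> pass it.\<close>

lemma ext_psi_list_comul:
  assumes "\<And>d. multilin (length xs) (\<lambda>ys c. F ys c d)" "\<And>d. multilin (length xs) (\<lambda>ys. F ys d)"
  shows "ext (\<lambda>ys c'. ext (F ys) (comul_rep c')) (psi_list xs c)
       = ext (\<lambda>c\<^sub>1 c\<^sub>2. ext (\<lambda>ys c\<^sub>2'. ext (\<lambda>zs c\<^sub>1'. F zs c\<^sub>1' c\<^sub>2') (psi_list ys c\<^sub>1)) (psi_list xs c\<^sub>2)) (comul_rep c)"
  using assms
proof (induction xs arbitrary: F c)
  case Nil
  show ?case by (simp add: ext_psi_list_Nil del: psi_list.simps)
next
  case (Cons x xs)
  \<comment> \<open>This is the claim for the tail with the entwined head \<open>y\<close> put back.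
    The axiom for a single element is applied to \<open>?G\<close>, whose linearity in all three
    arguments is checked next.\<close>
  let ?G = "\<lambda>y c\<^sub>1 c\<^sub>2. ext (\<lambda>ys c\<^sub>2'. ext (\<lambda>zs c\<^sub>1'. F (y # zs) c\<^sub>1' c\<^sub>2') (psi_list ys c\<^sub>1)) (psi_list xs c\<^sub>2)"
  have F1: "multilin (length xs) (\<lambda>ys c. F (y # ys) c d)" and F2: "multilin (length xs) (\<lambda>ys. F (y # ys) d)" for y d
    by (rule multilin_Cons[OF Cons.prems(1)] multilin_Cons[OF Cons.prems(2)], simp)+
  have "linA (\<lambda>y. ?G y c\<^sub>1 c\<^sub>2)" for c\<^sub>1 c\<^sub>2
    by (intro linmap_ext multilin_linA_Cons[OF Cons.prems(1)]) (auto dest!: length_psi_list)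
  moreover have "linC (\<lambda>c\<^sub>1. ?G y c\<^sub>1 c\<^sub>2)" for y c\<^sub>2
    using F1 by (intro linmap_ext linC_psi_list) (auto dest!: length_psi_list)
  moreover have "linC (\<lambda>c\<^sub>2. ?G y c\<^sub>1 c\<^sub>2)" for y c\<^sub>1
  proof (intro linC_psi_list multilinI linmap_ext)
    show "linC (F (y # zs) c)" if "length ys = length xs" "(zs, c) \<in> Poly_Mapping.keys (psi_list ys c\<^sub>1)" for ys zs c
      by (rule multilin_linC[OF F2]) (use that length_psi_list in simp)
    show "linA (\<lambda>z. ext (\<lambda>zs c\<^sub>1'. F (y # zs) c\<^sub>1' c) (psi_list (us @ z # vs) c\<^sub>1))"
      if "length us + length vs + 1 = length xs" for us vs c
      by (rule linA_psi_list[OF F1 that])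
  qed
  ultimately have "ext (\<lambda>y c'. ext (?G y) (comul_rep c')) (psi_rep c x)
      = ext (\<lambda>c\<^sub>1 c\<^sub>2. ext (\<lambda>y c\<^sub>2'. ext (\<lambda>z c\<^sub>1'. ?G z c\<^sub>1' c\<^sub>2') (psi_rep c\<^sub>1 y)) (psi_rep c\<^sub>2 x)) (comul_rep c)"
    by (rule ext_psi_comul)
  \<comment> \<open>\<open>c\<^sub>1\<close> passing the head and \<open>c\<^sub>2'\<close> passing
    the tail concern different tensor factors, so the two sums may be exchanged.\<close>
  moreover have "ext (\<lambda>z c\<^sub>1'. ?G z c\<^sub>1' c\<^sub>2') (psi_rep c\<^sub>1 y)
    = ext (\<lambda>ys c\<^sub>2''. ext (\<lambda>z c\<^sub>1'. ext (\<lambda>zs c\<^sub>1''. F (z # zs) c\<^sub>1'' c\<^sub>2'') (psi_list ys c\<^sub>1')) (psi_rep c\<^sub>1 y))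
        (psi_list xs c\<^sub>2')" for y c\<^sub>1 c\<^sub>2'
    by (rule ext_swap)
  ultimately show ?case
    by (simp add: ext_psi_list_Cons Cons.IH F1 F2 del: psi_list.simps)
qed

text \<open>A counit applied after the entwining undoes it. This is how composition with
  \<open>alpha\<close> gets rid of \<open>\<psi>\<close>.\<close>

lemma ext_psi_list_counit:
  assumes "\<And>us vs. length us + length vs + 1 = length xs \<Longrightarrow> linA (\<lambda>x. F (us @ x # vs))"
  shows "ext (\<lambda>ys c'. scaleA E (counit E c') (F ys)) (psi_list xs c) = scaleA E (counit E c) (F xs)"
  using assms
proof (induction xs arbitrary: F c)
  case Nil
  show ?case by (simp add: ext_psi_list_Nil del: psi_list.simps)
next
  case (Cons x xs)
  have "ext (\<lambda>ys c'. scaleA E (counit E c') (F (y # ys))) (psi_list xs c) = scaleA E (counit E c) (F (y # xs))" for y c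
  proof (rule Cons.IH)
    show "linA (\<lambda>x. F (y # us @ x # vs))" if "length us + length vs + 1 = length xs" for us vs
      using Cons.prems[of "y # us" vs] that by simp
  qed
  moreover have "linA (\<lambda>y. F (y # xs))"
    using Cons.prems[of "[]" xs] by simp
  ultimately show ?case
    by (simp add: ext_psi_list_Cons ext_psi_counit del: psi_list.simps)
qed

end

text \<open>Two neighbours may be multiplied before or after they are entwined, since
  \<open>\<psi>\<close> is multiplicative and passes \<open>zeta\<close> unchanged. On the right the
  entwined list is bound as a whole, hence the access by \<open>take\<close>, \<open>drop\<close>
  and position.\<close>

lemma (in entwining_structure_over) ext_psi_list_merge:
  assumes "multilin (length us + 1 + length vs) F"
  shows "ext F (psi_list (us @ (zeta E b * x * y) # vs) c)
    = ext (\<lambda>ws. F (take (length us) ws @ (zeta E b * ws ! length us * ws ! Suc (length us)) # drop (Suc (Suc (length us))) ws))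
        (psi_list (us @ x # y # vs) c)"
proof -
  let ?G = "\<lambda>us' z d. ext (\<lambda>vs'. F (us' @ z # vs')) (psi_list vs d)"
  have G: "linA (\<lambda>z. ?G us' z d)" "linC (?G us' z)" if "length us' = length us" for us' z d
  proof -
    show "linA (\<lambda>z. ?G us' z d)"
      using that by (intro linmap_ext multilin_linA[OF assms]) (auto dest!: length_psi_list)
    show "linC (?G us' z)"
      using that multilin_append[OF assms, of "us' @ [z]" "length vs"] by (intro linC_psi_list) simp
  qed
  have "ext (?G us') (psi_rep c (zeta E b * x * y))
      = ext (\<lambda>x' c'. ext (\<lambda>y'. ?G us' (zeta E b * x' * y')) (psi_rep c' y)) (psi_rep c x)"
    if "length us' = length us" for us' c
  proof -
    have "linA (\<lambda>z. ?G us' (zeta E b * z) d)" for d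
      by (rule linmap_compose[OF G(1)[OF that] linA_mult_left])
    moreover have "linC (?G us' (zeta E b * z))" for z
      by (rule G(2)[OF that])
    ultimately have "ext (\<lambda>z. ?G us' (zeta E b * z)) (psi_rep c (x * y))
      = ext (\<lambda>x' c'. ext (\<lambda>y'. ?G us' (zeta E b * (x' * y'))) (psi_rep c' y)) (psi_rep c x)"
      by (rule ext_psi_mult)
    then show ?thesis
      using ext_psi_zeta_mult[OF G[OF that], of c b "x * y"] by (simp only: mult.assoc)
  qed
  then show ?thesis
    unfolding ext_psi_list_append
    by (intro ext_cong) (simp add: ext_psi_list_Cons nth_append length_psi_list del: psi_list.simps)
qed


section \<open>Cochains as multilinear forms\<close>

context entwining_structure_over
begin

abbreviation linB :: "('b \<Rightarrow> 'a) \<Rightarrow> bool" where "linB \<equiv> linmap (scaleB E) (scaleA E)"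

text \<open>The diagonal is a list because entwining consumes it entry by entry. The entries from
  \<open>B\<close> are only reindexed and multiplied, so they stay a function on all index pairs;
  the last clause makes its values off the upper triangle irrelevant.\<close>

definition mform :: "nat \<Rightarrow> ('c \<Rightarrow> 'a list \<Rightarrow> (nat \<Rightarrow> nat \<Rightarrow> 'b) \<Rightarrow> 'a) \<Rightarrow> bool" where
  "mform n F \<longleftrightarrow>
     (\<forall>xs b. length xs = n \<longrightarrow> linC (\<lambda>c. F c xs b)) \<and>
     (\<forall>c xs ys b. length xs + length ys + 1 = n \<longrightarrow> linA (\<lambda>x. F c (xs @ x # ys) b)) \<and>
     (\<forall>c xs b i j. length xs = n \<longrightarrow> 1 \<le> i \<longrightarrow> i < j \<longrightarrow> j \<le> n \<longrightarrow>
        linB (\<lambda>y. F c xs (b(i := (b i)(j := y))))) \<and>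
     (\<forall>c xs b b'. length xs = n \<longrightarrow> (\<forall>i j. 1 \<le> i \<longrightarrow> i < j \<longrightarrow> j \<le> n \<longrightarrow> b i j = b' i j) \<longrightarrow>
        F c xs b = F c xs b')"

lemma mformI:
  assumes "\<And>xs b. length xs = n \<Longrightarrow> linC (\<lambda>c. F c xs b)"
    and "\<And>c xs ys b. length xs + length ys + 1 = n \<Longrightarrow> linA (\<lambda>x. F c (xs @ x # ys) b)"
    and "\<And>c xs b i j. length xs = n \<Longrightarrow> 1 \<le> i \<Longrightarrow> i < j \<Longrightarrow> j \<le> n \<Longrightarrow>
        linB (\<lambda>y. F c xs (b(i := (b i)(j := y))))"
    and "\<And>c xs b b'. length xs = n \<Longrightarrow> (\<And>i j. 1 \<le> i \<Longrightarrow> i < j \<Longrightarrow> j \<le> n \<Longrightarrow> b i j = b' i j) \<Longrightarrow>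
        F c xs b = F c xs b'"
  shows "mform n F"
  unfolding mform_def by (intro conjI allI impI assms; blast)

lemma mform_linC: "mform n F \<Longrightarrow> length xs = n \<Longrightarrow> linC (\<lambda>c. F c xs b)"
  by (simp add: mform_def)

lemma mform_linA: "mform n F \<Longrightarrow> length xs + length ys + 1 = n \<Longrightarrow> linA (\<lambda>x. F c (xs @ x # ys) b)"
  by (simp add: mform_def)

lemma mform_linB:
  "mform n F \<Longrightarrow> length xs = n \<Longrightarrow> 1 \<le> i \<Longrightarrow> i < j \<Longrightarrow> j \<le> n \<Longrightarrow> linB (\<lambda>y. F c xs (b(i := (b i)(j := y))))"
  by (simp add: mform_def)

lemma mform_cong:
  "mform n F \<Longrightarrow> length xs = n \<Longrightarrow> (\<And>i j. 1 \<le> i \<Longrightarrow> i < j \<Longrightarrow> j \<le> n \<Longrightarrow> b i j = b' i j) \<Longrightarrow>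
   F c xs b = F c xs b'"
  by (simp add: mform_def)

text \<open>Tensor matrices index the diagonal from 1, lists from 0.\<close>

definition form_of :: "nat \<Rightarrow> ('k, 'a, 'b, 'c) cochain \<Rightarrow> 'c \<Rightarrow> 'a list \<Rightarrow> (nat \<Rightarrow> nat \<Rightarrow> 'b) \<Rightarrow> 'a" where
  "form_of n f c xs b = apply_cochain E n f c (\<lambda>k. xs ! (k - 1), b)"

definition cochain_of_form ::
    "nat \<Rightarrow> ('c \<Rightarrow> 'a list \<Rightarrow> (nat \<Rightarrow> nat \<Rightarrow> 'b) \<Rightarrow> 'a) \<Rightarrow> ('k, 'a, 'b, 'c) cochain" where
  "cochain_of_form n F = cochain_of E n (\<lambda>c (a, b). F c (map a [1..<Suc n]) b)"

section \<open>Passage between cochains and multilinear forms\<close>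

lemma subspace_tmat_null: "free.subspace (tmat_null E n)"
  by (simp add: tmat_null_def)

lemma cochain_linear:
  assumes "f \<in> cochains E n"
  shows "linmap free_scale (scaleA E) (\<lambda>u. f (u +o tmat_null E n))"
proof -
  have lin: "linear_map_on (tmat_space E n) (quotient_scale free_scale (tmat_null E n)) (scaleA E) f"
    using assms by (simp add: cochains_def)
  have *: "u +o tmat_null E n \<in> tmat_space E n" for u
    by (simp add: tmat_space_def quotient_space_def)
  show ?thesis
    using lin * by (simp add: linear_map_on_def
        flip: free.coset_add[OF subspace_tmat_null] free.coset_scale[OF subspace_tmat_null])
qed

text \<open>Stated for an arbitrary insertion \<open>p\<close>, so that it serves the factors
  \<open>C\<close>, \<open>A\<close> and \<open>B\<close> alike.\<close>

lemma cochain_slot_linear: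
  assumes "f \<in> cochains E n" "slot_relations s p \<subseteq> tmat_null E n"
  shows "linmap s (scaleA E) (\<lambda>v. f (gen (p v) +o tmat_null E n))"
proof (rule linmapI)
  fix v w
  have "gen (p (v + w)) - (gen (p v) + gen (p w)) \<in> free.span (tmat_null E n)"
    by (rule gen_slot_add) (rule assms(2))
  then have "gen (p (v + w)) +o tmat_null E n = (gen (p v) + gen (p w)) +o tmat_null E n"
    unfolding free.coset_eq_iff[OF subspace_tmat_null]
    by (simp add: free.span_eq_iff[THEN iffD2, OF subspace_tmat_null])
  then show "f (gen (p (v + w)) +o tmat_null E n) = f (gen (p v) +o tmat_null E n) + f (gen (p w) +o tmat_null E n)"
    using linmap_add[OF cochain_linear[OF assms(1)]] by simp
next
  fix r v
  have "gen (p (s r v)) - free_scale r (gen (p v)) \<in> free.span (tmat_null E n)"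
    by (rule gen_slot_scale) (rule assms(2))
  then have "gen (p (s r v)) +o tmat_null E n = free_scale r (gen (p v)) +o tmat_null E n"
    unfolding free.coset_eq_iff[OF subspace_tmat_null]
    by (simp add: free.span_eq_iff[THEN iffD2, OF subspace_tmat_null])
  then show "f (gen (p (s r v)) +o tmat_null E n) = scaleA E r (f (gen (p v) +o tmat_null E n))"
    using linmap_scale[OF cochain_linear[OF assms(1)]] by simp
qed

lemma apply_cochain_cong:
  assumes "same_tmat n T T'"
  shows "apply_cochain E n f c T = apply_cochain E n f c T'"
proof -
  have "gen (c, T) +o tmat_null E n = gen (c, T') +o tmat_null E n"
    unfolding free.coset_eq_iff[OF subspace_tmat_null]
    unfolding tmat_null_def by (rule free.span_base) (use assms in blast)
  then show ?thesis by (simp add: apply_cochain_def)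
qed

lemma apply_cochain_form: "apply_cochain E n f c (a, b) = form_of n f c (map a [1..<Suc n]) b"
  unfolding form_of_def by (rule apply_cochain_cong) (auto simp: same_tmat_def simp del: upt_Suc)

lemma mform_form_of:
  assumes f: "f \<in> cochains E n"
  shows "mform n (form_of n f)"
proof (rule mformI)
  show "linC (\<lambda>c. form_of n f c xs b)" for xs b
    unfolding form_of_def apply_cochain_def
    by (rule cochain_slot_linear[OF f]) (auto simp: tmat_null_def intro: free.span_base)
  show "linA (\<lambda>x. form_of n f c (xs @ x # ys) b)" if "length xs + length ys + 1 = n" for c xs ys b
  proof -
    \<comment> \<open>The relations are stated for function updates, so the entry \<open>x\<close>
      is written as an update of a list with the placeholder 0 in its position.\<close>
    have "form_of n f c (xs @ x # ys) b
        = apply_cochain E n f c ((\<lambda>k. (xs @ 0 # ys) ! (k - 1))(Suc (length xs) := x), b)" for x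
      unfolding form_of_def
      by (rule apply_cochain_cong) (auto simp: same_tmat_def nth_append nth_Cons split: nat.split)
    moreover have "linA (\<lambda>x. apply_cochain E n f c ((\<lambda>k. (xs @ 0 # ys) ! (k - 1))(Suc (length xs) := x), b))"
      unfolding apply_cochain_def
    proof (rule cochain_slot_linear[OF f])
      have "Suc (length xs) \<in> {1..n}" using that by simp
      then show "slot_relations (scaleA E) (\<lambda>x. (c, (\<lambda>k. (xs @ 0 # ys) ! (k - 1))(Suc (length xs) := x), b))
          \<subseteq> tmat_null E n"
        unfolding tmat_null_def by (intro subset_trans[OF _ free.span_superset]) blast
    qed
    ultimately show ?thesis by simp
  qed
  show "linB (\<lambda>y. form_of n f c xs (b(i := (b i)(j := y))))"
    if "1 \<le> i" "i < j" "j \<le> n" for c xs b i j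
    unfolding form_of_def apply_cochain_def
  proof (rule cochain_slot_linear[OF f])
    have "i \<in> {1..n}" "j \<in> {i<..n}" using that by auto
    then show "slot_relations (scaleB E) (\<lambda>x. (c, \<lambda>k. xs ! (k - 1), b(i := (b i)(j := x)))) \<subseteq> tmat_null E n"
      unfolding tmat_null_def
      by (intro subset_trans[OF _ free.span_superset] le_supI1 le_supI2[OF subsetI]
          UN_I[of c UNIV] UN_I[of "\<lambda>k. xs ! (k - 1)" UNIV] UN_I[of b UNIV] UN_I[of i] UN_I[of j]) auto
  qed
  show "form_of n f c xs b = form_of n f c xs b'"
    if "\<And>i j. 1 \<le> i \<Longrightarrow> i < j \<Longrightarrow> j \<le> n \<Longrightarrow> b i j = b' i j" for c xs b b'
    unfolding form_of_def by (rule apply_cochain_cong) (use that in \<open>auto simp: same_tmat_def\<close>)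
qed

lemma free_extend_gen_id: "free_extend free_scale gen u = u"
proof (rule poly_mapping_eqI)
  fix x
  have "Poly_Mapping.lookup (free_extend free_scale gen u) x
      = (\<Sum>y\<in>Poly_Mapping.keys u. Poly_Mapping.lookup u y * (1 when y = x))"
    unfolding free_extend_def by (simp add: lookup_sum gen_def lookup_single)
  also have "\<dots> = Poly_Mapping.lookup u x"
    by (cases "x \<in> Poly_Mapping.keys u") (auto simp: when_def in_keys_iff sum.delta' mult_ac if_distrib cong: if_cong)
  finally show "Poly_Mapping.lookup (free_extend free_scale gen u) x = Poly_Mapping.lookup u x" .
qed

text \<open>Pure tensors span the domain, and outside of it both cochains are 0 by convention; hence
  they agree as total functions.\<close>

lemma cochain_eqI:
  assumes "f \<in> cochains E n" "g \<in> cochains E n"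
    and "\<And>c xs b. length xs = n \<Longrightarrow> form_of n f c xs b = form_of n g c xs b"
  shows "f = g"
proof
  fix X
  have coset: "h (u +o tmat_null E n) = free_extend (scaleA E) (\<lambda>(c, T). apply_cochain E n h c T) u"
    if "h \<in> cochains E n" for h u
    using A.linmap_of_free_extend[OF cochain_linear[OF that], of gen u]
    by (simp add: free_extend_gen_id apply_cochain_def split_def)
  have "apply_cochain E n f c (a, b) = apply_cochain E n g c (a, b)" for c a b
    unfolding apply_cochain_form by (rule assms(3)) simp
  then have "(\<lambda>(c, T). apply_cochain E n f c T) = (\<lambda>(c, T). apply_cochain E n g c T)"
    by (simp add: fun_eq_iff)
  then have "f (u +o tmat_null E n) = g (u +o tmat_null E n)" for u
    using assms(1,2) by (simp only: coset)
  then show "f X = g X"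
    using assms(1,2) by (cases "X \<in> tmat_space E n") (auto simp: cochains_def tmat_space_def quotient_space_def)
qed

text \<open>The four kinds of generators of the null space correspond to the four clauses of
  \<open>mform\<close>.\<close>

lemma free_extend_tmat_null:
  assumes F: "mform n F" and u: "u \<in> tmat_null E n"
  shows "free_extend (scaleA E) (\<lambda>(c, a, b). F c (map a [1..<Suc n]) b) u = 0"
    (is "free_extend _ ?F u = 0")
proof (rule A.linmap_vanishes_on_span[OF A.linmap_free_extend _ u[unfolded tmat_null_def]])
  fix v
  assume "v \<in> (\<Union>T. slot_relations (scaleC E) (\<lambda>c. (c, T))) \<union>
      (\<Union>c a b. \<Union>i\<in>{1..n}. slot_relations (scaleA E) (\<lambda>x. (c, a(i := x), b))) \<union>
      (\<Union>c a b. \<Union>i\<in>{1..n}. \<Union>j\<in>{i<..n}. slot_relations (scaleB E) (\<lambda>y. (c, a, b(i := (b i)(j := y))))) \<union>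
      {gen (c, T) - gen (c, T') | c T T'. same_tmat n T T'}"
  then consider
      (C) T where "v \<in> slot_relations (scaleC E) (\<lambda>c. (c, T))"
    | (A) c a b i where "i \<in> {1..n}" "v \<in> slot_relations (scaleA E) (\<lambda>x. (c, a(i := x), b))"
    | (B) c a b i j where "i \<in> {1..n}" "j \<in> {i<..n}"
        "v \<in> slot_relations (scaleB E) (\<lambda>y. (c, a, b(i := (b i)(j := y))))"
    | (same) c T T' where "v = gen (c, T) - gen (c, T')" "same_tmat n T T'"
    by fast
  then show "free_extend (scaleA E) ?F v = 0"
  proof cases
    case (C T)
    then show ?thesis
      by (rule A.free_extend_slot_relations) (simp add: split_def mform_linC[OF F])
  next
    case (A c a b i)
    have "[1..<Suc n] = [1..<i] @ i # [Suc i..<Suc n]"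
      using upt_add_eq_append[of 1 i "Suc n - i"] upt_conv_Cons[of i "Suc n"] A(1) by simp
    then have "map (a(i := x)) [1..<Suc n] = map a [1..<i] @ x # map a [Suc i..<Suc n]" for x
      by simp
    moreover have "linA (\<lambda>x. F c (map a [1..<i] @ x # map a [Suc i..<Suc n]) b)"
      using A(1) by (intro mform_linA[OF F]) auto
    ultimately show ?thesis
      by (intro A.free_extend_slot_relations[OF A(2)]) simp
  next
    case (B c a b i j)
    then have "linB (\<lambda>y. F c (map a [1..<Suc n]) (b(i := (b i)(j := y))))"
      by (intro mform_linB[OF F]) auto
    then show ?thesis
      by (intro A.free_extend_slot_relations[OF B(3)]) simp
  next
    case (same c T T')
    have "map (fst T') [1..<Suc n] = map (fst T) [1..<Suc n]"
      using same(2) by (auto simp: same_tmat_def simp del: upt_Suc)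
    moreover have "F c (map (fst T) [1..<Suc n]) (snd T) = F c (map (fst T) [1..<Suc n]) (snd T')"
      using same(2) by (intro mform_cong[OF F]) (auto simp: same_tmat_def)
    ultimately show ?thesis
      by (simp add: same(1) linmap_diff[OF A.linmap_free_extend] A.free_extend_gen split_def del: upt_Suc map_eq_conv)
  qed
qed

lemma cochain_of_form_coset:
  assumes "mform n F"
  shows "cochain_of_form n F (u +o tmat_null E n)
    = free_extend (scaleA E) (\<lambda>(c, a, b). F c (map a [1..<Suc n]) b) u"
proof -
  let ?X = "u +o tmat_null E n"
  have "(SOME v. v \<in> ?X) \<in> ?X"
    using free.coset_self[OF subspace_tmat_null] by (metis someI_ex)
  then have "(SOME v. v \<in> ?X) - u \<in> tmat_null E n"
    by (auto simp: elt_set_plus_def)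
  from free_extend_tmat_null[OF assms this] show ?thesis
    by (simp add: cochain_of_form_def cochain_of_def sweedler_def linmap_diff[OF A.linmap_free_extend]
        tmat_space_def quotient_space_def split_def del: upt_Suc)
qed

lemma cochain_of_form_in_cochains:
  assumes "mform n F"
  shows "cochain_of_form n F \<in> cochains E n"
proof -
  let ?f = "cochain_of_form n F"
  have "?f (X + Y) = ?f X + ?f Y" if XY: "X \<in> tmat_space E n" "Y \<in> tmat_space E n" for X Y
  proof -
    obtain u v where "X = u +o tmat_null E n" "Y = v +o tmat_null E n"
      using XY by (auto simp: tmat_space_def quotient_space_def)
    then show ?thesis
      by (simp only: free.coset_add[OF subspace_tmat_null] cochain_of_form_coset[OF assms]
          linmap_add[OF A.linmap_free_extend])
  qed
  moreover have "?f (quotient_scale free_scale (tmat_null E n) r X) = scaleA E r (?f X)"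
    if X: "X \<in> tmat_space E n" for r X
  proof -
    obtain u where "X = u +o tmat_null E n"
      using X by (auto simp: tmat_space_def quotient_space_def)
    then show ?thesis
      by (simp only: free.coset_scale[OF subspace_tmat_null] cochain_of_form_coset[OF assms]
          linmap_scale[OF A.linmap_free_extend])
  qed
  moreover have "?f X = 0" if "X \<notin> tmat_space E n" for X
    using that by (simp add: cochain_of_form_def cochain_of_def)
  ultimately show ?thesis
    by (simp add: cochains_def linear_map_on_def)
qed

lemma form_of_cochain_of_form:
  assumes "mform n F" "length xs = n"
  shows "form_of n (cochain_of_form n F) c xs b = F c xs b"
proof -
  have "map (\<lambda>k. xs ! (k - 1)) [1..<Suc n] = xs"
    using assms(2) by (intro nth_equalityI) (auto simp del: upt_Suc)
  then show ?thesis
    by (simp add: form_of_def apply_cochain_def cochain_of_form_coset[OF assms(1)] A.free_extend_gen del: upt_Suc)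
qed

text \<open>For an \<open>F\<close> that agrees on pure tensors with a known cochain there is no
  need to verify that \<open>F\<close> respects the relations. The differential and both products
  are identified in this way.\<close>

lemma cochain_of_eqI:
  assumes f: "f \<in> cochains E n" and F: "\<And>c a b. F c (a, b) = form_of n f c (map a [1..<Suc n]) b"
  shows "cochain_of E n F = f"
proof -
  have "F = (\<lambda>c (a, b). form_of n f c (map a [1..<Suc n]) b)"
    using F by (auto simp: fun_eq_iff simp del: upt_Suc)
  then have "cochain_of E n F = cochain_of_form n (form_of n f)"
    unfolding cochain_of_form_def by simp
  also have "\<dots> = f"
    by (intro cochain_eqI[of _ n] cochain_of_form_in_cochains form_of_cochain_of_form mform_form_of f)
  finally show ?thesis .
qed

lemma cochain_add:
  "f \<in> cochains E n \<Longrightarrow> g \<in> cochains E n \<Longrightarrow> f + g \<in> cochains E n"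
  by (simp add: cochains_def linear_map_on_def A.scale_right_distrib add_ac)

lemma cochain_scale_closed:
  "f \<in> cochains E n \<Longrightarrow> cochain_scale E r f \<in> cochains E n"
  by (simp add: cochains_def linear_map_on_def cochain_scale_def A.scale_right_distrib mult.commute)

lemma cochain_zero: "0 \<in> cochains E n"
  by (simp add: cochains_def linear_map_on_def)

lemma form_of_add: "form_of n (f + g) c xs b = form_of n f c xs b + form_of n g c xs b"
  by (simp add: form_of_def apply_cochain_def)

lemma form_of_scale: "form_of n (cochain_scale E r f) c xs b = scaleA E r (form_of n f c xs b)"
  by (simp add: form_of_def apply_cochain_def cochain_scale_def)

lemma vector_space_cochain_scale: "vector_space (cochain_scale E)"
  by standard (auto simp: cochain_scale_def fun_eq_iff A.scale_right_distrib A.scale_left_distrib)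

end


section \<open>Merging blocks of indices\<close>

text \<open>The monotone map of indices whose fibres are the sets \<open>block i n k\<close>. For
  \<open>n = 0\<close> it skips the value \<open>i + 1\<close>, whose fibre is empty: a form of
  degree 0 inserts a new entry.\<close>

definition place :: "nat \<Rightarrow> nat \<Rightarrow> nat \<Rightarrow> nat" where
  "place i n p = (if p \<le> i then p else if p \<le> i + n then i + 1 else p - n + 1)"

lemma fibre_place: "{p. place i n p = k} = block i n k"
  by (auto simp: place_def block_def split: if_splits)

lemma finite_fibre_place: "finite {p. place i n p = k}"
  by (simp add: fibre_place block_def)

lemma place_mono: "p \<le> q \<Longrightarrow> place i n p \<le> place i n q"
  by (auto simp: place_def)

lemma place_bounds: "1 \<le> p \<Longrightarrow> p \<le> m + n - 1 \<Longrightarrow> i < m \<Longrightarrow> 1 \<le> place i n p \<and> place i n p \<le> m"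
  by (auto simp: place_def)

text \<open>Collapsing an inner block and then the rest of the outer block around it is the same as
  collapsing the outer block at once.\<close>

lemma place_place_nested:
  assumes "i \<le> j" "j < n + i"
  shows "place i n (place j p x) = place i (n + p - 1) x"
proof -
  \<comment> \<open>Writing the inequalities as sums removes truncated subtraction from the case
    analysis.\<close>
  obtain s where j: "j = i + s"
    using assms(1) le_iff_add by blast
  obtain r where n: "n = Suc (s + r)"
    using assms(2) less_imp_Suc_add[of s n] by (auto simp: j)
  consider "x \<le> j + p" | t where "x = Suc (j + p + t)"
    using less_imp_Suc_add[of "j + p" x] by (meson not_le)
  then show ?thesis
    by cases (auto simp: j n place_def)
qed

text \<open>Disjoint blocks may be collapsed in either order; collapsing the earlier block moves the
  later one by \<open>p - 1\<close> places.\<close>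

lemma place_place_disjoint:
  assumes "j < i"
  shows "place i n (place j p x) = place j p (place (i + p - 1) n x)"
proof -
  obtain s where i: "i = Suc (j + s)"
    using assms less_imp_Suc_add by blast
  consider "x \<le> j + p" | t where "x = Suc (j + p + t)"
    using less_imp_Suc_add[of "j + p" x] by (meson not_le)
  then show ?thesis
    by cases (auto simp: i place_def)
qed

definition bmerge :: "(nat \<Rightarrow> nat) \<Rightarrow> (nat \<Rightarrow> nat \<Rightarrow> 'b::comm_monoid_mult) \<Rightarrow> nat \<Rightarrow> nat \<Rightarrow> 'b" where
  "bmerge \<pi> b r s = (\<Prod>p\<in>{p. \<pi> p = r}. \<Prod>q\<in>{q. \<pi> q = s}. b p q)"

definition bshift :: "nat \<Rightarrow> (nat \<Rightarrow> nat \<Rightarrow> 'b) \<Rightarrow> nat \<Rightarrow> nat \<Rightarrow> 'b" where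
  "bshift i b r s = b (r + i) (s + i)"

lemma bshift_0: "bshift 0 b = b"
  by (simp add: bshift_def fun_eq_iff)

lemma bshift_bshift: "bshift i (bshift j b) = bshift (i + j) b"
  by (simp add: bshift_def fun_eq_iff add.assoc)

text \<open>The fibres of \<open>\<rho>\<close> over a fibre of \<open>\<pi>\<close> partition the
  fibre of the composite. Iterated mergings are thereby compared through their index maps
  alone.\<close>

lemma bmerge_bmerge:
  assumes "\<And>k. finite {p. \<pi> p = k}" "\<And>k. finite {p. \<rho> p = k}"
  shows "bmerge \<pi> (bmerge \<rho> b) = bmerge (\<lambda>x. \<pi> (\<rho> x)) b"
proof -
  have *: "(\<Prod>p\<in>{p. \<pi> p = k}. \<Prod>x\<in>{x. \<rho> x = p}. h x) = (\<Prod>x\<in>{x. \<pi> (\<rho> x) = k}. h x)"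
    for h :: "nat \<Rightarrow> 'a" and k
  proof -
    have "{x. \<pi> (\<rho> x) = k} = (\<Union>p\<in>{p. \<pi> p = k}. {x. \<rho> x = p})" by auto
    then show ?thesis
      using assms by (auto intro: prod.UNION_disjoint[symmetric])
  qed
  have "(\<Prod>q\<in>{q. \<pi> q = s}. \<Prod>x\<in>{x. \<rho> x = p}. \<Prod>y\<in>{y. \<rho> y = q}. b x y)
      = (\<Prod>x\<in>{x. \<rho> x = p}. \<Prod>y\<in>{y. \<pi> (\<rho> y) = s}. b x y)" for p s
    by (subst prod.swap) (simp only: *)
  then show ?thesis
    by (simp add: fun_eq_iff bmerge_def *)
qed

lemma bmerge_low: "r \<le> i \<Longrightarrow> s \<le> i \<Longrightarrow> bmerge (place i n) b r s = b r s"
  by (simp add: bmerge_def fibre_place block_def)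

lemma bmerge_high: "i + 1 < r \<Longrightarrow> i + 1 < s \<Longrightarrow> bmerge (place i n) b r s = b (r + n - 1) (s + n - 1)"
  by (simp add: bmerge_def fibre_place block_def)

text \<open>The merged block lies behind the first \<open>i\<close> indices, so deleting these only
  renumbers the fibres.\<close>

lemma bshift_bmerge:
  assumes "i \<le> j" "1 \<le> r" "1 \<le> s"
  shows "bshift i (bmerge (place j p) b) r s = bmerge (place (j - i) p) (bshift i b) r s"
proof -
  have inj: "inj_on (\<lambda>x. x + i) X" for X by (simp add: inj_on_def)
  have "{x. place j p x = k + i} = (\<lambda>x. x + i) ` {x. place (j - i) p x = k}" if "1 \<le> k" for k
  proof (intro equalityI subsetI)
    fix x assume "x \<in> {x. place j p x = k + i}"
    then have "i \<le> x" "place (j - i) p (x - i) = k"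
      using assms(1) that by (auto simp: place_def split: if_splits)
    then show "x \<in> (\<lambda>x. x + i) ` {x. place (j - i) p x = k}"
      by (intro image_eqI[of _ _ "x - i"]) auto
  qed (use assms(1) that in \<open>auto simp: place_def split: if_splits\<close>)
  then show ?thesis
    using assms(2,3) by (simp add: bshift_def bmerge_def prod.reindex[OF inj])
qed

text \<open>One entry of \<open>b\<close> is a factor of exactly one merged entry, and
  \<open>z\<close> is the product of its other factors. That \<open>z\<close> works for all
  \<open>y\<close> is what yields linearity in the entry.\<close>

lemma bmerge_upd:
  fixes b :: "nat \<Rightarrow> nat \<Rightarrow> 'b::comm_monoid_mult"
  assumes "\<And>k. finite {p. \<pi> p = k}"
  shows "\<exists>z. \<forall>y. bmerge \<pi> (b(i := (b i)(j := y)))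
      = (bmerge \<pi> b)(\<pi> i := (bmerge \<pi> b (\<pi> i))(\<pi> j := z * y))"
proof -
  let ?b = "\<lambda>y. b(i := (b i)(j := y))"
  have split: "bmerge \<pi> b' (\<pi> i) (\<pi> j)
      = b' i j * (\<Prod>q\<in>{q. \<pi> q = \<pi> j} - {j}. b' i q) * (\<Prod>p\<in>{p. \<pi> p = \<pi> i} - {i}. \<Prod>q\<in>{q. \<pi> q = \<pi> j}. b' p q)" for b'
    unfolding bmerge_def
    by (subst prod.remove[OF assms, of i], simp, subst prod.remove[OF assms, of j]) simp_all
  have "bmerge \<pi> (?b y) r s = bmerge \<pi> b r s" if "(r, s) \<noteq> (\<pi> i, \<pi> j)" for y r s
    unfolding bmerge_def using that by (intro prod.cong) auto
  moreover have "bmerge \<pi> (?b y) (\<pi> i) (\<pi> j)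
      = (\<Prod>q\<in>{q. \<pi> q = \<pi> j} - {j}. b i q) * (\<Prod>p\<in>{p. \<pi> p = \<pi> i} - {i}. \<Prod>q\<in>{q. \<pi> q = \<pi> j}. b p q) * y" for y
  proof -
    have "(\<Prod>q\<in>{q. \<pi> q = \<pi> j} - {j}. ?b y i q) = (\<Prod>q\<in>{q. \<pi> q = \<pi> j} - {j}. b i q)"
      "(\<Prod>p\<in>{p. \<pi> p = \<pi> i} - {i}. \<Prod>q\<in>{q. \<pi> q = \<pi> j}. ?b y p q)
        = (\<Prod>p\<in>{p. \<pi> p = \<pi> i} - {i}. \<Prod>q\<in>{q. \<pi> q = \<pi> j}. b p q)"
      by (intro prod.cong; simp)+
    then show ?thesis
      unfolding split by (simp only:) (simp add: mult_ac)
  qed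
  ultimately show ?thesis
    by (intro exI[of _ "(\<Prod>q\<in>{q. \<pi> q = \<pi> j} - {j}. b i q) * (\<Prod>p\<in>{p. \<pi> p = \<pi> i} - {i}. \<Prod>q\<in>{q. \<pi> q = \<pi> j}. b p q)"])
       (auto simp: fun_eq_iff)
qed

lemma split_list2:
  assumes "length xs = i + j"
  obtains us vs where "xs = us @ vs" "length us = i" "length vs = j"
  using assms by (metis append_take_drop_id diff_add_inverse length_drop length_take min.absorb2 le_add1)

lemma split_list3:
  assumes "length xs = i + n + k"
  obtains us vs ws where "xs = us @ vs @ ws" "length us = i" "length vs = n" "length ws = k"
  by (metis assms split_list2 add.assoc)

lemma split_list_Cons_Cons:
  assumes "2 \<le> length xs"
  obtains x y ys where "xs = x # y # ys"
  using assms by (metis Suc_le_length_iff numeral_2_eq_2)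


section \<open>The operations on multilinear forms\<close>

context entwining_structure_over
begin

text \<open>The degree of \<open>F\<close> is no argument, as the length of \<open>xs\<close>
  determines it.\<close>

definition dform ::
    "nat \<Rightarrow> nat \<Rightarrow> ('c \<Rightarrow> 'a list \<Rightarrow> (nat \<Rightarrow> nat \<Rightarrow> 'b) \<Rightarrow> 'a) \<Rightarrow> ('c \<Rightarrow> 'a list \<Rightarrow> (nat \<Rightarrow> nat \<Rightarrow> 'b) \<Rightarrow> 'a) \<Rightarrow>
     'c \<Rightarrow> 'a list \<Rightarrow> (nat \<Rightarrow> nat \<Rightarrow> 'b) \<Rightarrow> 'a" where
  "dform n i F G c xs b =
     ext (\<lambda>c\<^sub>1 c\<^sub>2. ext (\<lambda>us c'.
         F c\<^sub>1 (us @ G c' (take n (drop i xs)) (bshift i b) # drop (i + n) xs) (bmerge (place i n) b))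
       (psi_list (take i xs) c\<^sub>2)) (comul_rep c)"

lemma dform_append:
  assumes "length us = i" "length vs = n"
  shows "dform n i F G c (us @ vs @ ws) b =
     ext (\<lambda>c\<^sub>1 c\<^sub>2. ext (\<lambda>us c'. F c\<^sub>1 (us @ G c' vs (bshift i b) # ws) (bmerge (place i n) b)) (psi_list us c\<^sub>2))
       (comul_rep c)"
  using assms by (simp add: dform_def)

lemma multilin_dform_summand:
  assumes "mform m F" "mform n G" "length vs = n" "i + 1 + length ws = m"
  shows "multilin i (\<lambda>us c'. F c (us @ G c' vs b # ws) b')"
proof (rule multilinI)
  show "linC (\<lambda>c'. F c (us @ G c' vs b # ws) b')" if "length us = i" for us
    by (rule linmap_compose[OF mform_linA[OF assms(1)] mform_linC[OF assms(2)]]) (use assms that in auto)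
  show "linA (\<lambda>x. F c ((us @ x # us') @ G c' vs b # ws) b')" if "length us + length us' + 1 = i" for us us' c'
    using mform_linA[OF assms(1), of us "us' @ G c' vs b # ws"] assms(4) that by simp
qed

text \<open>Each argument has a unique way into the composite: through the entwining, through
  \<open>G\<close>, or directly into \<open>F\<close>. The cases below follow this.\<close>

lemma mform_dform:
  assumes F: "mform m F" and G: "mform n G" and i: "i < m"
  shows "mform (m + n - 1) (dform n i F G)"
proof (rule mformI)
  fix xs :: "'a list" and b
  assume len: "length xs = m + n - 1"
  obtain us vs ws where xs: "xs = us @ vs @ ws" "length us = i" "length vs = n" "length ws = m - 1 - i"
    by (rule split_list3[of xs i n "m - 1 - i"]) (use i len in simp, rule that)
  have ws: "i + 1 + length ws = m" using xs i by simp
  show "linC (\<lambda>c. dform n i F G c xs b)"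
    unfolding xs(1) dform_append[OF xs(2,3)]
  proof (intro linC_comul linmap_ext)
    show "linC (\<lambda>c. F c (us' @ G d vs (bshift i b) # ws) (bmerge (place i n) b))"
      if "(us', d) \<in> Poly_Mapping.keys (psi_list us c\<^sub>2)" for us' d c\<^sub>2
      by (rule mform_linC[OF F]) (use length_psi_list[OF that] xs ws in simp)
  qed (rule linC_psi_list, use multilin_dform_summand[OF F G xs(3) ws] xs(2) in simp)
next
  fix c and xs ys :: "'a list" and b
  assume len: "length xs + length ys + 1 = m + n - 1"
  \<comment> \<open>The varied entry is entwined, is an argument of \<open>G\<close>, or goes to
    \<open>F\<close> unchanged.\<close>
  consider "length xs < i" | "i \<le> length xs" "length xs < i + n" | "i + n \<le> length xs"
    by linarith
  then show "linA (\<lambda>x. dform n i F G c (xs @ x # ys) b)"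
  proof cases
    case 1
    obtain us vs ws where ys: "ys = us @ vs @ ws" "length us = i - length xs - 1" "length vs = n" "length ws = m - 1 - i"
      by (rule split_list3[of ys "i - length xs - 1" n "m - 1 - i"]) (use i len 1 in simp, rule that)
    have "dform n i F G c (xs @ x # ys) b = ext (\<lambda>c\<^sub>1 c\<^sub>2. ext (\<lambda>us c'.
        F c\<^sub>1 (us @ G c' vs (bshift i b) # ws) (bmerge (place i n) b)) (psi_list (xs @ x # us) c\<^sub>2)) (comul_rep c)" for x
      using dform_append[of "xs @ x # us" i vs n F G c ws b] ys 1 by simp
    moreover have "linA (\<lambda>x. ext (\<lambda>c\<^sub>1 c\<^sub>2. ext (\<lambda>us c'.
        F c\<^sub>1 (us @ G c' vs (bshift i b) # ws) (bmerge (place i n) b)) (psi_list (xs @ x # us) c\<^sub>2)) (comul_rep c))"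
      by (intro linmap_ext linA_psi_list[OF multilin_dform_summand[OF F G]]) (use ys i 1 in auto)
    ultimately show ?thesis by simp
  next
    case 2
    obtain us xs' where xs: "xs = us @ xs'" "length us = i"
      by (rule split_list2[of xs i "length xs - i"]) (use 2 in simp, rule that)
    obtain ys' ws where ys: "ys = ys' @ ws" "length ys' = i + n - length xs - 1" "length ws = m - 1 - i"
      by (rule split_list2[of ys "i + n - length xs - 1" "m - 1 - i"]) (use 2 i len in simp, rule that)
    have "dform n i F G c (xs @ x # ys) b = ext (\<lambda>c\<^sub>1 c\<^sub>2. ext (\<lambda>us c'.
        F c\<^sub>1 (us @ G c' (xs' @ x # ys') (bshift i b) # ws) (bmerge (place i n) b)) (psi_list us c\<^sub>2)) (comul_rep c)" for x
      using dform_append[of us i "xs' @ x # ys'" n F G c ws b] xs ys 2 by simp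
    moreover have "linA (\<lambda>x. F c\<^sub>1 (us' @ G c' (xs' @ x # ys') (bshift i b) # ws) (bmerge (place i n) b))"
      if "length us' = i" for us' c\<^sub>1 c'
      by (rule linmap_compose[OF mform_linA[OF F] mform_linA[OF G]]) (use xs ys i 2 that in auto)
    then have "linA (\<lambda>x. ext (\<lambda>c\<^sub>1 c\<^sub>2. ext (\<lambda>us c'.
        F c\<^sub>1 (us @ G c' (xs' @ x # ys') (bshift i b) # ws) (bmerge (place i n) b)) (psi_list us c\<^sub>2)) (comul_rep c))"
      by (intro linmap_ext) (auto dest!: length_psi_list simp: xs(2))
    ultimately show ?thesis by simp
  next
    case 3
    obtain us vs xs' where xs: "xs = us @ vs @ xs'" "length us = i" "length vs = n"
      by (rule split_list3[of xs i n "length xs - n - i"]) (use 3 in simp, rule that)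
    have "dform n i F G c (xs @ x # ys) b = ext (\<lambda>c\<^sub>1 c\<^sub>2. ext (\<lambda>us c'.
        F c\<^sub>1 (us @ G c' vs (bshift i b) # xs' @ x # ys) (bmerge (place i n) b)) (psi_list us c\<^sub>2)) (comul_rep c)" for x
      using dform_append[of us i vs n F G c "xs' @ x # ys" b] xs by simp
    moreover have "linA (\<lambda>x. F c\<^sub>1 (us' @ G c' vs (bshift i b) # xs' @ x # ys) (bmerge (place i n) b))"
      if "length us' = i" for us' c\<^sub>1 c'
      using mform_linA[OF F, of "us' @ G c' vs (bshift i b) # xs'" ys] xs len i 3 that by simp
    then have "linA (\<lambda>x. ext (\<lambda>c\<^sub>1 c\<^sub>2. ext (\<lambda>us c'.
        F c\<^sub>1 (us @ G c' vs (bshift i b) # xs' @ x # ys) (bmerge (place i n) b)) (psi_list us c\<^sub>2)) (comul_rep c))"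
      by (intro linmap_ext) (auto dest!: length_psi_list simp: xs(2))
    ultimately show ?thesis by simp
  qed
next
  fix c and xs :: "'a list" and b :: "nat \<Rightarrow> nat \<Rightarrow> 'b" and k l
  assume len: "length xs = m + n - 1" and kl: "1 \<le> k" "k < l" "l \<le> m + n - 1"
  obtain us vs ws where xs: "xs = us @ vs @ ws" "length us = i" "length vs = n" "length ws = m - 1 - i"
    by (rule split_list3[of xs i n "m - 1 - i"]) (use i len in simp, rule that)
  have ws: "i + 1 + length ws = m" using xs i by simp
  let ?b = "\<lambda>y. b(k := (b k)(l := y))"
  have "linB (\<lambda>y. F c\<^sub>1 (us' @ G d vs (bshift i (?b y)) # ws) (bmerge (place i n) (?b y)))"
    if us': "length us' = i" for c\<^sub>1 us' d
  proof (cases "place i n k = place i n l")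
    \<comment> \<open>Both indices lie in the block, so the entry goes to \<open>G\<close>. For
      \<open>F\<close> the update hits a diagonal position of the merged matrix, which
      \<open>mform_cong\<close> ignores.\<close>
    case True
    then have J: "i < k" "l \<le> i + n"
      using kl by (auto simp: place_def split: if_splits)
    have "F c\<^sub>1 zs (bmerge (place i n) (?b y)) = F c\<^sub>1 zs (bmerge (place i n) b)" if "length zs = m" for zs y
    proof (rule mform_cong[OF F that])
      fix r s :: nat assume "r < s"
      obtain z where "bmerge (place i n) (?b y) = (bmerge (place i n) b)(place i n k :=
          (bmerge (place i n) b (place i n k))(place i n l := z * y))"
        using bmerge_upd[OF finite_fibre_place, of i n b k l] by blast
      then show "bmerge (place i n) (?b y) r s = bmerge (place i n) b r s"
        using \<open>r < s\<close> True by simp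
    qed
    moreover have "bshift i (?b y) = (bshift i b)(k - i := (bshift i b (k - i))(l - i := y))" for y
      using J kl by (auto simp: bshift_def fun_eq_iff)
    moreover have "linB (\<lambda>y. G d vs ((bshift i b)(k - i := (bshift i b (k - i))(l - i := y))))"
      by (rule mform_linB[OF G xs(3)]) (use J kl in auto)
    ultimately show ?thesis
      using us' ws by (simp add: linmap_compose[OF mform_linA[OF F]])
  next
    \<comment> \<open>Now \<open>G\<close> does not see the entry, and \<open>F\<close> sees it as a
      factor of one merged entry above the diagonal.\<close>
    case False
    then have lt: "place i n k < place i n l"
      using place_mono[of k l i n] kl by simp
    have "G d vs (bshift i (?b y)) = G d vs (bshift i b)" for y
    proof (rule mform_cong[OF G xs(3)])
      fix r s assume "1 \<le> r" "r < s" "s \<le> n"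
      then have "place i n (r + i) = place i n (s + i)" by (simp add: place_def)
      then show "bshift i (?b y) r s = bshift i b r s"
        using False by (auto simp: bshift_def)
    qed
    moreover obtain z where "\<And>y. bmerge (place i n) (?b y) = (bmerge (place i n) b)(place i n k :=
          (bmerge (place i n) b (place i n k))(place i n l := z * y))"
      using bmerge_upd[OF finite_fibre_place, of i n b k l] by blast
    moreover have "linB (\<lambda>y. F c\<^sub>1 zs ((bmerge (place i n) b)(place i n k :=
          (bmerge (place i n) b (place i n k))(place i n l := z * y))))" if "length zs = m" for zs z
    proof (rule linmap_compose[where f = "\<lambda>y. F c\<^sub>1 zs ((bmerge (place i n) b)(place i n k :=
          (bmerge (place i n) b (place i n k))(place i n l := y)))"])
      show "linmap (scaleB E) (scaleB E) ((*) z)"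
        by (simp add: linmapI distrib_left B.scale_mult_right)
    qed (use place_bounds[of k m n i] place_bounds[of l m n i] kl i lt that in \<open>auto intro: mform_linB[OF F]\<close>)
    ultimately show ?thesis
      using us' ws by simp
  qed
  then show "linB (\<lambda>y. dform n i F G c xs (?b y))"
    unfolding xs(1) dform_append[OF xs(2,3)]
    by (intro linmap_ext) (auto dest!: length_psi_list simp: xs(2))
next
  fix c and xs :: "'a list" and b b' :: "nat \<Rightarrow> nat \<Rightarrow> 'b"
  assume len: "length xs = m + n - 1" and eq: "\<And>k l. 1 \<le> k \<Longrightarrow> k < l \<Longrightarrow> l \<le> m + n - 1 \<Longrightarrow> b k l = b' k l"
  obtain us vs ws where xs: "xs = us @ vs @ ws" "length us = i" "length vs = n" "length ws = m - 1 - i"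
    by (rule split_list3[of xs i n "m - 1 - i"]) (use i len in simp, rule that)
  have ws: "i + 1 + length ws = m" using xs i by simp
  have "G d vs (bshift i b) = G d vs (bshift i b')" for d
    by (rule mform_cong[OF G xs(3)]) (use eq i in \<open>auto simp: bshift_def\<close>)
  moreover have "F c\<^sub>1 zs (bmerge (place i n) b) = F c\<^sub>1 zs (bmerge (place i n) b')" if "length zs = m" for c\<^sub>1 zs
  proof (rule mform_cong[OF F that])
    fix r s assume rs: "1 \<le> r" "r < s" "s \<le> m"
    have "b p q = b' p q" if "place i n p = r" "place i n q = s" for p q
      using that rs i by (intro eq) (auto simp: place_def split: if_splits)
    then show "bmerge (place i n) b r s = bmerge (place i n) b' r s"
      unfolding bmerge_def by (intro prod.cong) auto
  qed
  ultimately show "dform n i F G c xs b = dform n i F G c xs b'"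
    unfolding xs(1) dform_append[OF xs(2,3)]
    using ws by (intro ext_cong) (auto dest!: length_psi_list simp: xs(2))
qed

text \<open>Both sides are sums of the same \<open>W x y z\<close> over an iterated coproduct of
  \<open>c\<close>, bracketed to the left and to the right respectively, so coassociativity
  concludes. On the right the inner coproduct is taken after passing \<open>us\<close>;
  \<open>ext_psi_list_comul\<close> moves it in front.\<close>

lemma dform_assoc:
  assumes F: "mform m F" and G: "mform n G" and H: "mform p H"
    and i: "i < m" and j: "i \<le> j" "j < n + i" and len: "length xs + 2 = m + n + p"
  shows "dform p j (dform n i F G) H c xs b = dform (n + p - 1) i F (dform p (j - i) G H) c xs b"
proof -
  obtain us xs' where us: "xs = us @ xs'" "length us = i"
    by (rule split_list2[of xs i "length xs - i"]) (use i j len in simp, rule that)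
  obtain vs\<^sub>1 hs xs'' where vs\<^sub>1: "xs' = vs\<^sub>1 @ hs @ xs''" "length vs\<^sub>1 = j - i" "length hs = p"
    by (rule split_list3[of xs' "j - i" p "length xs' - p - (j - i)"]) (use i j len us in simp, rule that)
  obtain vs\<^sub>2 ws where vs\<^sub>2: "xs'' = vs\<^sub>2 @ ws" "length vs\<^sub>2 = n - 1 - (j - i)"
    by (rule split_list2[of xs'' "n - 1 - (j - i)" "length xs'' - (n - 1 - (j - i))"])
       (use i j len us vs\<^sub>1 in simp, rule that)
  have vs: "length vs\<^sub>1 + 1 + length vs\<^sub>2 = n" and ws: "i + 1 + length ws = m"
    using us vs\<^sub>1 vs\<^sub>2 i j len by simp_all
  define B where "B = bmerge (place i (n + p - 1)) b"
  define h where "h d = H d hs (bshift j b)" for d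
  define g where "g d vs = G d vs (bshift i (bmerge (place j p) b))" for d vs
  \<comment> \<open>Here \<open>x\<close> goes to \<open>F\<close>. The component \<open>z\<close>
    passes \<open>us\<close> first, \<open>y\<close> then passes the result and goes to
    \<open>G\<close>; what is left of \<open>z\<close> passes \<open>vs\<^sub>1\<close> and goes to
    \<open>H\<close>.\<close>
  define W where "W x y z = ext (\<lambda>us' d. ext (\<lambda>us'' e. ext (\<lambda>vs' e'.
      F x (us'' @ g e (vs' @ h e' # vs\<^sub>2) # ws) B) (psi_list vs\<^sub>1 d)) (psi_list us' y)) (psi_list us z)" for x y z
  have h_lin: "linC h"
    unfolding h_def using H vs\<^sub>1 by (intro mform_linC)
  have g_linC: "linC (\<lambda>d. g d vs)" if "length vs = n" for vs
    unfolding g_def using G that by (intro mform_linC)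
  have g_linA: "linA (\<lambda>x. g d (vs @ x # vs'))" if "length vs + length vs' + 1 = n" for d vs vs'
    unfolding g_def using G that by (intro mform_linA)
  have F_linA: "linA (\<lambda>y. F x (us' @ y # ws) B)" if "length us' = i" for us' x
    using F that ws by (intro mform_linA) auto
  have Fg_linC: "linC (\<lambda>e. F x (us' @ g e vs # ws) B)" if "length us' = i" "length vs = n" for us' vs x
    by (rule linmap_compose[OF F_linA g_linC]) (use that in auto)
  have multi_vs: "multilin (length vs\<^sub>1) (\<lambda>vs' e'. F x (us' @ g e (vs' @ h e' # vs\<^sub>2) # ws) B)"
    if us': "length us' = i" for us' e x
  proof (rule multilinI)
    show "linC (\<lambda>e'. F x (us' @ g e (vs' @ h e' # vs\<^sub>2) # ws) B)" if "length vs' = length vs\<^sub>1" for vs'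
      by (rule linmap_compose[OF F_linA linmap_compose[OF g_linA h_lin]]) (use us' that vs in auto)
    show "linA (\<lambda>y. F x (us' @ g e ((vs' @ y # vs'') @ h e' # vs\<^sub>2) # ws) B)"
      if "length vs' + length vs'' + 1 = length vs\<^sub>1" for vs' vs'' e'
      using linmap_compose[OF F_linA g_linA, of us' vs' "vs'' @ h e' # vs\<^sub>2"] us' that vs by simp
  qed
  have F_us_linA: "linA (\<lambda>y. F x ((us' @ y # us'') @ z # ws) B)" if "length us' + length us'' + 1 = i" for us' us'' x z
    using mform_linA[OF F, of us' "us'' @ z # ws"] that ws by simp
  have multi_us: "multilin i (\<lambda>us'' e. F x (us'' @ g e (vs' @ h e' # vs\<^sub>2) # ws) B)"
    if "length vs' = length vs\<^sub>1" for vs' e' x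
    using that vs by (intro multilinI Fg_linC F_us_linA) auto
  have multi_us2: "multilin i (\<lambda>us' d. ext (\<lambda>vs' e'. F x (us' @ g e (vs' @ h e' # vs\<^sub>2) # ws) B) (psi_list vs\<^sub>1 d))"
    for x e
    by (intro multilinI linC_psi_list multi_vs linmap_ext F_us_linA)
  have multi_us1: "multilin i (\<lambda>us' e. ext (\<lambda>vs' e'. F x (us' @ g e (vs' @ h e' # vs\<^sub>2) # ws) B) (psi_list vs\<^sub>1 d))"
    for x d
    using vs by (intro multilinI linmap_ext Fg_linC F_us_linA) (auto dest!: length_psi_list)

  have lhs: "dform p j (dform n i F G) H c xs b = ext (\<lambda>c\<^sub>1 z. ext (\<lambda>x y. W x y z) (comul_rep c\<^sub>1)) (comul_rep c)"
  proof -
    have "dform p j (dform n i F G) H c xs b = ext (\<lambda>c\<^sub>1 z. ext (\<lambda>us' d. ext (\<lambda>vs' e'.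
        dform n i F G c\<^sub>1 (us' @ (vs' @ h e' # vs\<^sub>2) @ ws) (bmerge (place j p) b))
          (psi_list vs\<^sub>1 d)) (psi_list us z)) (comul_rep c)"
      using dform_append[of "us @ vs\<^sub>1" j hs p "dform n i F G" H c "vs\<^sub>2 @ ws" b] us vs\<^sub>1 vs\<^sub>2 j
      by (simp add: ext_psi_list_append h_def)
    also have "\<dots> = ext (\<lambda>c\<^sub>1 z. ext (\<lambda>us' d. ext (\<lambda>vs' e'. ext (\<lambda>x y. ext (\<lambda>us'' e.
        F x (us'' @ g e (vs' @ h e' # vs\<^sub>2) # ws) B) (psi_list us' y)) (comul_rep c\<^sub>1))
          (psi_list vs\<^sub>1 d)) (psi_list us z)) (comul_rep c)"
    proof (intro ext_cong)
      fix c\<^sub>1 us' d vs' e' z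
      assume "(us', d) \<in> Poly_Mapping.keys (psi_list us z)" "(vs', e') \<in> Poly_Mapping.keys (psi_list vs\<^sub>1 d)"
      then have "length us' = i" "length (vs' @ h e' # vs\<^sub>2) = n"
        using us vs by (auto dest!: length_psi_list)
      then show "dform n i F G c\<^sub>1 (us' @ (vs' @ h e' # vs\<^sub>2) @ ws) (bmerge (place j p) b)
          = ext (\<lambda>x y. ext (\<lambda>us'' e. F x (us'' @ g e (vs' @ h e' # vs\<^sub>2) # ws) B) (psi_list us' y)) (comul_rep c\<^sub>1)"
        by (simp only: dform_append g_def B_def bmerge_bmerge[OF finite_fibre_place finite_fibre_place]
            place_place_nested[OF j])
    qed
    also have "\<dots> = ext (\<lambda>c\<^sub>1 z. ext (\<lambda>x y. W x y z) (comul_rep c\<^sub>1)) (comul_rep c)"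
    proof (rule ext_cong)
      fix c\<^sub>1 z
      \<comment> \<open>The inner sums have independent ranges, so they may be interchanged.\<close>
      have "ext (\<lambda>vs' e'. ext (\<lambda>x y. ext (\<lambda>us'' e.
          F x (us'' @ g e (vs' @ h e' # vs\<^sub>2) # ws) B) (psi_list us' y)) (comul_rep c\<^sub>1)) (psi_list vs\<^sub>1 d)
        = ext (\<lambda>x y. ext (\<lambda>us'' e. ext (\<lambda>vs' e'.
          F x (us'' @ g e (vs' @ h e' # vs\<^sub>2) # ws) B) (psi_list vs\<^sub>1 d)) (psi_list us' y)) (comul_rep c\<^sub>1)" for us' d
        by (subst ext_swap, rule ext_cong, rule ext_swap)
      then show "ext (\<lambda>us' d. ext (\<lambda>vs' e'. ext (\<lambda>x y. ext (\<lambda>us'' e.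
          F x (us'' @ g e (vs' @ h e' # vs\<^sub>2) # ws) B) (psi_list us' y)) (comul_rep c\<^sub>1))
            (psi_list vs\<^sub>1 d)) (psi_list us z) = ext (\<lambda>x y. W x y z) (comul_rep c\<^sub>1)"
        unfolding W_def by (simp only:) (rule ext_swap)
    qed
    finally show ?thesis .
  qed
  have rhs: "dform (n + p - 1) i F (dform p (j - i) G H) c xs b
      = ext (\<lambda>x c\<^sub>2. ext (\<lambda>y z. W x y z) (comul_rep c\<^sub>2)) (comul_rep c)"
  proof -
    have "bshift (j - i) (bshift i b) = bshift j b"
      using j by (simp add: bshift_bshift)
    moreover have "G d vs (bmerge (place (j - i) p) (bshift i b)) = g d vs" if "length vs = n" for d vs
      unfolding g_def using that j by (intro mform_cong[OF G]) (auto simp: bshift_bmerge)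
    ultimately have "dform p (j - i) G H d (vs\<^sub>1 @ hs @ vs\<^sub>2) (bshift i b)
        = ext (\<lambda>d\<^sub>1 d\<^sub>2. ext (\<lambda>vs' e'. g d\<^sub>1 (vs' @ h e' # vs\<^sub>2)) (psi_list vs\<^sub>1 d\<^sub>2)) (comul_rep d)" for d
      using vs unfolding dform_append[OF vs\<^sub>1(2,3)] h_def
      by (intro ext_cong) (auto dest!: length_psi_list)
    moreover have "length (vs\<^sub>1 @ hs @ vs\<^sub>2) = n + p - 1"
      using vs vs\<^sub>1 by simp
    ultimately have "dform (n + p - 1) i F (dform p (j - i) G H) c xs b
      = ext (\<lambda>x c\<^sub>2. ext (\<lambda>us' d. F x (us' @ ext (\<lambda>d\<^sub>1 d\<^sub>2. ext (\<lambda>vs' e'. g d\<^sub>1 (vs' @ h e' # vs\<^sub>2))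
          (psi_list vs\<^sub>1 d\<^sub>2)) (comul_rep d) # ws) B) (psi_list us c\<^sub>2)) (comul_rep c)"
      using dform_append[of us i "vs\<^sub>1 @ hs @ vs\<^sub>2" "n + p - 1" F "dform p (j - i) G H" c ws b] us vs\<^sub>1 vs\<^sub>2
      by (simp add: B_def)
    also have "\<dots> = ext (\<lambda>x c\<^sub>2. ext (\<lambda>us' d. ext (\<lambda>d\<^sub>1 d\<^sub>2. ext (\<lambda>vs' e'. F x (us' @ g d\<^sub>1 (vs' @ h e' # vs\<^sub>2) # ws) B)
          (psi_list vs\<^sub>1 d\<^sub>2)) (comul_rep d)) (psi_list us c\<^sub>2)) (comul_rep c)"
    proof (intro ext_cong)
      fix x c\<^sub>2 us' d
      assume "(us', d) \<in> Poly_Mapping.keys (psi_list us c\<^sub>2)"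
      then have "linA (\<lambda>y. F x (us' @ y # ws) B)"
        using us by (intro F_linA) (auto dest!: length_psi_list)
      then show "F x (us' @ ext (\<lambda>d\<^sub>1 d\<^sub>2. ext (\<lambda>vs' e'. g d\<^sub>1 (vs' @ h e' # vs\<^sub>2)) (psi_list vs\<^sub>1 d\<^sub>2)) (comul_rep d) # ws) B
        = ext (\<lambda>d\<^sub>1 d\<^sub>2. ext (\<lambda>vs' e'. F x (us' @ g d\<^sub>1 (vs' @ h e' # vs\<^sub>2) # ws) B) (psi_list vs\<^sub>1 d\<^sub>2)) (comul_rep d)"
        by (simp add: ext_linear[where f = "\<lambda>y. F x (us' @ y # ws) B"])
    qed
    \<comment> \<open>The coproduct of the entwined component \<open>d\<close> is exchanged for
      separate entwinings of the two components of \<open>c\<^sub>2\<close>.\<close>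
    also have "\<dots> = ext (\<lambda>x c\<^sub>2. ext (\<lambda>y z. W x y z) (comul_rep c\<^sub>2)) (comul_rep c)"
      unfolding W_def using multi_us1 multi_us2 us(2)
      by (intro ext_cong) (rule ext_psi_list_comul; simp)
    finally show ?thesis .
  qed
  have "linC (\<lambda>x. W x y z)" for y z
    unfolding W_def using ws vs us
    by (intro linmap_ext mform_linC[OF F]) (auto dest!: length_psi_list)
  moreover have "linC (\<lambda>y. W x y z)" for x z
    unfolding W_def using multi_us1 us(2)
    by (intro linmap_ext linC_psi_list) (auto dest!: length_psi_list)
  moreover have "linC (W x y)" for x y
    unfolding W_def
  proof (intro linC_psi_list multilinI)
    show "linC (\<lambda>d. ext (\<lambda>us'' e. ext (\<lambda>vs' e'. F x (us'' @ g e (vs' @ h e' # vs\<^sub>2) # ws) B) (psi_list vs\<^sub>1 d)) (psi_list us' y))"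
      if "length us' = length us" for us'
      using multi_vs us(2) that by (intro linmap_ext linC_psi_list) (auto dest!: length_psi_list)
    show "linA (\<lambda>v. ext (\<lambda>us'' e. ext (\<lambda>vs' e'. F x (us'' @ g e (vs' @ h e' # vs\<^sub>2) # ws) B) (psi_list vs\<^sub>1 d))
        (psi_list (us' @ v # us\<^sub>2) y))" if "length us' + length us\<^sub>2 + 1 = length us" for us' us\<^sub>2 d
      by (rule linA_psi_list[OF multi_us1]) (use us(2) that in simp)
  qed
  ultimately show ?thesis
    unfolding lhs rhs by (rule ext_coassoc)
qed

lemma dform_cong:
  assumes "\<And>c zs b. length zs = m \<Longrightarrow> F c zs b = F' c zs b" "\<And>c zs b. length zs = n \<Longrightarrow> G c zs b = G' c zs b"
    and "i < m" "length xs = m + n - 1"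
  shows "dform n i F G c xs b = dform n i F' G' c xs b"
  using assms unfolding dform_def by (intro ext_cong) (auto dest!: length_psi_list)

section \<open>Composition with the multiplication element\<close>

definition aform :: "'c \<Rightarrow> 'a list \<Rightarrow> (nat \<Rightarrow> nat \<Rightarrow> 'b) \<Rightarrow> 'a" where
  "aform c xs b = scaleA E (counit E c) (zeta E (b 1 2) * xs ! 0 * xs ! 1)"

lemma mform_aform: "mform 2 aform"
proof (rule mformI)
  show "linC (\<lambda>c. aform c xs b)" for xs b
    unfolding aform_def by (rule linmap_scale_fun[OF C.counit_linear])
  show "linA (\<lambda>x. aform c (xs @ x # ys) b)" if len: "length xs + length ys + 1 = 2" for c xs ys b
  proof (cases xs)
    case Nil
    then show ?thesis
      unfolding aform_def
      by (simp add: linmap_compose[OF linA_scale] linmap_compose[OF linA_mult_right] linA_mult_left)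
  next
    case (Cons x xs')
    then show ?thesis
      using len unfolding aform_def by (simp add: linmap_compose[OF linA_scale linA_mult_left])
  qed
  show "linB (\<lambda>y. aform c xs (b(i := (b i)(j := y))))" if "1 \<le> i" "i < j" "j \<le> 2" for c xs b i j
  proof -
    have "i = 1" "j = 2" using that by auto
    then show ?thesis
      unfolding aform_def
      by (simp add: linmap_compose[OF linA_scale] linmap_compose[OF linA_mult_right] zeta_linear)
  qed
  show "aform c xs b = aform c xs b'" if "\<And>i j. 1 \<le> i \<Longrightarrow> i < j \<Longrightarrow> j \<le> 2 \<Longrightarrow> b i j = b' i j" for c xs b b'
    using that[of 1 2] by (simp add: aform_def)
qed

text \<open>The counit first undoes the entwining of \<open>c\<^sub>2\<close> with \<open>us\<close>
  and then absorbs \<open>c\<^sub>2\<close>; only the merging of two neighbours remains.\<close>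

lemma dform_aform:
  assumes F: "mform m F" and len: "length us = j" "j + 1 + length ws = m"
  shows "dform 2 j F aform c (us @ x # y # ws) b
    = F c (us @ (zeta E (b (j + 1) (j + 2)) * x * y) # ws) (bmerge (place j 2) b)"
proof -
  let ?z = "zeta E (b (j + 1) (j + 2)) * x * y"
  let ?B = "bmerge (place j 2) b"
  have "dform 2 j F aform c (us @ x # y # ws) b = ext (\<lambda>c\<^sub>1 c\<^sub>2. ext (\<lambda>us' c'.
      F c\<^sub>1 (us' @ scaleA E (counit E c') ?z # ws) ?B) (psi_list us c\<^sub>2)) (comul_rep c)"
    using dform_append[of us j "[x, y]" 2 F aform c ws b] len by (simp add: aform_def bshift_def)
  also have "\<dots> = ext (\<lambda>c\<^sub>1 c\<^sub>2. ext (\<lambda>us' c'. scaleA E (counit E c') (F c\<^sub>1 (us' @ ?z # ws) ?B))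
      (psi_list us c\<^sub>2)) (comul_rep c)"
  proof (intro ext_cong)
    fix c\<^sub>1 c\<^sub>2 us' c'
    assume "(us', c') \<in> Poly_Mapping.keys (psi_list us c\<^sub>2)"
    then have "linA (\<lambda>z. F c\<^sub>1 (us' @ z # ws) ?B)"
      using len by (intro mform_linA[OF F]) (auto dest!: length_psi_list)
    then show "F c\<^sub>1 (us' @ scaleA E (counit E c') ?z # ws) ?B = scaleA E (counit E c') (F c\<^sub>1 (us' @ ?z # ws) ?B)"
      by (rule linmap_scale)
  qed
  also have "\<dots> = ext (\<lambda>c\<^sub>1 c\<^sub>2. scaleA E (counit E c\<^sub>2) (F c\<^sub>1 (us @ ?z # ws) ?B)) (comul_rep c)"
  proof (intro ext_cong ext_psi_list_counit)
    show "linA (\<lambda>v. F c\<^sub>1 ((us' @ v # us'') @ ?z # ws) ?B)" if "length us' + length us'' + 1 = length us" for c\<^sub>1 us' us''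
      using mform_linA[OF F, of us' "us'' @ ?z # ws"] that len by simp
  qed
  also have "\<dots> = F c (us @ ?z # ws) ?B"
    using len by (intro ext_counit_right mform_linC[OF F]) simp
  finally show ?thesis .
qed

text \<open>With \<open>aform\<close> outside, the counit absorbs \<open>c\<^sub>1\<close> and all
  of \<open>c\<close> reaches \<open>G\<close>. Up to sign this is the last term of the
  differential; \<open>dform_aform_right\<close> gives the first.\<close>

lemma dform_aform_left:
  assumes G: "mform n G" and len: "length vs = n"
  shows "dform n 0 aform G c (vs @ [w]) b = zeta E (\<Prod>p=1..n. b p (n + 1)) * G c vs b * w"
proof -
  have "dform n 0 aform G c (vs @ [w]) b
      = ext (\<lambda>c\<^sub>1 c\<^sub>2. aform c\<^sub>1 [G c\<^sub>2 vs (bshift 0 b), w] (bmerge (place 0 n) b)) (comul_rep c)"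
    using dform_append[of "[]" 0 vs n aform G c "[w]" b] len by (simp add: ext_psi_list_Nil del: psi_list.simps)
  also have "bmerge (place 0 n) b 1 2 = (\<Prod>p=1..n. b p (n + 1))"
    by (simp add: bmerge_def fibre_place block_def)
  then have "(\<lambda>c\<^sub>1 c\<^sub>2. aform c\<^sub>1 [G c\<^sub>2 vs (bshift 0 b), w] (bmerge (place 0 n) b))
      = (\<lambda>c\<^sub>1 c\<^sub>2. scaleA E (counit E c\<^sub>1) (zeta E (\<Prod>p=1..n. b p (n + 1)) * G c\<^sub>2 vs b * w))"
    by (simp add: aform_def bshift_0)
  also have "ext \<dots> (comul_rep c) = zeta E (\<Prod>p=1..n. b p (n + 1)) * G c vs b * w"
    by (intro ext_counit_left linmap_compose[OF linA_mult_right] linmap_compose[OF linA_mult_left] mform_linC[OF G] len)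
  finally show ?thesis .
qed

lemma dform_aform_right:
  assumes G: "mform n G" and len: "length vs = n"
  shows "dform n 1 aform G c (x # vs) b
    = zeta E (\<Prod>q=2..n+1. b 1 q) * ext (\<lambda>y d. y * G d vs (bshift 1 b)) (psi_rep c x)"
proof -
  let ?z = "zeta E (\<Prod>q=2..n+1. b 1 q)"
  have "bmerge (place 1 n) b 1 2 = (\<Prod>q=2..n+1. b 1 q)"
    by (simp add: bmerge_def fibre_place block_def numeral_2_eq_2)
  then have "dform n 1 aform G c (x # vs) b = ext (\<lambda>c\<^sub>1 c\<^sub>2. scaleA E (counit E c\<^sub>1)
      (?z * ext (\<lambda>y d. y * G d vs (bshift 1 b)) (psi_rep c\<^sub>2 x))) (comul_rep c)"
    using dform_append[of "[x]" 1 vs n aform G c "[]" b] len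
    by (simp add: ext_psi_list_Cons ext_psi_list_Nil aform_def ext_scale mult.assoc ext_linear[OF linA_mult_left]
        del: psi_list.simps)
  also have "\<dots> = ?z * ext (\<lambda>y d. y * G d vs (bshift 1 b)) (psi_rep c x)"
    by (intro ext_counit_left linmap_compose[OF linA_mult_left] linC_psi linA_mult_right mform_linC[OF G] len)
  finally show ?thesis .
qed

text \<open>The merged pair precedes the block of \<open>G\<close>. On the left it is merged and
  then entwined, on the right entwined and then merged, so \<open>ext_psi_list_merge\<close>
  compares the two.\<close>

lemma dform_swap_right:
  assumes F: "mform m F" and G: "mform n G" and ij: "j < i" "i < m" and len: "length xs = m + n"
  shows "dform 2 j (dform n i F G) aform c xs b = dform n (i + 1) (dform 2 j F aform) G c xs b"
proof -
  obtain us xs' where us: "xs = us @ xs'" "length us = j"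
    by (rule split_list2[of xs j "length xs - j"]) (use ij len in simp, rule that)
  obtain x y xs'' where xy: "xs' = x # y # xs''"
    by (rule split_list_Cons_Cons[of xs']) (use us ij len in simp, rule that)
  obtain us\<^sub>2 vs ws where us\<^sub>2: "xs'' = us\<^sub>2 @ vs @ ws" "length us\<^sub>2 = i - j - 1" "length vs = n" "length ws = m - 1 - i"
    by (rule split_list3[of xs'' "i - j - 1" n "m - 1 - i"]) (use ij len us xy in simp, rule that)
  have ws: "i + 1 + length ws = m" using us\<^sub>2 ij by simp
  let ?B = "bmerge (place i n) (bmerge (place j 2) b)"
  let ?z = "zeta E (b (j + 1) (j + 2))"
  have B: "bmerge (place j 2) (bmerge (place (i + 1) n) b) = ?B"
    by (simp add: bmerge_bmerge finite_fibre_place place_place_disjoint[OF ij(1)])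
  have g: "G d vs (bshift i (bmerge (place j 2) b)) = G d vs (bshift (i + 1) b)" for d
    using ij by (intro mform_cong[OF G us\<^sub>2(3)]) (auto simp: bshift_def bmerge_high)
  have multi: "multilin i (\<lambda>us' d. F c\<^sub>1 (us' @ G d vs b' # ws) ?B)" for c\<^sub>1 b'
    by (rule multilin_dform_summand[OF F G us\<^sub>2(3) ws])
  have "dform 2 j (dform n i F G) aform c xs b
      = dform n i F G c (us @ (?z * x * y) # us\<^sub>2 @ vs @ ws) (bmerge (place j 2) b)"
    using dform_aform[OF mform_dform[OF F G ij(2)] us(2), of "us\<^sub>2 @ vs @ ws"] us us\<^sub>2 xy ij by simp
  also have "\<dots> = ext (\<lambda>c\<^sub>1 c\<^sub>2. ext (\<lambda>us' d. F c\<^sub>1 (us' @ G d vs (bshift (i + 1) b) # ws) ?B)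
      (psi_list (us @ (?z * x * y) # us\<^sub>2) c\<^sub>2)) (comul_rep c)"
    using dform_append[of "us @ (?z * x * y) # us\<^sub>2" i vs n F G c ws "bmerge (place j 2) b"] us us\<^sub>2 ij g by simp
  also have "\<dots> = ext (\<lambda>c\<^sub>1 c\<^sub>2. ext (\<lambda>us' d. F c\<^sub>1 ((take j us' @ (?z * us' ! j * us' ! Suc j) # drop (Suc (Suc j)) us')
      @ G d vs (bshift (i + 1) b) # ws) ?B) (psi_list (us @ x # y # us\<^sub>2) c\<^sub>2)) (comul_rep c)"
    unfolding us(2)[symmetric]
    by (intro ext_cong ext_psi_list_merge) (use multi us us\<^sub>2 ij in simp)
  also have "\<dots> = ext (\<lambda>c\<^sub>1 c\<^sub>2. ext (\<lambda>us' d. dform 2 j F aform c\<^sub>1 (us' @ G d vs (bshift (i + 1) b) # ws)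
      (bmerge (place (i + 1) n) b)) (psi_list (us @ x # y # us\<^sub>2) c\<^sub>2)) (comul_rep c)"
  proof (intro ext_cong)
    fix c\<^sub>1 c\<^sub>2 us' d
    assume "(us', d) \<in> Poly_Mapping.keys (psi_list (us @ x # y # us\<^sub>2) c\<^sub>2)"
    then have us': "length us' = i + 1"
      using us us\<^sub>2 ij by (auto dest!: length_psi_list)
    \<comment> \<open>Exposes the two neighbours to be merged, in the shape required by
      \<open>dform_aform\<close>.\<close>
    then have "us' = take j us' @ us' ! j # us' ! Suc j # drop (Suc (Suc j)) us'"
      using ij by (simp add: Cons_nth_drop_Suc)
    then have "dform 2 j F aform c\<^sub>1 (us' @ G d vs (bshift (i + 1) b) # ws) (bmerge (place (i + 1) n) b)
      = dform 2 j F aform c\<^sub>1 (take j us' @ us' ! j # us' ! Suc j # drop (Suc (Suc j)) us' @ G d vs (bshift (i + 1) b) # ws)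
          (bmerge (place (i + 1) n) b)"
      by (metis append.assoc append_Cons)
    also have "\<dots> = F c\<^sub>1 (take j us' @ (?z * us' ! j * us' ! Suc j) # drop (Suc (Suc j)) us' @ G d vs (bshift (i + 1) b) # ws) ?B"
      using us' ws ij by (subst dform_aform[OF F]) (auto simp: bmerge_low B[simplified])
    finally show "F c\<^sub>1 ((take j us' @ (?z * us' ! j * us' ! Suc j) # drop (Suc (Suc j)) us') @ G d vs (bshift (i + 1) b) # ws) ?B
      = dform 2 j F aform c\<^sub>1 (us' @ G d vs (bshift (i + 1) b) # ws) (bmerge (place (i + 1) n) b)"
      by simp
  qed
  also have "\<dots> = dform n (i + 1) (dform 2 j F aform) G c xs b"
    using dform_append[of "us @ x # y # us\<^sub>2" "i + 1" vs n "dform 2 j F aform" G c ws b] us us\<^sub>2 xy ij by simp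
  finally show ?thesis .
qed

text \<open>The merged pair lies behind the block of \<open>H\<close> and is never entwined. After
  \<open>dform_aform\<close> nothing passes the value of \<open>H\<close> either, so only indices
  have to be compared.\<close>

lemma dform_swap_left:
  assumes F: "mform m F" and H: "mform p H" and ij: "j < i" "i < m" and len: "length xs = m + p"
  shows "dform p j (dform 2 i F aform) H c xs b = dform 2 (i + p - 1) (dform p j F H) aform c xs b"
proof -
  obtain us hs xs' where us: "xs = us @ hs @ xs'" "length us = j" "length hs = p" "length xs' = m - j"
    by (rule split_list3[of xs j p "m - j"]) (use ij len in simp, rule that)
  obtain us\<^sub>2 xs'' where us\<^sub>2: "xs' = us\<^sub>2 @ xs''" "length us\<^sub>2 = i - j - 1" "length xs'' = m - i + 1"
    by (rule split_list2[of xs' "i - j - 1" "m - i + 1"]) (use ij us in simp, rule that)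
  obtain x y ws where xy: "xs'' = x # y # ws"
    by (rule split_list_Cons_Cons[of xs'']) (use us\<^sub>2 ij in simp, rule that)
  have ws: "i + 1 + length ws = m" using us\<^sub>2 ij xy by simp
  let ?B = "bmerge (place i 2) (bmerge (place j p) b)"
  let ?z = "zeta E (b (i + p) (i + p + 1)) * x * y"
  have B: "bmerge (place j p) (bmerge (place (i + p - 1) 2) b) = ?B"
    by (simp add: bmerge_bmerge finite_fibre_place place_place_disjoint[OF ij(1)])
  have h: "H d hs (bshift j (bmerge (place (i + p - 1) 2) b)) = H d hs (bshift j b)" for d
    using ij by (intro mform_cong[OF H us(3)]) (auto simp: bshift_def bmerge_low)
  have "dform p j (dform 2 i F aform) H c xs b = ext (\<lambda>c\<^sub>1 c\<^sub>2. ext (\<lambda>us' d.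
      dform 2 i F aform c\<^sub>1 ((us' @ H d hs (bshift j b) # us\<^sub>2) @ x # y # ws) (bmerge (place j p) b))
        (psi_list us c\<^sub>2)) (comul_rep c)"
    using dform_append[OF us(2,3), of "dform 2 i F aform" H c xs' b] us us\<^sub>2 xy by simp
  also have "\<dots> = ext (\<lambda>c\<^sub>1 c\<^sub>2. ext (\<lambda>us' d. F c\<^sub>1 (us' @ H d hs (bshift j b) # us\<^sub>2 @ ?z # ws) ?B)
        (psi_list us c\<^sub>2)) (comul_rep c)"
  proof (intro ext_cong)
    fix c\<^sub>1 c\<^sub>2 us' d
    assume "(us', d) \<in> Poly_Mapping.keys (psi_list us c\<^sub>2)"
    then have "length (us' @ H d hs (bshift j b) # us\<^sub>2) = i"
      using us us\<^sub>2 ij by (auto dest!: length_psi_list)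
    \<comment> \<open>Behind the block of \<open>H\<close> the original indices exceed the merged
      ones by \<open>p - 1\<close>.\<close>
    moreover have "bmerge (place j p) b (i + 1) (i + 2) = b (i + p) (i + p + 1)"
      using ij by (simp add: bmerge_high)
    ultimately show "dform 2 i F aform c\<^sub>1 ((us' @ H d hs (bshift j b) # us\<^sub>2) @ x # y # ws) (bmerge (place j p) b)
        = F c\<^sub>1 (us' @ H d hs (bshift j b) # us\<^sub>2 @ ?z # ws) ?B"
      using ws by (subst dform_aform[OF F]) auto
  qed
  also have "\<dots> = dform p j F H c ((us @ hs @ us\<^sub>2) @ ?z # ws) (bmerge (place (i + p - 1) 2) b)"
    using dform_append[OF us(2,3), of F H c "us\<^sub>2 @ ?z # ws" "bmerge (place (i + p - 1) 2) b"] by (simp add: B h del: One_nat_def)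
  also have "\<dots> = dform 2 (i + p - 1) (dform p j F H) aform c ((us @ hs @ us\<^sub>2) @ x # y # ws) b"
    using us us\<^sub>2 ij ws
    by (subst dform_aform[OF mform_dform[OF F H]]) auto
  finally show ?thesis
    using us us\<^sub>2 xy by simp
qed

end


section \<open>The weak comp algebra of cochains\<close>

context entwining_structure_over
begin

text \<open>\<open>psi_iter\<close> grows at the last index while \<open>psi_list\<close> recurses
  on the head; \<open>ext_psi_list_append\<close> reconciles them.\<close>

lemma ext_psi_iter:
  "ext F (psi_iter E i c a)
    = ext (\<lambda>us d. F (\<lambda>k. if 1 \<le> k \<and> k \<le> i then us ! (k - 1) else a k) d) (psi_list (map a [1..<Suc i]) c)"
proof (induction i arbitrary: F)
  case 0
  have "(\<lambda>k. if 1 \<le> k \<and> k \<le> 0 then [] ! (k - 1) else a k) = a" by auto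
  then show ?case by (simp add: ext_gen)
next
  case (Suc i)
  let ?a = "\<lambda>i us k. if 1 \<le> k \<and> k \<le> i then us ! (k - 1) else a k"
  have upd: "(?a i us)(Suc i := x) = ?a (Suc i) (us @ [x])" if "length us = i" for us x
    using that by (auto simp: fun_eq_iff nth_append)
  have "ext F (psi_iter E (Suc i) c a)
      = ext (\<lambda>us d. ext (\<lambda>x. F ((?a i us)(Suc i := x))) (psi_rep d (a (Suc i)))) (psi_list (map a [1..<Suc i]) c)"
    by (simp add: ext_free_extend sweedler_psi ext_gen Suc.IH del: upt_Suc psi_list.simps)
  also have "\<dots> = ext (\<lambda>us d. ext (\<lambda>x. F (?a (Suc i) (us @ [x]))) (psi_rep d (a (Suc i)))) (psi_list (map a [1..<Suc i]) c)"
    by (rule ext_cong) (auto dest!: length_psi_list simp: upd simp del: upt_Suc One_nat_def)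
  also have "\<dots> = ext (\<lambda>us. F (?a (Suc i) us)) (psi_list (map a [1..<Suc i] @ [a (Suc i)]) c)"
    by (simp only: ext_psi_list_append ext_psi_list_Cons ext_psi_list_Nil)
  finally show ?case by simp
qed

lemma diamond_eq:
  assumes i: "i < m"
  shows "diamond E m n i f g = cochain_of_form (m + n - 1) (dform n i (form_of m f) (form_of n g))"
proof -
  let ?xs = "\<lambda>a. map a [1..<Suc (m + n - 1)]"
  have "sweedler (scaleA E) (\<lambda>(c\<^sub>1, c\<^sub>2). free_extend (scaleA E) (\<lambda>(a', c'). apply_cochain E m f c\<^sub>1
        (tmat_insert i n (apply_cochain E n g c' (tmat_shift i (a, b))) (a', b))) (psi_iter E i c\<^sub>2 a)) (comul E c)
    = dform n i (form_of m f) (form_of n g) c (?xs a) b" for a b c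
  proof -
    let ?a = "\<lambda>us k. if 1 \<le> k \<and> k \<le> i then us ! (k - 1) else a k"
    have upt: "[1..<Suc (m + n - 1)] = [1..<Suc i] @ [Suc i..<Suc (i + n)] @ [Suc (i + n)..<m + n]"
      using i upt_add_eq_append[of 1 "Suc i" "m + n - Suc i"] upt_add_eq_append[of "Suc i" "Suc (i + n)" "m - Suc i"]
      by (simp add: add.commute del: upt_Suc)
    have G: "apply_cochain E n g d (tmat_shift i (a, b)) = form_of n g d (take n (drop i (?xs a))) (bshift i b)" for d
    proof -
      have "map (\<lambda>k. a (k + i)) [1..<Suc n] = take n (drop i (?xs a))"
        by (intro nth_equalityI) (use i in \<open>auto simp: upt simp del: upt_Suc\<close>, simp add: add.commute)
      moreover have "(\<lambda>r s. b (r + i) (s + i)) = bshift i b"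
        by (simp add: fun_eq_iff bshift_def)
      ultimately show ?thesis
        by (simp add: tmat_shift_def apply_cochain_form del: upt_Suc)
    qed
    have F: "apply_cochain E m f d (tmat_insert i n x (?a us, b))
        = form_of m f d (us @ x # drop (i + n) (?xs a)) (bmerge (place i n) b)" if us: "length us = i" for d x us
    proof -
      have "map (\<lambda>k. if k \<le> i then ?a us k else if k = i + 1 then x else ?a us (k + n - 1)) [1..<Suc m]
          = us @ x # drop (i + n) (?xs a)"
        by (intro nth_equalityI) (use i us in \<open>auto simp: upt nth_append nth_Cons simp del: upt_Suc split: nat.split\<close>,
            rule arg_cong[of _ _ a], linarith)
      moreover have "(\<lambda>r s. \<Prod>p\<in>block i n r. \<Prod>q\<in>block i n s. b p q) = bmerge (place i n) b"
        by (simp add: fun_eq_iff bmerge_def fibre_place)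
      ultimately show ?thesis
        by (simp add: tmat_insert_def apply_cochain_form del: upt_Suc One_nat_def)
    qed
    have "take i (?xs a) = map a [1..<Suc i]"
      by (simp add: upt del: upt_Suc One_nat_def)
    moreover have "ext (\<lambda>us d. apply_cochain E m f c\<^sub>1 (tmat_insert i n (apply_cochain E n g d (tmat_shift i (a, b))) (?a us, b)))
        (psi_list (map a [1..<Suc i]) c\<^sub>2)
      = ext (\<lambda>us d. form_of m f c\<^sub>1 (us @ form_of n g d (take n (drop i (?xs a))) (bshift i b) # drop (i + n) (?xs a))
          (bmerge (place i n) b)) (psi_list (map a [1..<Suc i]) c\<^sub>2)" for c\<^sub>1 c\<^sub>2
      unfolding G by (intro ext_cong F) (auto dest!: length_psi_list)
    ultimately show ?thesis
      unfolding sweedler_comul ext_def[symmetric] ext_psi_iter dform_def by simp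
  qed
  then show ?thesis
    unfolding diamond_def cochain_of_form_def using i by simp
qed

lemma diamond_vanish: "m \<le> i \<Longrightarrow> diamond E m n i f g = 0"
  by (simp add: diamond_def)

lemma diamond_in_cochains:
  assumes "f \<in> cochains E m" "g \<in> cochains E n"
  shows "diamond E m n i f g \<in> cochains E (m + n - 1)"
proof (cases "i < m")
  case True
  then show ?thesis
    unfolding diamond_eq[OF True] by (intro cochain_of_form_in_cochains mform_dform mform_form_of assms)
next
  case False
  then show ?thesis by (simp add: diamond_def cochain_zero)
qed

lemma form_of_diamond:
  assumes "f \<in> cochains E m" "g \<in> cochains E n" "i < m" "length xs = m + n - 1"
  shows "form_of (m + n - 1) (diamond E m n i f g) c xs b = dform n i (form_of m f) (form_of n g) c xs b"
  unfolding diamond_eq[OF assms(3)]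
  by (intro form_of_cochain_of_form mform_dform mform_form_of assms)

lemma alpha_eq: "alpha E = cochain_of_form 2 aform"
proof -
  have "map a [1..<Suc 2] = [a 1, a 2]" for a :: "nat \<Rightarrow> 'a"
    by (simp add: numeral_2_eq_2)
  then show ?thesis
    unfolding alpha_def cochain_of_form_def aform_def by (simp del: upt_Suc)
qed

lemma alpha_in_cochains: "alpha E \<in> cochains E 2"
  unfolding alpha_eq by (rule cochain_of_form_in_cochains[OF mform_aform])

lemma form_of_alpha: "length xs = 2 \<Longrightarrow> form_of 2 (alpha E) c xs b = aform c xs b"
  unfolding alpha_eq by (rule form_of_cochain_of_form[OF mform_aform])

lemma diamond_linear_left:
  assumes g: "g \<in> cochains E n"
  shows "linear_map_on (cochains E m) (cochain_scale E) (cochain_scale E) (\<lambda>f. diamond E m n i f g)"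
proof (cases "i < m")
  case True
  have "diamond E m n i (f + f') g = diamond E m n i f g + diamond E m n i f' g"
    if "f \<in> cochains E m" "f' \<in> cochains E m" for f f'
    by (rule cochain_eqI[of _ "m + n - 1"])
       (simp_all add: that g diamond_in_cochains cochain_add form_of_add form_of_diamond True dform_def ext_add del: One_nat_def)
  moreover have "diamond E m n i (cochain_scale E r f) g = cochain_scale E r (diamond E m n i f g)"
    if "f \<in> cochains E m" for r f
    by (rule cochain_eqI[of _ "m + n - 1"])
       (simp_all add: that g diamond_in_cochains cochain_scale_closed form_of_scale form_of_diamond True dform_def ext_scale del: One_nat_def)
  ultimately show ?thesis
    by (simp add: linear_map_on_def)
qed (simp add: linear_map_on_def diamond_def cochain_scale_def fun_eq_iff)

lemma diamond_linear_right:
  assumes f: "f \<in> cochains E m"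
  shows "linear_map_on (cochains E n) (cochain_scale E) (cochain_scale E) (diamond E m n i f)"
proof (cases "i < m")
  case True
  have lin: "linA (\<lambda>x. form_of m f c (us @ x # drop (i + n) xs) b)"
    if "(us, d) \<in> Poly_Mapping.keys (psi_list (take i xs) c')" "length xs = m + n - 1" for us xs :: "'a list" and c d c' b
    by (rule mform_linA[OF mform_form_of[OF f]]) (use True that in \<open>auto dest!: length_psi_list\<close>)
  have "diamond E m n i f (g + g') = diamond E m n i f g + diamond E m n i f g'"
    if "g \<in> cochains E n" "g' \<in> cochains E n" for g g'
    by (rule cochain_eqI[of _ "m + n - 1"])
       (auto simp: that f diamond_in_cochains cochain_add form_of_add form_of_diamond True dform_def
          linmap_add[OF lin] ext_add[symmetric] intro!: ext_cong simp del: One_nat_def)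
  moreover have "diamond E m n i f (cochain_scale E r g) = cochain_scale E r (diamond E m n i f g)"
    if "g \<in> cochains E n" for r g
    by (rule cochain_eqI[of _ "m + n - 1"])
       (auto simp: that f diamond_in_cochains cochain_scale_closed form_of_scale form_of_diamond True dform_def
          linmap_scale[OF lin] ext_scale[symmetric] intro!: ext_cong simp del: One_nat_def)
  ultimately show ?thesis
    by (simp add: linear_map_on_def)
qed (simp add: linear_map_on_def diamond_def cochain_scale_def fun_eq_iff)

lemma diamond_zero_left: "diamond E m n i 0 g = 0" if "g \<in> cochains E n"
  using diamond_linear_left[OF that, of m i] cochain_zero[of m]
  by (metis (no_types, lifting) add.right_neutral add_left_cancel linear_map_on_def)

lemma diamond_assoc:
  assumes f: "f \<in> cochains E m" and g: "g \<in> cochains E n" and h: "h \<in> cochains E p"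
    and j: "i \<le> j" "j < n + i"
  shows "diamond E (m + n - 1) p j (diamond E m n i f g) h = diamond E m (n + p - 1) i f (diamond E n p (j - i) g h)"
proof (cases "i < m")
  case False
  then have "diamond E m n i f g = 0" "diamond E m (n + p - 1) i f (diamond E n p (j - i) g h) = 0"
    by (simp_all add: diamond_def)
  then show ?thesis by (simp add: diamond_zero_left h)
next
  case i: True
  \<comment> \<open>The assumptions make \<open>m\<close> and \<open>n\<close> positive, so all
    truncated subtractions are exact.\<close>
  have N: "m + n - 1 + p - 1 = m + (n + p - 1) - 1" using i j by simp
  show ?thesis
  proof (rule cochain_eqI)
    show "diamond E (m + n - 1) p j (diamond E m n i f g) h \<in> cochains E (m + (n + p - 1) - 1)"
      unfolding N[symmetric] by (intro diamond_in_cochains f g h)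
    show "diamond E m (n + p - 1) i f (diamond E n p (j - i) g h) \<in> cochains E (m + (n + p - 1) - 1)"
      by (intro diamond_in_cochains f g h)
    fix c b and xs :: "'a list"
    assume len: "length xs = m + (n + p - 1) - 1"
    have "form_of (m + n - 1 + p - 1) (diamond E (m + n - 1) p j (diamond E m n i f g) h) c xs b
        = dform p j (form_of (m + n - 1) (diamond E m n i f g)) (form_of p h) c xs b"
      by (rule form_of_diamond[OF diamond_in_cochains[OF f g] h]) (use len i j in auto)
    also have "\<dots> = dform p j (dform n i (form_of m f) (form_of n g)) (form_of p h) c xs b"
      by (rule dform_cong[of "m + n - 1" _ _ p]) (use len i j in \<open>auto simp: form_of_diamond[OF f g] simp del: One_nat_def\<close>)
    also have "\<dots> = dform (n + p - 1) i (form_of m f) (dform p (j - i) (form_of n g) (form_of p h)) c xs b"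
      by (rule dform_assoc[of m _ n _ p]) (use len i j in \<open>auto intro: mform_form_of f g h\<close>)
    also have "\<dots> = dform (n + p - 1) i (form_of m f) (form_of (n + p - 1) (diamond E n p (j - i) g h)) c xs b"
      by (rule dform_cong[of m _ _ "n + p - 1"]) (use len i j in \<open>auto simp: form_of_diamond[OF g h] simp del: One_nat_def\<close>)
    also have "\<dots> = form_of (m + (n + p - 1) - 1) (diamond E m (n + p - 1) i f (diamond E n p (j - i) g h)) c xs b"
      by (rule form_of_diamond[OF f diamond_in_cochains[OF g h], symmetric]) (use len i j in auto)
    finally show "form_of (m + (n + p - 1) - 1) (diamond E (m + n - 1) p j (diamond E m n i f g) h) c xs b
        = form_of (m + (n + p - 1) - 1) (diamond E m (n + p - 1) i f (diamond E n p (j - i) g h)) c xs b"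
      by (simp only: N)
  qed
qed

text \<open>\<open>F\<close>, \<open>G\<close>, \<open>H\<close> need to agree with the forms of the
  cochains only on lists of the right length, which allows \<open>aform\<close> in place of the form
  of \<open>alpha\<close>.\<close>

lemma form_of_diamond_diamond:
  assumes "f \<in> cochains E m" "g \<in> cochains E n" "h \<in> cochains E p"
    and "\<And>c zs b. length zs = m \<Longrightarrow> form_of m f c zs b = F c zs b"
    and "\<And>c zs b. length zs = n \<Longrightarrow> form_of n g c zs b = G c zs b"
    and "\<And>c zs b. length zs = p \<Longrightarrow> form_of p h c zs b = H c zs b"
    and "i < m" "j < m + n - 1" "length xs = m + n - 1 + p - 1"
  shows "form_of (m + n - 1 + p - 1) (diamond E (m + n - 1) p j (diamond E m n i f g) h) c xs b
    = dform p j (dform n i F G) H c xs b"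
proof -
  have "form_of (m + n - 1 + p - 1) (diamond E (m + n - 1) p j (diamond E m n i f g) h) c xs b
      = dform p j (form_of (m + n - 1) (diamond E m n i f g)) (form_of p h) c xs b"
    by (intro form_of_diamond diamond_in_cochains assms)
  also have "\<dots> = dform p j (dform n i F G) H c xs b"
  proof (rule dform_cong[of "m + n - 1" _ _ p])
    show "form_of (m + n - 1) (diamond E m n i f g) c zs b = dform n i F G c zs b"
      if "length zs = m + n - 1" for c zs b
      unfolding form_of_diamond[OF assms(1,2,7) that]
      by (rule dform_cong[of m _ _ n]) (use assms that in auto)
  qed (use assms in auto)
  finally show ?thesis .
qed

lemma diamond_swap:
  assumes f: "f \<in> cochains E m" and g: "g \<in> cochains E n" and h: "h \<in> cochains E p"
    and alpha: "(n = 2 \<and> g = alpha E) \<or> (p = 2 \<and> h = alpha E)" and j: "j < i"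
  shows "diamond E (m + n - 1) p j (diamond E m n i f g) h = diamond E (m + p - 1) n (i + p - 1) (diamond E m p j f h) g"
proof (cases "i < m")
  case False
  \<comment> \<open>From \<open>m \<le> i\<close> follows \<open>m + p - 1 \<le> i + p - 1\<close>,
    so the right side vanishes as well.\<close>
  have "diamond E m n i f g = 0" "diamond E (m + p - 1) n (i + p - 1) (diamond E m p j f h) g = 0"
    by (rule diamond_vanish, use False in simp)+
  then show ?thesis by (simp add: diamond_zero_left h)
next
  case i: True
  have N: "m + p - 1 + n - 1 = m + n - 1 + p - 1" using i j by simp
  show ?thesis
  proof (rule cochain_eqI)
    show "diamond E (m + n - 1) p j (diamond E m n i f g) h \<in> cochains E (m + n - 1 + p - 1)"
      by (intro diamond_in_cochains f g h)
    show "diamond E (m + p - 1) n (i + p - 1) (diamond E m p j f h) g \<in> cochains E (m + n - 1 + p - 1)"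
      unfolding N[symmetric] by (intro diamond_in_cochains f g h)
    fix c b and xs :: "'a list"
    assume len: "length xs = m + n - 1 + p - 1"
    from alpha show "form_of (m + n - 1 + p - 1) (diamond E (m + n - 1) p j (diamond E m n i f g) h) c xs b
        = form_of (m + n - 1 + p - 1) (diamond E (m + p - 1) n (i + p - 1) (diamond E m p j f h) g) c xs b"
    proof
      assume n: "n = 2 \<and> g = alpha E"
      have "form_of (m + n - 1 + p - 1) (diamond E (m + n - 1) p j (diamond E m n i f g) h) c xs b
          = dform p j (dform n i (form_of m f) aform) (form_of p h) c xs b"
        by (rule form_of_diamond_diamond[OF f g h]) (use n i j len in \<open>auto simp: form_of_alpha\<close>)
      moreover have "form_of (m + p - 1 + n - 1) (diamond E (m + p - 1) n (i + p - 1) (diamond E m p j f h) g) c xs b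
          = dform n (i + p - 1) (dform p j (form_of m f) (form_of p h)) aform c xs b"
        by (rule form_of_diamond_diamond[OF f h g]) (use n i j len in \<open>auto simp: form_of_alpha\<close>)
      ultimately show ?thesis
        using dform_swap_left[OF mform_form_of[OF f] mform_form_of[OF h] j i, of xs c b] n i j len N by simp
    next
      assume p: "p = 2 \<and> h = alpha E"
      have "form_of (m + n - 1 + p - 1) (diamond E (m + n - 1) p j (diamond E m n i f g) h) c xs b
          = dform p j (dform n i (form_of m f) (form_of n g)) aform c xs b"
        by (rule form_of_diamond_diamond[OF f g h]) (use p i j len in \<open>auto simp: form_of_alpha\<close>)
      moreover have "form_of (m + p - 1 + n - 1) (diamond E (m + p - 1) n (i + p - 1) (diamond E m p j f h) g) c xs b
          = dform n (i + p - 1) (dform p j (form_of m f) aform) (form_of n g) c xs b"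
        by (rule form_of_diamond_diamond[OF f h g]) (use p i j len in \<open>auto simp: form_of_alpha\<close>)
      ultimately show ?thesis
        using dform_swap_right[OF mform_form_of[OF f] mform_form_of[OF g] j i, of xs c b] p i j len N by simp
    qed
  qed
qed

text \<open>Both sides evaluate to the product of all three \<open>b\<close>-entries and all three
  diagonal entries, scaled by the counit; this uses commutativity of \<open>B\<close> and centrality
  of \<open>zeta\<close>.\<close>

lemma alpha_diamond_alpha: "diamond E 2 2 0 (alpha E) (alpha E) = diamond E 2 2 1 (alpha E) (alpha E)"
proof (rule cochain_eqI)
  show "diamond E 2 2 0 (alpha E) (alpha E) \<in> cochains E (2 + 2 - 1)"
    "diamond E 2 2 1 (alpha E) (alpha E) \<in> cochains E (2 + 2 - 1)"
    by (intro diamond_in_cochains alpha_in_cochains)+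
  fix c b and xs :: "'a list"
  assume len: "length xs = 2 + 2 - 1"
  then obtain x y z where xs: "xs = [x, y, z]"
    by (auto simp: numeral_eq_Suc length_Suc_conv)
  have form: "form_of (2 + 2 - 1) (diamond E 2 2 i (alpha E) (alpha E)) c xs b = dform 2 i aform aform c xs b"
    if "i < 2" for i
    unfolding form_of_diamond[OF alpha_in_cochains alpha_in_cochains that len]
    by (rule dform_cong[of 2 _ _ 2]) (use that len in \<open>auto simp: form_of_alpha\<close>)
  have "bmerge (place 0 2) b 1 2 = b 1 3 * b 2 3" "bmerge (place 1 2) b 1 2 = b 1 2 * b 1 3"
    by (simp_all add: bmerge_def fibre_place block_def numeral_eq_Suc)
  moreover have "dform 2 0 aform aform c xs b = aform c [zeta E (b 1 2) * x * y, z] (bmerge (place 0 2) b)"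
    "dform 2 1 aform aform c xs b = aform c [x, zeta E (b 2 3) * y * z] (bmerge (place 1 2) b)"
    using dform_aform[OF mform_aform, of "[]" 0 "[z]" c x y b] dform_aform[OF mform_aform, of "[x]" 1 "[]" c y z b]
    by (simp_all add: xs numeral_eq_Suc)
  moreover have "zeta E (b 1 3 * b 2 3) * (zeta E (b 1 2) * x * y) * z
      = zeta E (b 1 2 * b 1 3) * x * (zeta E (b 2 3) * y * z)"
  proof -
    have "x * (zeta E t * v) = zeta E t * (x * v)" for t v
      by (metis mult.assoc zeta_central)
    then have "zeta E (b 1 2 * b 1 3) * x * (zeta E (b 2 3) * y * z) = zeta E (b 1 2 * b 1 3 * b 2 3) * (x * y * z)"
      by (simp only: mult.assoc zeta_mult)
    also have "b 1 2 * b 1 3 * b 2 3 = b 1 3 * b 2 3 * b 1 2"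
      by (simp only: mult_ac)
    finally show ?thesis
      by (simp only: mult.assoc zeta_mult)
  qed
  ultimately have "dform 2 0 aform aform c xs b = dform 2 1 aform aform c xs b"
    by (simp add: aform_def del: One_nat_def)
  then show "form_of (2 + 2 - 1) (diamond E 2 2 0 (alpha E) (alpha E)) c xs b
      = form_of (2 + 2 - 1) (diamond E 2 2 1 (alpha E) (alpha E)) c xs b"
    by (simp only: form[of 0] form[of 1])
qed

lemma weak_comp_algebra_cochains: "weak_comp_algebra (cochain_scale E) (cochains E) (diamond E) (alpha E)"
proof -
  interpret cochain: vector_space "cochain_scale E" by (rule vector_space_cochain_scale)
  show ?thesis
    by unfold_locales
       (auto intro: diamond_in_cochains alpha_in_cochains diamond_assoc diamond_swap alpha_diamond_alpha
          cochain.subspaceI cochain_zero cochain_add cochain_scale_closed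
          simp: bilinear_map_on_def diamond_linear_left diamond_linear_right diamond_vanish
          simp del: One_nat_def)
qed

section \<open>The explicit products as composites with \<open>alpha\<close>\<close>

lemma apply_cochain_shift:
  "apply_cochain E n g d (tmat_shift i (a, b)) = form_of n g d (map a [Suc i..<Suc (i + n)]) (bshift i b)"
proof -
  have "map (\<lambda>k. a (k + i)) [1..<Suc n] = map a [Suc i..<Suc (i + n)]"
    by (intro nth_equalityI) (auto simp: add.commute simp del: upt_Suc)
  moreover have "(\<lambda>r s. b (r + i) (s + i)) = bshift i b"
    by (simp add: fun_eq_iff bshift_def)
  ultimately show ?thesis
    by (simp add: tmat_shift_def apply_cochain_form del: upt_Suc One_nat_def)
qed

text \<open>Inserting \<open>g\<close> at position \<open>m\<close> makes \<open>c\<^sub>2\<close>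
  pass the \<open>m\<close> arguments of \<open>f\<close>, and the counit of \<open>alpha\<close>
  leaves all of \<open>c\<^sub>1\<close> to \<open>f\<close>. In the merged matrix \<open>g\<close>
  has index \<open>m + 1\<close>, whose column collects the factors of
  \<open>\<beta>\<close>.\<close>

lemma cup_eq:
  assumes f: "f \<in> cochains E m" and g: "g \<in> cochains E n"
  shows "cup E m n f g = diamond E (m + 1) n m (diamond E 2 m 0 (alpha E) f) g"
proof -
  have deg: "2 + m - 1 = m + 1" "m + 1 + n - 1 = m + n" by simp_all
  have closed: "diamond E (m + 1) n m (diamond E 2 m 0 (alpha E) f) g \<in> cochains E (m + n)"
    using diamond_in_cochains[OF diamond_in_cochains[OF alpha_in_cochains f] g] unfolding deg .
  have form: "zeta E (\<Prod>r=1..m. \<Prod>s=m+1..m+n. b r s) * sweedler (scaleA E) (\<lambda>(c\<^sub>1, c\<^sub>2). free_extend (scaleA E) (\<lambda>(a', c').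
        apply_cochain E m f c\<^sub>1 (a', b) * apply_cochain E n g c' (tmat_shift m (a, b))) (psi_iter E m c\<^sub>2 a)) (comul E c)
      = form_of (m + n) (diamond E (m + 1) n m (diamond E 2 m 0 (alpha E) f) g) c (map a [1..<Suc (m + n)]) b" for c a b
  proof -
    let ?us = "map a [1..<Suc m]" and ?vs = "map a [Suc m..<Suc (m + n)]"
    let ?z = "zeta E (\<Prod>r=1..m. \<Prod>s=m+1..m+n. b r s)"
    let ?g = "\<lambda>d. form_of n g d ?vs (bshift m b)"
    have xs: "map a [1..<Suc (m + n)] = ?us @ ?vs"
      using upt_add_eq_append[of 1 "Suc m" n] by (simp del: upt_Suc)
    have "form_of (m + n) (diamond E (m + 1) n m (diamond E 2 m 0 (alpha E) f) g) c (?us @ ?vs) b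
        = dform n m (dform m 0 aform (form_of m f)) (form_of n g) c (?us @ ?vs) b"
      using form_of_diamond_diamond[OF alpha_in_cochains f g form_of_alpha refl refl, of 0 m "?us @ ?vs" c b]
      unfolding deg by (simp del: upt_Suc One_nat_def)
    also have "\<dots> = ext (\<lambda>c\<^sub>1 c\<^sub>2. ext (\<lambda>us d. dform m 0 aform (form_of m f) c\<^sub>1 (us @ [?g d]) (bmerge (place m n) b))
        (psi_list ?us c\<^sub>2)) (comul_rep c)"
      using dform_append[of ?us m ?vs n "dform m 0 aform (form_of m f)" "form_of n g" c "[]" b] by (simp del: upt_Suc)
    also have "\<dots> = ext (\<lambda>c\<^sub>1 c\<^sub>2. ext (\<lambda>us d. ?z * (form_of m f c\<^sub>1 us b * ?g d)) (psi_list ?us c\<^sub>2)) (comul_rep c)"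
    proof (intro ext_cong)
      fix c\<^sub>1 c\<^sub>2 us d
      assume "(us, d) \<in> Poly_Mapping.keys (psi_list ?us c\<^sub>2)"
      then have us: "length us = m" by (auto dest!: length_psi_list)
      have "form_of m f c\<^sub>1 us (bmerge (place m n) b) = form_of m f c\<^sub>1 us b"
        by (rule mform_cong[OF mform_form_of[OF f] us]) (simp add: bmerge_low)
      moreover have "(\<Prod>p=1..m. bmerge (place m n) b p (m + 1)) = (\<Prod>r=1..m. \<Prod>s=m+1..m+n. b r s)"
        by (intro prod.cong) (auto simp: bmerge_def fibre_place block_def)
      ultimately show "dform m 0 aform (form_of m f) c\<^sub>1 (us @ [?g d]) (bmerge (place m n) b)
          = ?z * (form_of m f c\<^sub>1 us b * ?g d)"
        by (simp only: dform_aform_left[OF mform_form_of[OF f] us] mult.assoc)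
    qed
    also have "\<dots> = ?z * ext (\<lambda>c\<^sub>1 c\<^sub>2. ext (\<lambda>us d. form_of m f c\<^sub>1 us b * ?g d) (psi_list ?us c\<^sub>2)) (comul_rep c)"
      by (simp only: ext_linear[OF linA_mult_left])
    also have "(\<lambda>c\<^sub>1 c\<^sub>2. ext (\<lambda>us d. form_of m f c\<^sub>1 us b * ?g d) (psi_list ?us c\<^sub>2))
      = (\<lambda>c\<^sub>1 c\<^sub>2. ext (\<lambda>a' c'. apply_cochain E m f c\<^sub>1 (a', b) * apply_cochain E n g c' (tmat_shift m (a, b)))
          (psi_iter E m c\<^sub>2 a))"
    proof (intro ext)
      fix c\<^sub>1 c\<^sub>2
      show "ext (\<lambda>us d. form_of m f c\<^sub>1 us b * ?g d) (psi_list ?us c\<^sub>2)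
        = ext (\<lambda>a' c'. apply_cochain E m f c\<^sub>1 (a', b) * apply_cochain E n g c' (tmat_shift m (a, b))) (psi_iter E m c\<^sub>2 a)"
        unfolding ext_psi_iter apply_cochain_shift
      proof (rule ext_cong)
        fix us d
        assume "(us, d) \<in> Poly_Mapping.keys (psi_list ?us c\<^sub>2)"
        then have "map (\<lambda>k. if 1 \<le> k \<and> k \<le> m then us ! (k - 1) else a k) [1..<Suc m] = us"
          by (intro nth_equalityI) (auto dest!: length_psi_list simp del: upt_Suc)
        then show "form_of m f c\<^sub>1 us b * ?g d
          = apply_cochain E m f c\<^sub>1 (\<lambda>k. if 1 \<le> k \<and> k \<le> m then us ! (k - 1) else a k, b) * ?g d"
          by (simp only: apply_cochain_form)
      qed
    qed
    finally show ?thesis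
      unfolding xs by (simp only: sweedler_comul ext_def)
  qed
  show ?thesis
    unfolding cup_def using closed by (rule cochain_of_eqI) (simp only: prod.case form)
qed

text \<open>At position 0 nothing precedes \<open>f\<close>, so it receives \<open>c\<^sub>2\<close>
  without entwining; its value then stands first in the composite of \<open>alpha\<close> and
  \<open>g\<close>, where \<open>c\<^sub>1\<close> passes it.\<close>

lemma sqcup_eq:
  assumes f: "f \<in> cochains E m" and g: "g \<in> cochains E n"
  shows "sqcup E m n f g = diamond E (n + 1) m 0 (diamond E 2 n 1 (alpha E) g) f"
proof -
  have deg: "2 + n - 1 = n + 1" "n + 1 + m - 1 = m + n" by simp_all
  have closed: "diamond E (n + 1) m 0 (diamond E 2 n 1 (alpha E) g) f \<in> cochains E (m + n)"
    using diamond_in_cochains[OF diamond_in_cochains[OF alpha_in_cochains g] f] unfolding deg .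
  have form: "zeta E (\<Prod>r=1..m. \<Prod>s=m+1..m+n. b r s) * sweedler (scaleA E) (\<lambda>(c\<^sub>1, c\<^sub>2). sweedler (scaleA E) (\<lambda>(x, c').
        x * apply_cochain E n g c' (tmat_shift m (a, b))) (psi E c\<^sub>1 (apply_cochain E m f c\<^sub>2 (a, b)))) (comul E c)
      = form_of (m + n) (diamond E (n + 1) m 0 (diamond E 2 n 1 (alpha E) g) f) c (map a [1..<Suc (m + n)]) b" for c a b
  proof -
    let ?us = "map a [1..<Suc m]" and ?vs = "map a [Suc m..<Suc (m + n)]"
    let ?z = "zeta E (\<Prod>r=1..m. \<Prod>s=m+1..m+n. b r s)"
    let ?g = "\<lambda>d. form_of n g d ?vs (bshift m b)"
    let ?B = "bmerge (place 0 m) b"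
    have xs: "map a [1..<Suc (m + n)] = ?us @ ?vs"
      using upt_add_eq_append[of 1 "Suc m" n] by (simp del: upt_Suc)
    have g': "form_of n g d ?vs (bshift 1 ?B) = ?g d" for d
      by (rule mform_cong[OF mform_form_of[OF g]]) (auto simp: bshift_def bmerge_high simp del: upt_Suc)
    have "(\<Prod>q=2..n+1. ?B 1 q) = (\<Prod>q=2..n+1. \<Prod>r=1..m. b r (q + m - 1))"
      by (intro prod.cong) (auto simp: bmerge_def fibre_place block_def)
    also have "\<dots> = (\<Prod>s=m+1..m+n. \<Prod>r=1..m. b r s)"
      \<comment> \<open>The merged index \<open>q\<close> behind the block of \<open>f\<close>
        stands for the original index \<open>q + m - 1\<close>.\<close>
      by (rule prod.reindex_bij_witness[of _ "\<lambda>s. s - m + 1" "\<lambda>q. q + m - 1"]) auto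
    also have "\<dots> = (\<Prod>r=1..m. \<Prod>s=m+1..m+n. b r s)"
      by (rule prod.swap)
    finally have z: "zeta E (\<Prod>q=2..n+1. ?B 1 q) = ?z" by simp
    have "form_of (m + n) (diamond E (n + 1) m 0 (diamond E 2 n 1 (alpha E) g) f) c (?us @ ?vs) b
        = dform m 0 (dform n 1 aform (form_of n g)) (form_of m f) c (?us @ ?vs) b"
      using form_of_diamond_diamond[OF alpha_in_cochains g f form_of_alpha refl refl, of 1 0 "?us @ ?vs" c b]
      unfolding deg by (simp del: upt_Suc One_nat_def)
    also have "\<dots> = ext (\<lambda>c\<^sub>1 c\<^sub>2. dform n 1 aform (form_of n g) c\<^sub>1 (form_of m f c\<^sub>2 ?us b # ?vs) ?B) (comul_rep c)"
      using dform_append[of "[]" 0 ?us m "dform n 1 aform (form_of n g)" "form_of m f" c ?vs b]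
      by (simp add: ext_psi_list_Nil bshift_0 del: upt_Suc psi_list.simps)
    also have "\<dots> = ext (\<lambda>c\<^sub>1 c\<^sub>2. ?z * ext (\<lambda>x d. x * ?g d) (psi_rep c\<^sub>1 (form_of m f c\<^sub>2 ?us b))) (comul_rep c)"
    proof -
      have "length ?vs = n" by (simp del: upt_Suc)
      then show ?thesis
        by (simp only: dform_aform_right[OF mform_form_of[OF g]] g' z)
    qed
    also have "\<dots> = ?z * ext (\<lambda>c\<^sub>1 c\<^sub>2. ext (\<lambda>x d. x * ?g d) (psi_rep c\<^sub>1 (form_of m f c\<^sub>2 ?us b))) (comul_rep c)"
      by (simp only: ext_linear[OF linA_mult_left])
    finally show ?thesis
      unfolding xs by (simp only: sweedler_comul sweedler_psi ext_def apply_cochain_shift apply_cochain_form)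
  qed
  show ?thesis
    unfolding sqcup_def using closed by (rule cochain_of_eqI) (simp only: prod.case form)
qed

end


section \<open>Cup products in weak comp algebras\<close>

lemma linear_map_on_sum:
  fixes f :: "'v::ab_group_add \<Rightarrow> 'w::ab_group_add"
  assumes "vector_space s" "module.subspace s V" "linear_map_on V s s' f" "\<And>i. i \<in> I \<Longrightarrow> x i \<in> V"
  shows "f (\<Sum>i\<in>I. s (c i) (x i)) = (\<Sum>i\<in>I. s' (c i) (f (x i)))"
proof -
  interpret vector_space s by fact
  have zero: "f 0 = 0"
    using assms(3) subspace_0[OF assms(2)] by (metis add_cancel_left_left linear_map_on_def)
  show ?thesis
    using assms(4)
  proof (induction I rule: infinite_finite_induct)
    case (insert i I)
    have "(\<Sum>i\<in>I. s (c i) (x i)) \<in> V" "s (c i) (x i) \<in> V"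
      using insert.prems by (auto intro: subspace_sum subspace_scale assms(2))
    then show ?case
      using insert assms(3) by (simp add: linear_map_on_def)
  qed (simp_all add: zero)
qed

context weak_comp_algebra
begin

section \<open>Bilinearity and the axioms with \<open>\<alpha>\<close>\<close>

lemma op_add_left: "f \<in> V m \<Longrightarrow> f' \<in> V m \<Longrightarrow> g \<in> V n \<Longrightarrow> op m n i (f + f') g = op m n i f g + op m n i f' g"
  using op_bilinear[of m n i] by (simp add: bilinear_map_on_def linear_map_on_def)

lemma op_add_right: "f \<in> V m \<Longrightarrow> g \<in> V n \<Longrightarrow> g' \<in> V n \<Longrightarrow> op m n i f (g + g') = op m n i f g + op m n i f g'"
  using op_bilinear[of m n i] by (simp add: bilinear_map_on_def linear_map_on_def)

lemma op_scale_left: "f \<in> V m \<Longrightarrow> g \<in> V n \<Longrightarrow> op m n i (scale r f) g = scale r (op m n i f g)"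
  using op_bilinear[of m n i] by (simp add: bilinear_map_on_def linear_map_on_def)

lemma op_scale_right: "f \<in> V m \<Longrightarrow> g \<in> V n \<Longrightarrow> op m n i f (scale r g) = scale r (op m n i f g)"
  using op_bilinear[of m n i] by (simp add: bilinear_map_on_def linear_map_on_def)

lemma op_sum_left:
  "(\<And>k. k \<in> I \<Longrightarrow> f k \<in> V m) \<Longrightarrow> g \<in> V n \<Longrightarrow>
   op m n i (\<Sum>k\<in>I. scale (c k) (f k)) g = (\<Sum>k\<in>I. scale (c k) (op m n i (f k) g))"
  by (rule linear_map_on_sum[OF vector_space_axioms graded, where f = "\<lambda>f. op m n i f g"])
     (use op_bilinear[of m n i] in \<open>auto simp: bilinear_map_on_def\<close>)

lemma op_sum_right:
  "f \<in> V m \<Longrightarrow> (\<And>k. k \<in> I \<Longrightarrow> g k \<in> V n) \<Longrightarrow>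
   op m n i f (\<Sum>k\<in>I. scale (c k) (g k)) = (\<Sum>k\<in>I. scale (c k) (op m n i f (g k)))"
  by (rule linear_map_on_sum[OF vector_space_axioms graded])
     (use op_bilinear[of m n i] in \<open>auto simp: bilinear_map_on_def\<close>)

lemma op_zero_left: "g \<in> V n \<Longrightarrow> op m n i 0 g = 0"
  using op_sum_left[of "{}" "\<lambda>_. 0" m g n] by simp

lemma op_zero_right: "f \<in> V m \<Longrightarrow> op m n i f 0 = 0"
  using op_sum_right[of f m "{}" "\<lambda>_. 0" n] by simp

lemma op_minus_left: "f \<in> V m \<Longrightarrow> g \<in> V n \<Longrightarrow> op m n i (- f) g = - op m n i f g"
  using op_scale_left[of f m g n i "-1"] by simp

lemma alpha_op_closed: "f \<in> V n \<Longrightarrow> op 2 n i \<alpha> f \<in> V (n + 1)"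
  using op_closed[OF alpha_closed, of f n i] by simp

lemma op_alpha_closed: "f \<in> V n \<Longrightarrow> op n 2 i f \<alpha> \<in> V (n + 1)"
  using op_closed[OF _ alpha_closed, of f n i] by simp

lemma alpha_op_assoc:
  assumes "f \<in> V m" "g \<in> V n" "i \<le> j" "j < m + i"
  shows "op (m + 1) n j (op 2 m i \<alpha> f) g = op 2 (m + n - 1) i \<alpha> (op m n (j - i) f g)"
  using op_assoc[OF alpha_closed assms] by simp

lemma op_alpha_assoc:
  assumes "f \<in> V m" "g \<in> V n" "i \<le> j" "j < 2 + i"
  shows "op (m + 1) n j (op m 2 i f \<alpha>) g = op m (n + 1) i f (op 2 n (j - i) \<alpha> g)"
  using op_assoc[OF assms(1) alpha_closed assms(2-4)] by simp

lemma op_assoc_alpha: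
  assumes "f \<in> V m" "g \<in> V n" "i \<le> j" "j < n + i"
  shows "op (m + n - 1) 2 j (op m n i f g) \<alpha> = op m (n + 1) i f (op n 2 (j - i) g \<alpha>)"
  using op_assoc[OF assms(1,2) alpha_closed assms(3,4)] by simp

lemma op_alpha_swap:
  assumes "f \<in> V m" "g \<in> V n" "j < i"
  shows "op (m + n - 1) 2 j (op m n i f g) \<alpha> = op (m + 1) n (i + 1) (op m 2 j f \<alpha>) g"
  using op_swap[OF assms(1,2) alpha_closed _ assms(3)] by simp

text \<open>Since \<open>\<alpha> \<diamond>\<^sub>0 \<alpha>\<close> and
  \<open>\<alpha> \<diamond>\<^sub>1 \<alpha>\<close> coincide, a double composite with
  \<open>\<alpha>\<close> depends only on the sum of its two positions.\<close>

lemma alpha_alpha_op: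
  assumes "f \<in> V n" "i < 2"
  shows "op 2 (n + 1) 0 \<alpha> (op 2 n i \<alpha> f) = op 3 n i (op 2 2 0 \<alpha> \<alpha>) f"
    "op 2 (n + 1) 1 \<alpha> (op 2 n i \<alpha> f) = op 3 n (i + 1) (op 2 2 0 \<alpha> \<alpha>) f"
  using op_assoc[OF alpha_closed alpha_closed assms(1), of 0 i] assms(2)
    op_assoc[OF alpha_closed alpha_closed assms(1), of 1 "i + 1"] alpha_alpha by simp_all

definition comp_diff :: "nat \<Rightarrow> 'v \<Rightarrow> 'v" where
  "comp_diff n f = op 2 n 1 \<alpha> f + (\<Sum>k<n. scale ((-1) ^ (k + 1)) (op n 2 k f \<alpha>)) + scale ((-1) ^ (n + 1)) (op 2 n 0 \<alpha> f)"

text \<open>The differential is cut at \<open>i\<close> because the faces of \<open>f\<close> before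
  and after an inserted \<open>g\<close> end up at different positions and with different
  signs.\<close>

definition diff_init :: "nat \<Rightarrow> nat \<Rightarrow> 'v \<Rightarrow> 'v" where
  "diff_init n i f = op 2 n 1 \<alpha> f + (\<Sum>k<i. scale ((-1) ^ (k + 1)) (op n 2 k f \<alpha>))"

definition diff_tail :: "nat \<Rightarrow> nat \<Rightarrow> 'v \<Rightarrow> 'v" where
  "diff_tail n i f = (\<Sum>k\<in>{i..<n}. scale ((-1) ^ (k + 1)) (op n 2 k f \<alpha>)) + scale ((-1) ^ (n + 1)) (op 2 n 0 \<alpha> f)"

definition comp_cup :: "nat \<Rightarrow> nat \<Rightarrow> 'v \<Rightarrow> 'v \<Rightarrow> 'v" where
  "comp_cup m n f g = op (m + 1) n m (op 2 m 0 \<alpha> f) g"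

definition comp_sqcup :: "nat \<Rightarrow> nat \<Rightarrow> 'v \<Rightarrow> 'v \<Rightarrow> 'v" where
  "comp_sqcup m n f g = op (n + 1) m 0 (op 2 n 1 \<alpha> g) f"

lemma comp_diff_split: "i \<le> n \<Longrightarrow> comp_diff n f = diff_init n i f + diff_tail n i f"
  unfolding comp_diff_def diff_init_def diff_tail_def
  using sum.union_disjoint[of "{..<i}" "{i..<n}" "\<lambda>k. scale ((-1) ^ (k + 1)) (op n 2 k f \<alpha>)"]
  by (simp add: ivl_disj_un_one(2) ivl_disj_int_one(2) add.assoc)

lemma diff_init_closed: "f \<in> V n \<Longrightarrow> diff_init n i f \<in> V (n + 1)"
  unfolding diff_init_def
  by (intro subspace_add[OF graded] subspace_sum[OF graded] subspace_scale[OF graded] alpha_op_closed op_alpha_closed)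

lemma diff_tail_closed: "f \<in> V n \<Longrightarrow> diff_tail n i f \<in> V (n + 1)"
  unfolding diff_tail_def
  by (intro subspace_add[OF graded] subspace_sum[OF graded] subspace_scale[OF graded] alpha_op_closed op_alpha_closed)

lemma comp_diff_closed: "f \<in> V n \<Longrightarrow> comp_diff n f \<in> V (n + 1)"
  unfolding comp_diff_split[OF order_refl] by (intro subspace_add[OF graded] diff_init_closed diff_tail_closed)

lemma comp_cup_closed: "f \<in> V m \<Longrightarrow> g \<in> V n \<Longrightarrow> comp_cup m n f g \<in> V (m + n)"
  unfolding comp_cup_def using op_closed[OF alpha_op_closed, of f m g n m 0] by simp

lemma comp_sqcup_closed: "f \<in> V m \<Longrightarrow> g \<in> V n \<Longrightarrow> comp_sqcup m n f g \<in> V (m + n)"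
  unfolding comp_sqcup_def using op_closed[OF alpha_op_closed, of g n f m 0 1] by (simp add: add.commute)

lemma comp_diff_linear: "linear_map_on (V n) scale scale (comp_diff n)"
  unfolding linear_map_on_def comp_diff_def
  by (simp add: op_add_left op_add_right op_scale_left op_scale_right alpha_closed sum.distrib
      scale_right_distrib scale_sum_right mult.commute add_ac del: power_Suc)

lemma comp_cup_bilinear: "bilinear_map_on (V m) scale (V n) scale scale (comp_cup m n)"
  unfolding bilinear_map_on_def linear_map_on_def comp_cup_def
  by (simp add: op_add_left[of _ "Suc m"] op_add_right op_scale_left[of _ "Suc m"] op_scale_right alpha_closed
      alpha_op_closed[simplified])

lemma comp_sqcup_bilinear: "bilinear_map_on (V m) scale (V n) scale scale (comp_sqcup m n)"
  unfolding bilinear_map_on_def linear_map_on_def comp_sqcup_def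
  by (simp add: op_add_left[of _ "Suc n"] op_add_right op_scale_left[of _ "Suc n"] op_scale_right alpha_closed
      alpha_op_closed[simplified])

text \<open>
  The partial products \<open>f \<diamond>\<^sub>i g\<close> interpolate between \<open>\<union>\<close> and \<open>\<squnion>\<close>: this formula gives the Leibniz rules
  (for the outermost \<open>i\<close>) as well as the homotopy for commutativity (by telescoping over \<open>i\<close>).
\<close>

lemma comp_diff_op:
  assumes f: "f \<in> V m" and g: "g \<in> V n" and i: "i < m"
  shows "comp_diff (m + n - 1) (op m n i f g)
    = op (m + 1) n (i + 1) (diff_init m (i + 1) f) g + scale ((-1) ^ (n + 1)) (op (m + 1) n i (diff_tail m i f) g)
      + scale ((-1) ^ i) (op m (n + 1) i f (comp_diff n g))"
proof -
  let ?t = "\<lambda>k. scale ((-1) ^ (k + 1)) (op (m + n - 1) 2 k (op m n i f g) \<alpha>)"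
  \<comment> \<open>The faces of the composite fall into those before, inside and behind the block
    of \<open>g\<close>.\<close>
  have sum: "(\<Sum>k<m + n - 1. ?t k) = (\<Sum>k<i. ?t k) + (\<Sum>k<n. ?t (i + k)) + (\<Sum>k\<in>{i + 1..<m}. ?t (k + n - 1))"
  proof -
    have "(\<Sum>k<m + n - 1. ?t k) = (\<Sum>k<i. ?t k) + (\<Sum>k\<in>{i..<i + n}. ?t k) + (\<Sum>k\<in>{i + n..<m + n - 1}. ?t k)"
      using i by (simp add: lessThan_atLeast0 sum.atLeastLessThan_concat)
    moreover have "(\<Sum>k\<in>{i..<i + n}. ?t k) = (\<Sum>k<n. ?t (i + k))"
      by (rule sum.reindex_bij_witness[of _ "\<lambda>k. i + k" "\<lambda>k. k - i"]) auto
    moreover have "(\<Sum>k\<in>{i + n..<m + n - 1}. ?t k) = (\<Sum>k\<in>{i + 1..<m}. ?t (k + n - 1))"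
      by (rule sum.reindex_bij_witness[of _ "\<lambda>k. k + n - 1" "\<lambda>k. k + 1 - n"]) auto
    ultimately show ?thesis by simp
  qed
  \<comment> \<open>The exchange axiom with \<open>\<alpha>\<close> handles the faces outside the
    block: here with \<open>\<alpha>\<close> inserted last, in \<open>3\<close> with
    \<open>\<alpha>\<close> inserted first. Inside the block, \<open>2\<close> is
    associativity.\<close>
  have 1: "(\<Sum>k<i. ?t k) = (\<Sum>k<i. scale ((-1) ^ (k + 1)) (op (m + 1) n (i + 1) (op m 2 k f \<alpha>) g))"
    using op_alpha_swap[OF f g] by simp
  have 2: "(\<Sum>k<n. ?t (i + k)) = scale ((-1) ^ i) (\<Sum>k<n. scale ((-1) ^ (k + 1)) (op m (n + 1) i f (op n 2 k g \<alpha>)))"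
    unfolding scale_sum_right
    by (intro sum.cong refl) (use op_assoc_alpha[OF f g, of i] in \<open>simp add: power_add\<close>)
  have 3: "(\<Sum>k\<in>{i + 1..<m}. ?t (k + n - 1))
      = scale ((-1) ^ (n + 1)) (\<Sum>k\<in>{i + 1..<m}. scale ((-1) ^ (k + 1)) (op (m + 1) n i (op m 2 k f \<alpha>) g))"
    unfolding scale_sum_right
  proof (intro sum.cong refl)
    fix k assume k: "k \<in> {i + 1..<m}"
    have "op (m + 1) n i (op m 2 k f \<alpha>) g = op (m + n - 1) 2 (k + n - 1) (op m n i f g) \<alpha>"
      using op_swap[OF f alpha_closed g, of i k] k by simp
    moreover have "(-1 :: 'k) ^ (k + n - 1 + 1) = (-1) ^ (n + 1) * (-1) ^ (k + 1)"
      using k by (simp add: power_add)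
    ultimately show "?t (k + n - 1) = scale ((-1) ^ (n + 1)) (scale ((-1) ^ (k + 1)) (op (m + 1) n i (op m 2 k f \<alpha>) g))"
      by simp
  qed
  have 4: "op 2 (m + n - 1) 1 \<alpha> (op m n i f g) = op (m + 1) n (i + 1) (op 2 m 1 \<alpha> f) g"
    "op 2 (m + n - 1) 0 \<alpha> (op m n i f g) = op (m + 1) n i (op 2 m 0 \<alpha> f) g"
    using alpha_op_assoc[OF f g, of 1 "i + 1"] alpha_op_assoc[OF f g, of 0 i] i by simp_all
  \<comment> \<open>The first and last terms of the differential of \<open>g\<close> are faces of
    \<open>f\<close> at position \<open>i\<close>. They cancel the summand \<open>k = i\<close> that
    occurs both in \<open>diff_init m (i + 1) f\<close> and in
    \<open>diff_tail m i f\<close>.\<close>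
  have 5: "op m (n + 1) i f (op 2 n 1 \<alpha> g) = op (m + 1) n (i + 1) (op m 2 i f \<alpha>) g"
    "op m (n + 1) i f (op 2 n 0 \<alpha> g) = op (m + 1) n i (op m 2 i f \<alpha>) g"
    using op_alpha_assoc[OF f g, of i "i + 1"] op_alpha_assoc[OF f g, of i i] by simp_all
  note closed = alpha_op_closed op_alpha_closed f g
    subspace_add[OF graded] subspace_sum[OF graded] subspace_scale[OF graded]
  have init: "op (m + 1) n (i + 1) (diff_init m (i + 1) f) g = op (m + 1) n (i + 1) (op 2 m 1 \<alpha> f) g
      + (\<Sum>k<i. scale ((-1) ^ (k + 1)) (op (m + 1) n (i + 1) (op m 2 k f \<alpha>) g))
      + scale ((-1) ^ (i + 1)) (op (m + 1) n (i + 1) (op m 2 i f \<alpha>) g)"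
    unfolding diff_init_def
    by (subst op_add_left, (intro closed)+, subst op_sum_left, (intro closed)+) (simp add: add.assoc)
  have tail: "op (m + 1) n i (diff_tail m i f) g = scale ((-1) ^ (i + 1)) (op (m + 1) n i (op m 2 i f \<alpha>) g)
      + (\<Sum>k\<in>{i + 1..<m}. scale ((-1) ^ (k + 1)) (op (m + 1) n i (op m 2 k f \<alpha>) g))
      + scale ((-1) ^ (m + 1)) (op (m + 1) n i (op 2 m 0 \<alpha> f) g)"
    unfolding diff_tail_def
    by (subst op_add_left, (intro closed)+, subst op_sum_left, (intro closed)+, subst op_scale_left, (intro closed)+)
       (simp add: sum.atLeast_Suc_lessThan[OF i])
  have dg: "op m (n + 1) i f (comp_diff n g) = op (m + 1) n (i + 1) (op m 2 i f \<alpha>) g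
      + (\<Sum>k<n. scale ((-1) ^ (k + 1)) (op m (n + 1) i f (op n 2 k g \<alpha>)))
      + scale ((-1) ^ (n + 1)) (op (m + 1) n i (op m 2 i f \<alpha>) g)"
    unfolding comp_diff_def 5[symmetric]
    by (subst op_add_right, (intro closed)+, subst op_add_right, (intro closed)+,
        subst op_sum_right, (intro closed)+, subst op_scale_right, (intro closed)+) (rule refl)
  have sign: "(-1 :: 'k) ^ (m + n - 1 + 1) = (-1) ^ (n + 1) * (-1) ^ (m + 1)"
    using i by (simp add: power_add)
  have "comp_diff (m + n - 1) (op m n i f g) = op (m + 1) n (i + 1) (op 2 m 1 \<alpha> f) g
      + ((\<Sum>k<i. scale ((-1) ^ (k + 1)) (op (m + 1) n (i + 1) (op m 2 k f \<alpha>) g))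
      + scale ((-1) ^ i) (\<Sum>k<n. scale ((-1) ^ (k + 1)) (op m (n + 1) i f (op n 2 k g \<alpha>)))
      + scale ((-1) ^ (n + 1)) (\<Sum>k\<in>{i + 1..<m}. scale ((-1) ^ (k + 1)) (op (m + 1) n i (op m 2 k f \<alpha>) g)))
      + scale ((-1) ^ (n + 1) * (-1) ^ (m + 1)) (op (m + 1) n i (op 2 m 0 \<alpha> f) g)"
    unfolding comp_diff_def[of "m + n - 1"] sum 1 2 3 4 sign ..
  then show ?thesis
    unfolding init tail dg
    by (simp add: scale_right_distrib power_add algebra_simps)
qed

text \<open>\<open>comp_diff_op\<close> is applied to \<open>\<alpha> \<diamond>\<^sub>0 f\<close>
  at its last position \<open>m\<close>. There the tail consists of two equal terms of opposite
  sign, and the initial part is \<open>\<alpha> \<diamond>\<^sub>0\<close> the differential of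
  \<open>f\<close>.\<close>

lemma comp_diff_cup:
  assumes f: "f \<in> V m" and g: "g \<in> V n"
  shows "comp_diff (m + n) (comp_cup m n f g)
    = comp_cup (m + 1) n (comp_diff m f) g + scale ((-1) ^ m) (comp_cup m (n + 1) f (comp_diff n g))"
proof -
  let ?h = "op 2 m 0 \<alpha> f"
  note closed = alpha_op_closed op_alpha_closed f
    subspace_add[OF graded] subspace_sum[OF graded] subspace_scale[OF graded] alpha_closed
  have h: "?h \<in> V (m + 1)" by (rule alpha_op_closed[OF f])
  \<comment> \<open>Both sides are
    \<open>(\<alpha> \<diamond>\<^sub>0 \<alpha>) \<diamond>\<^sub>0 f\<close>: the left by the
    exchange axiom and \<open>alpha_alpha\<close>, the right by associativity.\<close>
  have last: "op (m + 1) 2 m ?h \<alpha> = op 2 (m + 1) 0 \<alpha> ?h"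
    using op_swap[OF alpha_closed alpha_closed f, of 0 1] alpha_alpha_op(1)[OF f, of 0] alpha_alpha
    by (simp add: numeral_3_eq_3 numeral_2_eq_2)
  have "diff_init (m + 1) (m + 1) ?h = op 2 (m + 1) 0 \<alpha> (comp_diff m f)"
  proof -
    have "op (m + 1) 2 k ?h \<alpha> = op 2 (m + 1) 0 \<alpha> (op m 2 k f \<alpha>)" if "k < m" for k
      using alpha_op_assoc[OF f alpha_closed, of 0 k] that by simp
    moreover have "op 2 (m + 1) 1 \<alpha> ?h = op 2 (m + 1) 0 \<alpha> (op 2 m 1 \<alpha> f)"
      using alpha_alpha_op[OF f] by simp
    moreover have "op 2 (m + 1) 0 \<alpha> (comp_diff m f) = op 2 (m + 1) 0 \<alpha> (op 2 m 1 \<alpha> f)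
        + (\<Sum>k<m. scale ((-1) ^ (k + 1)) (op 2 (m + 1) 0 \<alpha> (op m 2 k f \<alpha>)))
        + scale ((-1) ^ (m + 1)) (op 2 (m + 1) 0 \<alpha> ?h)"
      unfolding comp_diff_def
      by (subst op_add_right, (intro closed)+, subst op_add_right, (intro closed)+,
          subst op_sum_right, (intro closed)+, subst op_scale_right, (intro closed)+) (rule refl)
    ultimately show ?thesis
      by (simp add: diff_init_def last[simplified] add.assoc)
  qed
  moreover have "diff_tail (m + 1) m ?h = 0"
    by (simp add: diff_tail_def last[simplified])
  ultimately show ?thesis
    using comp_diff_op[OF h g, of m]
    by (simp add: comp_cup_def op_zero_left[OF g])
qed

text \<open>Mirror image at position 0: now the initial part cancels and the tail is minus
  \<open>\<alpha> \<diamond>\<^sub>1\<close> the differential of \<open>g\<close>. This minus turns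
  the sign \<open>(-1) ^ (m + 1)\<close> of \<open>comp_diff_op\<close> into
  \<open>(-1) ^ m\<close>.\<close>

lemma comp_diff_sqcup:
  assumes f: "f \<in> V m" and g: "g \<in> V n"
  shows "comp_diff (m + n) (comp_sqcup m n f g)
    = comp_sqcup (m + 1) n (comp_diff m f) g + scale ((-1) ^ m) (comp_sqcup m (n + 1) f (comp_diff n g))"
proof -
  let ?h = "op 2 n 1 \<alpha> g"
  note closed = alpha_op_closed op_alpha_closed g
    subspace_add[OF graded] subspace_sum[OF graded] subspace_scale[OF graded] alpha_closed
  have h: "?h \<in> V (n + 1)" by (rule alpha_op_closed[OF g])
  have first: "op (n + 1) 2 0 ?h \<alpha> = op 2 (n + 1) 1 \<alpha> ?h"
    using op_swap[OF alpha_closed g alpha_closed, of 0 1] alpha_alpha_op(2)[OF g, of 1] alpha_alpha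
    by (simp add: numeral_3_eq_3 numeral_2_eq_2)
  have "diff_tail (n + 1) 0 ?h = scale (-1) (op 2 (n + 1) 1 \<alpha> (comp_diff n g))"
  proof -
    have "op (n + 1) 2 (Suc k) ?h \<alpha> = op 2 (n + 1) 1 \<alpha> (op n 2 k g \<alpha>)" if "k < n" for k
      using alpha_op_assoc[OF g alpha_closed, of 1 "Suc k"] that by simp
    moreover have "op 2 (n + 1) 0 \<alpha> ?h = op 2 (n + 1) 1 \<alpha> (op 2 n 0 \<alpha> g)"
      using alpha_alpha_op[OF g] by simp
    moreover have "op 2 (n + 1) 1 \<alpha> (comp_diff n g) = op 2 (n + 1) 1 \<alpha> ?h
        + (\<Sum>k<n. scale ((-1) ^ (k + 1)) (op 2 (n + 1) 1 \<alpha> (op n 2 k g \<alpha>)))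
        + scale ((-1) ^ (n + 1)) (op 2 (n + 1) 1 \<alpha> (op 2 n 0 \<alpha> g))"
      unfolding comp_diff_def
      by (subst op_add_right, (intro closed)+, subst op_add_right, (intro closed)+,
          subst op_sum_right, (intro closed)+, subst op_scale_right, (intro closed)+) (rule refl)
    moreover have "diff_tail (n + 1) 0 ?h = scale (-1) (op (n + 1) 2 0 ?h \<alpha>)
        + (\<Sum>k<n. scale ((-1) ^ (Suc k + 1)) (op (n + 1) 2 (Suc k) ?h \<alpha>))
        + scale ((-1) ^ (n + 1 + 1)) (op 2 (n + 1) 0 \<alpha> ?h)"
      by (simp add: diff_tail_def atLeast0LessThan sum.lessThan_Suc_shift del: sum.lessThan_Suc)
    ultimately show ?thesis
      unfolding first by (simp add: scale_right_distrib sum_negf)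
  qed
  moreover have "diff_init (n + 1) 1 ?h = 0"
    by (simp add: diff_init_def first[simplified])
  ultimately show ?thesis
    using comp_diff_op[OF h f, of 0] f g
    by (simp add: comp_sqcup_def op_zero_left[OF f] op_minus_left[of _ "Suc (Suc n)"] alpha_op_closed[of _ "Suc n", simplified]
        comp_diff_closed[simplified] add.commute)
qed

text \<open>For a cocycle \<open>f\<close> the tail is minus the initial part, so the differentials
  of the partial products telescope after weighting. The exponent \<open>i * (n + 1)\<close> has the
  parity of \<open>i * (n - 1)\<close> and avoids truncation at \<open>n = 0\<close>.\<close>

lemma comp_cup_sqcup_homotopy:
  assumes f: "f \<in> V m" "comp_diff m f = 0" and g: "g \<in> V n" "comp_diff n g = 0"
  shows "scale ((-1) ^ (m * n)) (comp_cup m n f g) - comp_sqcup n m g f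
    = scale ((-1) ^ (n + 1)) (comp_diff (m + n - 1) (\<Sum>i<m. scale ((-1) ^ (i * (n + 1))) (op m n i f g)))"
proof -
  let ?w = "(-1 :: 'k) ^ (n + 1)"
  \<comment> \<open>\<open>X\<close> runs from \<open>comp_sqcup n m g f\<close> at 0 to a signed
    \<open>comp_cup m n f g\<close> at \<open>m\<close>.\<close>
  define X where "X i = op (m + 1) n i (diff_init m i f) g" for i
  have tail: "diff_tail m i f = scale (-1) (diff_init m i f)" if "i \<le> m" for i
    using comp_diff_split[OF that, of f] f(2) by (simp add: eq_neg_iff_add_eq_0 add.commute)
  have "comp_diff (m + n - 1) (op m n i f g) = X (i + 1) + scale ((-1) ^ n) (X i)" if "i < m" for i
    unfolding X_def using comp_diff_op[OF f(1) g(1) that] that f g diff_init_closed[OF f(1)]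
    by (simp add: tail op_minus_left[of _ "Suc m"] op_zero_right)
  then have step: "comp_diff (m + n - 1) (op m n i f g) = X (Suc i) - scale ?w (X i)" if "i < m" for i
    using that by simp
  have summand: "scale ?w (scale ((-1) ^ (i * (n + 1))) (X (Suc i) - scale ?w (X i)))
      = scale ((-1) ^ (Suc i * (n + 1))) (X (Suc i)) - scale ((-1) ^ (i * (n + 1))) (X i)" for i
  proof -
    have "?w * ?w = 1"
      by (simp flip: power_mult_distrib)
    then have "?w * ((-1) ^ (i * (n + 1)) * ?w) = (-1) ^ (i * (n + 1))"
      by (metis mult.left_commute mult.right_neutral)
    moreover have "(-1) ^ (Suc i * (n + 1)) = ?w * (-1) ^ (i * (n + 1))"
      by (simp only: mult_Suc power_add)
    ultimately show ?thesis
      by (simp only: scale_right_diff_distrib scale_scale)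
  qed
  have "scale ?w (comp_diff (m + n - 1) (\<Sum>i<m. scale ((-1) ^ (i * (n + 1))) (op m n i f g)))
      = scale ?w (\<Sum>i<m. scale ((-1) ^ (i * (n + 1))) (comp_diff (m + n - 1) (op m n i f g)))"
    by (subst linear_map_on_sum[OF vector_space_axioms graded comp_diff_linear]) (rule op_closed[OF f(1) g(1)], rule refl)
  also have "\<dots> = (\<Sum>i<m. scale ((-1) ^ (Suc i * (n + 1))) (X (Suc i)) - scale ((-1) ^ (i * (n + 1))) (X i))"
    unfolding scale_sum_right by (intro sum.cong refl) (simp only: step summand lessThan_iff)
  also have "\<dots> = scale ((-1) ^ (m * (n + 1))) (X m) - X 0"
    by (rule trans[OF sum_lessThan_telescope[of "\<lambda>i. scale ((-1) ^ (i * (n + 1))) (X i)"]]) simp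
  also have "X 0 = comp_sqcup n m g f"
    by (simp add: X_def diff_init_def comp_sqcup_def)
  also have "X m = scale ((-1) ^ m) (comp_cup m n f g)"
  proof -
    \<comment> \<open>At \<open>i = m\<close> only the last term of the differential is left in the
      tail.\<close>
    have "scale (-1) (diff_init m m f) = scale (-1) (scale ((-1) ^ m) (op 2 m 0 \<alpha> f))"
      using tail[of m] by (simp add: diff_tail_def)
    then have "diff_init m m f = scale ((-1) ^ m) (op 2 m 0 \<alpha> f)"
      by simp
    then show ?thesis
      using f g by (simp add: X_def comp_cup_def op_scale_left[of _ "Suc m"] alpha_op_closed[simplified])
  qed
  finally show ?thesis
    by (simp add: power_add)
qed

section \<open>Cocycles, coboundaries and descent of products\<close>

definition comp_cocycles :: "nat \<Rightarrow> 'v set" where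
  "comp_cocycles n = {f \<in> V n. comp_diff n f = 0}"

definition comp_coboundaries :: "nat \<Rightarrow> 'v set" where
  "comp_coboundaries n = (if n = 0 then {0} else comp_diff (n - 1) ` V (n - 1))"

lemma comp_diff_add: "f \<in> V n \<Longrightarrow> g \<in> V n \<Longrightarrow> comp_diff n (f + g) = comp_diff n f + comp_diff n g"
  using comp_diff_linear[of n] by (simp add: linear_map_on_def)

lemma comp_diff_scale: "f \<in> V n \<Longrightarrow> comp_diff n (scale r f) = scale r (comp_diff n f)"
  using comp_diff_linear[of n] by (simp add: linear_map_on_def)

lemma comp_diff_zero: "comp_diff n 0 = 0"
  using comp_diff_scale[OF subspace_0[OF graded], of n 0] by simp

lemma comp_diff_in_coboundaries: "f \<in> V n \<Longrightarrow> comp_diff n f \<in> comp_coboundaries (Suc n)"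
  by (simp add: comp_coboundaries_def)

lemma subspace_comp_cocycles: "subspace (comp_cocycles n)"
  by (rule subspaceI)
     (auto simp: comp_cocycles_def comp_diff_zero comp_diff_add comp_diff_scale
       intro: subspace_0 subspace_add subspace_scale graded)

lemma subspace_comp_coboundaries: "subspace (comp_coboundaries n)"
proof (cases n)
  case (Suc n')
  have "0 \<in> comp_diff n' ` V n'"
    using comp_diff_zero subspace_0[OF graded] by (metis image_eqI)
  moreover have "comp_diff n' f + comp_diff n' g \<in> comp_diff n' ` V n'" if "f \<in> V n'" "g \<in> V n'" for f g
    using comp_diff_add[OF that] subspace_add[OF graded that] by (metis image_eqI)
  moreover have "scale r (comp_diff n' f) \<in> comp_diff n' ` V n'" if "f \<in> V n'" for r f
    using comp_diff_scale[OF that] subspace_scale[OF graded that] by (metis image_eqI)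
  ultimately show ?thesis
    using Suc by (auto simp: comp_coboundaries_def intro!: subspaceI)
qed (simp add: comp_coboundaries_def)

end

text \<open>Collects what descent to cohomology needs, so that it is proved once for both
  products.\<close>

locale comp_product = weak_comp_algebra +
  fixes P :: "nat \<Rightarrow> nat \<Rightarrow> 'b \<Rightarrow> 'b \<Rightarrow> 'b"
  assumes P_closed: "f \<in> V m \<Longrightarrow> g \<in> V n \<Longrightarrow> P m n f g \<in> V (m + n)"
    and P_bilinear: "bilinear_map_on (V m) scale (V n) scale scale (P m n)"
    and P_diff: "f \<in> V m \<Longrightarrow> g \<in> V n \<Longrightarrow> comp_diff (m + n) (P m n f g)
      = P (m + 1) n (comp_diff m f) g + scale ((-1) ^ m) (P m (n + 1) f (comp_diff n g))"
begin

lemma P_zero: "f \<in> V m \<Longrightarrow> P m n f 0 = 0" "g \<in> V n \<Longrightarrow> P m n 0 g = 0"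
proof -
  note lin = P_bilinear[of m n, unfolded bilinear_map_on_def linear_map_on_def]
  show "P m n f 0 = 0" if "f \<in> V m"
  proof -
    have "P m n f (0 + 0) = P m n f 0 + P m n f 0"
      using lin subspace_0[OF graded, of n] that by blast
    then show ?thesis by simp
  qed
  show "P m n 0 g = 0" if "g \<in> V n"
  proof -
    have "P m n (0 + 0) g = P m n 0 g + P m n 0 g"
      using lin subspace_0[OF graded, of m] that by blast
    then show ?thesis by simp
  qed
qed

lemma P_cocycles: "f \<in> comp_cocycles m \<Longrightarrow> g \<in> comp_cocycles n \<Longrightarrow> P m n f g \<in> comp_cocycles (m + n)"
  by (simp add: comp_cocycles_def P_closed P_diff P_zero)

lemma P_coboundary_left:
  assumes "f \<in> comp_coboundaries m" "g \<in> comp_cocycles n"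
  shows "P m n f g \<in> comp_coboundaries (m + n)"
proof (cases m)
  case 0
  then show ?thesis
    using assms subspace_0[OF subspace_comp_coboundaries] by (simp add: comp_coboundaries_def comp_cocycles_def P_zero)
next
  case (Suc m')
  then obtain h where h: "h \<in> V m'" "f = comp_diff m' h"
    using assms(1) by (auto simp: comp_coboundaries_def)
  then have "P m n f g = comp_diff (m' + n) (P m' n h g)"
    using assms(2) Suc by (simp add: comp_cocycles_def P_diff P_zero)
  then show ?thesis
    using comp_diff_in_coboundaries[OF P_closed[OF h(1)], of g n] assms(2) Suc by (simp add: comp_cocycles_def)
qed

lemma P_coboundary_right:
  assumes "f \<in> comp_cocycles m" "g \<in> comp_coboundaries n"
  shows "P m n f g \<in> comp_coboundaries (m + n)"
proof (cases n)
  case 0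
  then show ?thesis
    using assms subspace_0[OF subspace_comp_coboundaries] by (simp add: comp_coboundaries_def comp_cocycles_def P_zero)
next
  case (Suc n')
  then obtain h where h: "h \<in> V n'" "g = comp_diff n' h"
    using assms(2) by (auto simp: comp_coboundaries_def)
  have f: "f \<in> V m" "comp_diff m f = 0"
    using assms(1) by (simp_all add: comp_cocycles_def)
  have "(-1 :: 'a) ^ m * (-1) ^ m = 1"
    by (simp flip: power_mult_distrib)
  then have "P m n f g = scale ((-1) ^ m) (comp_diff (m + n') (P m n' f h))"
    using f h Suc comp_diff_closed[OF h(1)] by (simp add: P_diff P_zero)
  also have "\<dots> \<in> comp_coboundaries (m + n)"
    using comp_diff_in_coboundaries[OF P_closed[OF f(1) h(1)]] Suc
    by (auto intro: subspace_scale[OF subspace_comp_coboundaries])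
  finally show ?thesis .
qed

text \<open>The two arguments are exchanged one at a time, through the intermediate product of
  \<open>f'\<close> and \<open>g\<close>.\<close>

lemma P_class_cong:
  assumes f: "f \<in> comp_cocycles m" "f' \<in> comp_cocycles m" "f +o comp_coboundaries m = f' +o comp_coboundaries m"
    and g: "g \<in> comp_cocycles n" "g' \<in> comp_cocycles n" "g +o comp_coboundaries n = g' +o comp_coboundaries n"
  shows "P m n f g +o comp_coboundaries (m + n) = P m n f' g' +o comp_coboundaries (m + n)"
proof -
  note V = f(1,2)[unfolded comp_cocycles_def] g(1,2)[unfolded comp_cocycles_def]
  have "P m n (f - f') g \<in> comp_coboundaries (m + n)"
    by (rule P_coboundary_left) (use f(3) g(1) in \<open>simp_all add: coset_eq_iff[OF subspace_comp_coboundaries]\<close>)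
  moreover have "P m n f' (g - g') \<in> comp_coboundaries (m + n)"
    by (rule P_coboundary_right) (use f(2) g(3) in \<open>simp_all add: coset_eq_iff[OF subspace_comp_coboundaries]\<close>)
  moreover have "P m n f g = P m n (f - f') g + P m n f' g"
  proof -
    have "P m n ((f - f') + f') g = P m n (f - f') g + P m n f' g"
      using P_bilinear[of m n] V subspace_diff[OF graded, of f m f']
      unfolding bilinear_map_on_def linear_map_on_def by blast
    then show ?thesis by simp
  qed
  moreover have "P m n f' g = P m n f' (g - g') + P m n f' g'"
  proof -
    have "P m n f' ((g - g') + g') = P m n f' (g - g') + P m n f' g'"
      using P_bilinear[of m n] V subspace_diff[OF graded, of g n g']
      unfolding bilinear_map_on_def linear_map_on_def by blast
    then show ?thesis by simp
  qed
  ultimately show ?thesis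
    unfolding coset_eq_iff[OF subspace_comp_coboundaries]
    using subspace_add[OF subspace_comp_coboundaries] by simp
qed

end

lemma (in weak_comp_algebra) comp_cup_sqcup_class:
  assumes f: "f \<in> comp_cocycles m" and g: "g \<in> comp_cocycles n"
  shows "comp_cup m n f g +o comp_coboundaries (m + n)
    = scale ((-1) ^ (m * n)) (comp_sqcup n m g f) +o comp_coboundaries (m + n)"
proof -
  let ?s = "(-1 :: 'k) ^ (m * n)"
  have fg: "f \<in> V m" "comp_diff m f = 0" "g \<in> V n" "comp_diff n g = 0"
    using f g by (simp_all add: comp_cocycles_def)
  let ?S = "\<Sum>i<m. scale ((-1) ^ (i * (n + 1))) (op m n i f g)"
  have "comp_diff (m + n - 1) ?S \<in> comp_coboundaries (m + n)"
  \<comment> \<open>For \<open>m = 0\<close> the sum is empty; otherwise \<open>m + n - 1\<close> is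
    the true degree of the homotopy.\<close>
  proof (cases "m = 0")
    case True
    then show ?thesis
      by (simp add: comp_diff_zero subspace_0[OF subspace_comp_coboundaries])
  next
    case False
    have "?S \<in> V (m + n - 1)"
      by (intro subspace_sum subspace_scale graded op_closed fg)
    then show ?thesis
      using comp_diff_in_coboundaries[of ?S "m + n - 1"] False by simp
  qed
  \<comment> \<open>The sign is its own inverse, so a second factor \<open>?s\<close> isolates the
    cup product.\<close>
  then have "scale ?s (scale ?s (comp_cup m n f g) - comp_sqcup n m g f) \<in> comp_coboundaries (m + n)"
    unfolding comp_cup_sqcup_homotopy[OF fg]
    by (intro subspace_scale[OF subspace_comp_coboundaries])
  moreover have "?s * ?s = 1"
    by (simp flip: power_mult_distrib)
  ultimately show ?thesis
    unfolding coset_eq_iff[OF subspace_comp_coboundaries] by (simp add: scale_right_diff_distrib)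
qed


section \<open>Cup products on cohomology\<close>

context entwining_structure_over
begin

interpretation comp: weak_comp_algebra "cochain_scale E" "cochains E" "diamond E" "alpha E"
  by (rule weak_comp_algebra_cochains)

lemma form_of_sum: "form_of n (\<Sum>k\<in>I. h k) c xs b = (\<Sum>k\<in>I. form_of n (h k) c xs b)"
  by (induction I rule: infinite_finite_induct) (simp_all add: form_of_def apply_cochain_def)

text \<open>The inner faces of the differential are composites with \<open>alpha\<close>. Positions
  count from 0 and matrix indices from 1, hence \<open>k + 1\<close>.\<close>

lemma form_of_diamond_alpha:
  assumes f: "f \<in> cochains E n" and k: "k < n"
  shows "form_of (n + 1) (diamond E n 2 k f (alpha E)) c (map a [1..<Suc (n + 1)]) b
    = apply_cochain E n f c (tmat_merge (zeta E) (k + 1) (a, b))"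
proof -
  let ?us = "map a [1..<Suc k]" and ?ws = "map a [k + 3..<Suc (n + 1)]"
  let ?z = "zeta E (b (k + 1) (k + 2)) * a (k + 1) * a (k + 2)"
  obtain a' b' where T: "tmat_merge (zeta E) (k + 1) (a, b) = (a', b')"
    by fastforce
  have a': "a' l = (if l = k + 1 then ?z else if l \<le> k then a l else a (Suc l))" for l
    using T by (auto simp: tmat_merge_def Let_def)
  \<comment> \<open>The two descriptions of the merged matrix need only be compared above the
    diagonal, which is all that a form sees.\<close>
  have b': "bmerge (place k 2) b r s = b' r s" if "r < s" for r s
    using T that by (auto simp: tmat_merge_def Let_def bmerge_def fibre_place block_def numeral_2_eq_2)
  have "[1..<Suc (n + 1)] = [1..<Suc k] @ (k + 1) # (k + 2) # [k + 3..<Suc (n + 1)]"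
    using k upt_add_eq_append[of 1 "Suc k" "n + 1 - k"]
    by (simp add: upt_conv_Cons[of "Suc k"] upt_conv_Cons[of "Suc (Suc k)"] numeral_3_eq_3 del: upt_Suc)
  then have xs: "map a [1..<Suc (n + 1)] = ?us @ a (k + 1) # a (k + 2) # ?ws"
    by simp
  have "form_of (n + 1) (diamond E n 2 k f (alpha E)) c (map a [1..<Suc (n + 1)]) b
      = dform 2 k (form_of n f) (form_of 2 (alpha E)) c (map a [1..<Suc (n + 1)]) b"
    using form_of_diamond[OF f alpha_in_cochains k] by simp
  also have "\<dots> = dform 2 k (form_of n f) aform c (map a [1..<Suc (n + 1)]) b"
    by (rule dform_cong[of n _ _ 2]) (use k in \<open>auto simp: form_of_alpha\<close>)
  also have "\<dots> = form_of n f c (?us @ ?z # ?ws) (bmerge (place k 2) b)"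
    unfolding xs by (rule dform_aform[OF mform_form_of[OF f]]) (use k in auto)
  also have "?us @ ?z # ?ws = map a' [1..<Suc n]"
    by (intro nth_equalityI) (use k in \<open>auto simp: a' nth_append nth_Cons numeral_3_eq_3 simp del: upt_Suc split: nat.split\<close>,
        rule arg_cong[of _ _ a], linarith)
  also have "form_of n f c (map a' [1..<Suc n]) (bmerge (place k 2) b) = form_of n f c (map a' [1..<Suc n]) b'"
    by (rule mform_cong[OF mform_form_of[OF f]]) (simp_all add: b' del: upt_Suc)
  finally show ?thesis
    by (simp only: T apply_cochain_form)
qed

lemma differential_eq:
  assumes f: "f \<in> cochains E n"
  shows "differential E n f = comp.comp_diff n f"
proof -
  have form: "zeta E (\<Prod>j=2..n+1. b 1 j) *
        sweedler (scaleA E) (\<lambda>(x, c'). x * apply_cochain E n f c' (tmat_shift 1 (a, b))) (psi E c (a 1))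
      + (\<Sum>i=1..n. scaleA E ((-1) ^ i) (apply_cochain E n f c (tmat_merge (zeta E) i (a, b))))
      + scaleA E ((-1) ^ (n + 1)) (zeta E (\<Prod>r=1..n. b r (n + 1)) * apply_cochain E n f c (a, b) * a (n + 1))
    = form_of (n + 1) (comp.comp_diff n f) c (map a [1..<Suc (n + 1)]) b" for c a b
  proof -
    have dform: "form_of (n + 1) (diamond E 2 n i (alpha E) f) c (map a [1..<Suc (n + 1)]) b
        = dform n i aform (form_of n f) c (map a [1..<Suc (n + 1)]) b" if "i < 2" for i
    proof -
      have "form_of (n + 1) (diamond E 2 n i (alpha E) f) c (map a [1..<Suc (n + 1)]) b
          = dform n i (form_of 2 (alpha E)) (form_of n f) c (map a [1..<Suc (n + 1)]) b"
        using form_of_diamond[OF alpha_in_cochains f that] by simp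
      also have "\<dots> = dform n i aform (form_of n f) c (map a [1..<Suc (n + 1)]) b"
        by (rule dform_cong[of 2 _ _ n]) (use that in \<open>auto simp: form_of_alpha\<close>)
      finally show ?thesis .
    qed
    have "form_of (n + 1) (diamond E 2 n 1 (alpha E) f) c (map a [1..<Suc (n + 1)]) b
        = zeta E (\<Prod>j=2..n+1. b 1 j) *
          sweedler (scaleA E) (\<lambda>(x, c'). x * apply_cochain E n f c' (tmat_shift 1 (a, b))) (psi E c (a 1))"
    proof -
      have "map a [1..<Suc (n + 1)] = a 1 # map a [Suc 1..<Suc (1 + n)]"
        by (simp add: upt_conv_Cons del: upt_Suc)
      then show ?thesis
        using dform[of 1] dform_aform_right[OF mform_form_of[OF f], of "map a [Suc 1..<Suc (1 + n)]" c "a 1" b]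
        by (simp add: sweedler_psi ext_def apply_cochain_shift del: upt_Suc One_nat_def)
    qed
    moreover have "form_of (n + 1) (diamond E 2 n 0 (alpha E) f) c (map a [1..<Suc (n + 1)]) b
        = zeta E (\<Prod>r=1..n. b r (n + 1)) * apply_cochain E n f c (a, b) * a (n + 1)"
    proof -
      have "map a [1..<Suc (n + 1)] = map a [1..<Suc n] @ [a (n + 1)]" by simp
      then show ?thesis
        using dform[of 0] dform_aform_left[OF mform_form_of[OF f], of "map a [1..<Suc n]" c "a (n + 1)" b]
        by (simp add: apply_cochain_form del: upt_Suc One_nat_def)
    qed
    moreover have "(\<Sum>i=1..n. scaleA E ((-1) ^ i) (apply_cochain E n f c (tmat_merge (zeta E) i (a, b))))
        = (\<Sum>k<n. scaleA E ((-1) ^ (k + 1))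
            (form_of (n + 1) (diamond E n 2 k f (alpha E)) c (map a [1..<Suc (n + 1)]) b))"
      unfolding sum.atLeast1_atMost_eq[folded One_nat_def]
      by (intro sum.cong refl) (simp only: lessThan_iff form_of_diamond_alpha[OF f, unfolded Suc_eq_plus1] Suc_eq_plus1)
    ultimately show ?thesis
      by (simp only: comp.comp_diff_def form_of_add form_of_sum form_of_scale)
  qed
  show ?thesis
    unfolding differential_def using comp.comp_diff_closed[OF f]
    by (rule cochain_of_eqI) (simp only: prod.case form)
qed

lemma cocycles_eq: "cocycles E n = comp.comp_cocycles n"
  by (auto simp: cocycles_def comp.comp_cocycles_def differential_eq)

lemma coboundaries_eq: "coboundaries E n = comp.comp_coboundaries n"
  by (auto simp: coboundaries_def comp.comp_coboundaries_def differential_eq image_iff)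

definition class_rep :: "nat \<Rightarrow> ('k, 'a, 'b, 'c) cochain set \<Rightarrow> ('k, 'a, 'b, 'c) cochain" where
  "class_rep n x = (SOME f. f \<in> cocycles E n \<and> x = cohomology_class E n f)"

text \<open>Choosing representatives gives a total function on sets of cochains; its independence of
  the choice on classes comes from \<open>P_class_cong\<close>.\<close>

definition induced_product ::
    "(nat \<Rightarrow> nat \<Rightarrow> ('k, 'a, 'b, 'c) cochain \<Rightarrow> ('k, 'a, 'b, 'c) cochain \<Rightarrow> ('k, 'a, 'b, 'c) cochain) \<Rightarrow>
     nat \<Rightarrow> nat \<Rightarrow> ('k, 'a, 'b, 'c) cochain set \<Rightarrow> ('k, 'a, 'b, 'c) cochain set \<Rightarrow> ('k, 'a, 'b, 'c) cochain set" where
  "induced_product P m n x y = cohomology_class E (m + n) (P m n (class_rep m x) (class_rep n y))"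

lemma HH_eq: "HH E n = cohomology_class E n ` cocycles E n"
  by (simp add: HH_def quotient_space_def cohomology_class_def)

lemma class_rep:
  assumes "f \<in> cocycles E n"
  shows "class_rep n (cohomology_class E n f) \<in> cocycles E n"
    "cohomology_class E n (class_rep n (cohomology_class E n f)) = cohomology_class E n f"
  unfolding class_rep_def by (rule someI2[of _ f]; use assms in simp)+

lemma class_add: "cohomology_class E n f + cohomology_class E n g = cohomology_class E n (f + g)"
  by (simp add: cohomology_class_def coboundaries_eq comp.coset_add[OF comp.subspace_comp_coboundaries])

lemma class_scale: "HH_scale E n r (cohomology_class E n f) = cohomology_class E n (cochain_scale E r f)"
  by (simp add: cohomology_class_def HH_scale_def coboundaries_eq comp.coset_scale[OF comp.subspace_comp_coboundaries])

text \<open>\<open>P\<close> is the explicit product and \<open>P'\<close> its expression by the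
  comp operations; their agreement on cochains is enough to transport the descent.\<close>

lemma induces_product:
  assumes P: "comp_product (cochain_scale E) (cochains E) (diamond E) (alpha E) P'"
    and eq: "\<And>m n f g. f \<in> cochains E m \<Longrightarrow> g \<in> cochains E n \<Longrightarrow> P m n f g = P' m n f g"
  shows "induces_product E P (induced_product P)"
    and "f \<in> cocycles E m \<Longrightarrow> g \<in> cocycles E n \<Longrightarrow>
      induced_product P m n (cohomology_class E m f) (cohomology_class E n g) = cohomology_class E (m + n) (P m n f g)"
proof -
  interpret P: comp_product "cochain_scale E" "cochains E" "diamond E" "alpha E" P' by (rule P)
  have Z: "f \<in> cochains E n" if "f \<in> cocycles E n" for f n
    using that by (simp add: cocycles_def)
  have closed: "P m n f g \<in> cocycles E (m + n)" if "f \<in> cocycles E m" "g \<in> cocycles E n" for m n f g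
    using P.P_cocycles that eq[OF Z Z] by (simp add: cocycles_eq)
  have on_classes: "induced_product P m n (cohomology_class E m f) (cohomology_class E n g) = cohomology_class E (m + n) (P m n f g)"
    if "f \<in> cocycles E m" "g \<in> cocycles E n" for m n f g
    using P.P_class_cong[of "class_rep m (cohomology_class E m f)" m f "class_rep n (cohomology_class E n g)" n g]
      class_rep[OF that(1)] class_rep[OF that(2)] that eq[OF Z Z]
    by (simp add: induced_product_def cocycles_eq coboundaries_eq cohomology_class_def)
  have bilin: "P m n (f + f') g = P m n f g + P m n f' g" "P m n (cochain_scale E r f) g = cochain_scale E r (P m n f g)"
    "P m n f (g + g') = P m n f g + P m n f g'" "P m n f (cochain_scale E r g) = cochain_scale E r (P m n f g)"
    if "f \<in> cocycles E m" "f' \<in> cocycles E m" "g \<in> cocycles E n" "g' \<in> cocycles E n" for m n f f' g g' r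
    using P.P_bilinear[of m n] that[THEN Z]
    by (auto simp: eq cochain_add cochain_scale_closed bilinear_map_on_def linear_map_on_def)
  have Z_closed: "f + g \<in> cocycles E n" "cochain_scale E r f \<in> cocycles E n"
    if "f \<in> cocycles E n" "g \<in> cocycles E n" for n f g r
    using that comp.subspace_comp_cocycles
    by (auto simp: cocycles_eq intro: comp.subspace_add comp.subspace_scale)
  show "induces_product E P (induced_product P)"
    unfolding induces_product_def HH_eq bilinear_map_on_def linear_map_on_def
    by (auto simp: on_classes closed class_add class_scale bilin Z_closed)
  show "f \<in> cocycles E m \<Longrightarrow> g \<in> cocycles E n \<Longrightarrow>
      induced_product P m n (cohomology_class E m f) (cohomology_class E n g) = cohomology_class E (m + n) (P m n f g)"
    by (rule on_classes)
qed

lemma comp_product_cup: "comp_product (cochain_scale E) (cochains E) (diamond E) (alpha E) comp.comp_cup"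
  by unfold_locales (fact comp.comp_cup_closed comp.comp_cup_bilinear comp.comp_diff_cup)+

lemma comp_product_sqcup: "comp_product (cochain_scale E) (cochains E) (diamond E) (alpha E) comp.comp_sqcup"
  by unfold_locales (fact comp.comp_sqcup_closed comp.comp_sqcup_bilinear comp.comp_diff_sqcup)+

lemma cup_products_on_cohomology:
  "\<exists>cupH sqcupH.
     induces_product E (cup E) cupH \<and> induces_product E (sqcup E) sqcupH \<and>
     (\<forall>m n. \<forall>x\<in>HH E m. \<forall>y\<in>HH E n.
        cupH m n x y = HH_scale E (m + n) ((-1) ^ (m * n)) (sqcupH n m y x))"
proof (intro exI conjI allI ballI)
  have cup: "cup E m n f g = comp.comp_cup m n f g" and sqcup: "sqcup E m n f g = comp.comp_sqcup m n f g"
    if "f \<in> cochains E m" "g \<in> cochains E n" for m n f g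
    using that by (simp_all only: cup_eq sqcup_eq comp.comp_cup_def comp.comp_sqcup_def)
  show "induces_product E (cup E) (induced_product (cup E))"
    by (rule induces_product(1)[OF comp_product_cup cup])
  show "induces_product E (sqcup E) (induced_product (sqcup E))"
    by (rule induces_product(1)[OF comp_product_sqcup sqcup])
  fix m n x y
  assume "x \<in> HH E m" "y \<in> HH E n"
  then obtain f g where f: "f \<in> cocycles E m" "x = cohomology_class E m f"
      and g: "g \<in> cocycles E n" "y = cohomology_class E n g"
    by (auto simp: HH_eq)
  have V: "f \<in> cochains E m" "g \<in> cochains E n"
    using f(1) g(1) by (simp_all add: cocycles_def)
  have "cohomology_class E (m + n) (cup E m n f g)
      = HH_scale E (m + n) ((-1) ^ (m * n)) (cohomology_class E (m + n) (sqcup E n m g f))"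
    using comp.comp_cup_sqcup_class[of f m g n] f(1) g(1)
    unfolding class_scale cup[OF V] sqcup[OF V(2,1)]
    by (simp add: cohomology_class_def cocycles_eq coboundaries_eq)
  then show "induced_product (cup E) m n x y
      = HH_scale E (m + n) ((-1) ^ (m * n)) (induced_product (sqcup E) n m y x)"
    using induces_product(2)[OF comp_product_cup cup f(1) g(1)] induces_product(2)[OF comp_product_sqcup sqcup g(1) f(1)]
    by (simp add: f(2) g(2) add.commute)
qed

end

theorem theorem1p1:
  fixes E :: "('k::field, 'a::{ring, monoid_mult}, 'b::{comm_ring, comm_monoid_mult},
               'c::ab_group_add) entwining_data"
  assumes "entwining_structure_over E"
  shows "weak_comp_algebra (cochain_scale E) (cochains E) (diamond E) (alpha E) \<and>
    (\<exists>cupH sqcupH.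
       induces_product E (cup E) cupH \<and> induces_product E (sqcup E) sqcupH \<and>
       (\<forall>m n. \<forall>x\<in>HH E m. \<forall>y\<in>HH E n.
          cupH m n x y = HH_scale E (m + n) ((-1) ^ (m * n)) (sqcupH n m y x)))"
  using assms
  by (intro conjI entwining_structure_over.weak_comp_algebra_cochains
      entwining_structure_over.cup_products_on_cohomology)

end
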